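(* Let $\tau$ be a positive normalised trace on $\mathcal L_{1,\infty}$. Then $\tau$ is an extreme point of the set $\mathcal{PT}$ of all positive normalised traces on $\mathcal L_{1,\infty}$ if and only if $B=\tau\circ{\rm diag}\circ D$ is an extreme point of the set $\mathfrak B$ of all Banach limits.
   Context: $\mu(n,A)$ denotes singular values; $\mathcal L_{1,\infty}=\{A\text{ compact}:\sup_n(n+1)\mu(n,A)<\infty\}$. A trace is a unitarily invariant linear functional on $\mathcal L_{1,\infty}$; positive means nonnegative on positive operators; normalised means $\tau(A)=1$ for $A\ge0$ with $\mu(n,A)=1/(n+1)$. A Banach limit is a linear functional $B$ on the real sequence space $l_\infty$ with $B\ge0$, $B(1,1,\dots)=1$, $B(Sx)=B(x)$, where $S(x_0,x_1,\dots)=(0,x_0,x_1,\dots)$. $D:l_\infty\to l_{1,\infty}$ is $(Dx)_k=\log2\cdot x_n/2^n$ for $2^n-1\le k\le2^{n+1}-2$; ${\rm diag}(x)$ is the diagonal operator with diagonal $x$ in a fixed orthonormal basis. ($\tau\circ{\rm diag}\circ D$ is known to be a Banach limit for $\tau\in\mathcal{PT}$.) *)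

theory Defs
  imports "HOL-Analysis.Analysis" "HOL-Library.Function_Algebras"
begin

text \<open>The separable Hilbert space is realised concretely as complex l2(N);
  the fixed orthonormal basis is the standard basis.
  Operators are maps on sequences, canonically zero off l2.\<close>

type_synonym vec = "nat \<Rightarrow> complex"
type_synonym op = "vec \<Rightarrow> vec"

definition l2 :: "vec set" where
  "l2 = {x. summable (\<lambda>n. (cmod (x n))\<^sup>2)}"

definition l2norm :: "vec \<Rightarrow> real" where
  "l2norm x = sqrt (\<Sum>n. (cmod (x n))\<^sup>2)"

definition l2inner :: "vec \<Rightarrow> vec \<Rightarrow> complex" where
  "l2inner x y = (\<Sum>n. x n * cnj (y n))"

definition bounded_op :: "op \<Rightarrow> bool" where
  "bounded_op A \<longleftrightarrow>
     (\<forall>x\<in>l2. A x \<in> l2) \<and>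
     (\<forall>x\<in>l2. \<forall>y\<in>l2. A (x + y) = A x + A y) \<and>
     (\<forall>x\<in>l2. \<forall>c. A (\<lambda>k. c * x k) = (\<lambda>k. c * A x k)) \<and>
     (\<exists>C. \<forall>x\<in>l2. l2norm (A x) \<le> C * l2norm x) \<and>
     (\<forall>x. x \<notin> l2 \<longrightarrow> A x = 0)"

definition opnorm :: "op \<Rightarrow> real" where
  "opnorm A = Sup {l2norm (A x) | x. x \<in> l2 \<and> l2norm x \<le> 1}"

definition rank_le :: "op \<Rightarrow> nat \<Rightarrow> bool" where
  "rank_le F n \<longleftrightarrow> bounded_op F \<and>
     (\<exists>(v :: nat \<Rightarrow> vec). \<forall>x\<in>l2. \<exists>(c :: nat \<Rightarrow> complex). F x = (\<lambda>k. \<Sum>i<n. c i * v i k))"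

definition sval :: "nat \<Rightarrow> op \<Rightarrow> real" where
  "sval n A = Inf {opnorm (A - F) | F. rank_le F n}"

definition compact_l2op :: "op \<Rightarrow> bool" where
  "compact_l2op A \<longleftrightarrow> bounded_op A \<and>
     (\<forall>(x :: nat \<Rightarrow> vec). (\<forall>j. x j \<in> l2 \<and> l2norm (x j) \<le> 1) \<longrightarrow>
        (\<exists>r::nat \<Rightarrow> nat. strict_mono r \<and>
           (\<forall>e::real>0. \<exists>N. \<forall>m\<ge>N. \<forall>n\<ge>N. l2norm (A (x (r m)) - A (x (r n))) < e)))"

definition L1inf :: "op set" where
  "L1inf = {A. compact_l2op A \<and> bdd_above (range (\<lambda>n. real (n + 1) * sval n A))}"

definition positive_op :: "op \<Rightarrow> bool" where
  "positive_op A \<longleftrightarrow> bounded_op A \<and>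
     (\<forall>x\<in>l2. Im (l2inner (A x) x) = 0 \<and> Re (l2inner (A x) x) \<ge> 0)"

definition is_adjoint :: "op \<Rightarrow> op \<Rightarrow> bool" where
  "is_adjoint U V \<longleftrightarrow> bounded_op U \<and> bounded_op V \<and>
     (\<forall>x\<in>l2. \<forall>y\<in>l2. l2inner (U x) y = l2inner x (V y))"

definition unitary_op :: "op \<Rightarrow> bool" where
  "unitary_op U \<longleftrightarrow> bounded_op U \<and> (\<forall>x\<in>l2. l2norm (U x) = l2norm x) \<and> U ` l2 = l2"

text \<open>A trace: unitarily invariant (complex-)linear functional on L_{1,infinity}.
  Values outside L1inf are irrelevant.\<close>
definition is_trace :: "(op \<Rightarrow> complex) \<Rightarrow> bool" where
  "is_trace \<tau> \<longleftrightarrow>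
     (\<forall>A\<in>L1inf. \<forall>B\<in>L1inf. \<tau> (A + B) = \<tau> A + \<tau> B) \<and>
     (\<forall>A\<in>L1inf. \<forall>c. \<tau> (\<lambda>x k. c * A x k) = c * \<tau> A) \<and>
     (\<forall>A\<in>L1inf. \<forall>U V. unitary_op U \<and> is_adjoint U V \<longrightarrow> \<tau> (U \<circ> A \<circ> V) = \<tau> A)"

definition positive_trace :: "(op \<Rightarrow> complex) \<Rightarrow> bool" where
  "positive_trace \<tau> \<longleftrightarrow> is_trace \<tau> \<and>
     (\<forall>A\<in>L1inf. positive_op A \<longrightarrow> Im (\<tau> A) = 0 \<and> Re (\<tau> A) \<ge> 0)"

definition normalised :: "(op \<Rightarrow> complex) \<Rightarrow> bool" where
  "normalised \<tau> \<longleftrightarrow>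
     (\<forall>A\<in>L1inf. positive_op A \<and> (\<forall>n. sval n A = 1 / real (n + 1)) \<longrightarrow> \<tau> A = 1)"

definition PT :: "(op \<Rightarrow> complex) set" where
  "PT = {\<tau>. positive_trace \<tau> \<and> normalised \<tau>}"

definition linf :: "(nat \<Rightarrow> real) set" where
  "linf = {x. bounded (range x)}"

definition shift :: "(nat \<Rightarrow> real) \<Rightarrow> (nat \<Rightarrow> real)" where
  "shift x = (\<lambda>n. if n = 0 then 0 else x (n - 1))"

definition banach_limit :: "((nat \<Rightarrow> real) \<Rightarrow> real) \<Rightarrow> bool" where
  "banach_limit B \<longleftrightarrow>
     (\<forall>x\<in>linf. \<forall>y\<in>linf. B (x + y) = B x + B y) \<and>
     (\<forall>x\<in>linf. \<forall>c. B (\<lambda>n. c * x n) = c * B x) \<and>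
     (\<forall>x\<in>linf. (\<forall>n. x n \<ge> 0) \<longrightarrow> B x \<ge> 0) \<and>
     B (\<lambda>_. 1) = 1 \<and>
     (\<forall>x\<in>linf. B (shift x) = B x)"

definition BL :: "((nat \<Rightarrow> real) \<Rightarrow> real) set" where
  "BL = {B. banach_limit B}"

text \<open>Extreme point of a set K of functionals considered on the domain X
  (functionals are identified when they agree on X).\<close>
definition extreme_pt_on :: "'a set \<Rightarrow> ('a \<Rightarrow> 'b::real_vector) set \<Rightarrow> ('a \<Rightarrow> 'b) \<Rightarrow> bool" where
  "extreme_pt_on X K f \<longleftrightarrow> f \<in> K \<and>
     (\<forall>g\<in>K. \<forall>h\<in>K. \<forall>t::real. 0 < t \<and> t < 1 \<and>
        (\<forall>a\<in>X. f a = t *\<^sub>R g a + (1 - t) *\<^sub>R h a) \<longrightarrow> (\<forall>a\<in>X. g a = f a \<and> h a = f a))"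

text \<open>D: (Dx)_k = log 2 * x_n / 2^n for 2^n - 1 <= k <= 2^(n+1) - 2, i.e. n = floor(log2(k+1)).\<close>
definition dyad :: "nat \<Rightarrow> nat" where
  "dyad k = nat \<lfloor>log 2 (real k + 1)\<rfloor>"

definition Dmap :: "(nat \<Rightarrow> real) \<Rightarrow> (nat \<Rightarrow> real)" where
  "Dmap x = (\<lambda>k. ln 2 * x (dyad k) / 2 ^ dyad k)"

definition diag :: "(nat \<Rightarrow> complex) \<Rightarrow> op" where
  "diag d = (\<lambda>v. if v \<in> l2 then (\<lambda>n. d n * v n) else 0)"

end

theory Submission
  imports Defs
begin

text \<open>The map sending a trace to its Banach limit is an affine bijection, so it matches extreme points.
  It is injective because a trace is invariant under conjugation with isometries, hence depends on
  a positive operator only through its singular values; averaging these over rotations of the dyadic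
  blocks replaces them, up to an arbitrarily small error, by the block means, so that
  tau(A) = B(s), where s n is the sum of the singular values over the n-th block divided by log 2.
  It is surjective because, for any Banach limit B, this formula defines an additive functional on
  the positive cone: by the Ky Fan inequalities the defect of additivity is a difference
  d (n + 1) - d n with bounded d, and B annihilates it.\<close>

section \<open>The Hilbert space of square-summable sequences\<close>

text \<open>Invariance is assumed under unitaries only, while diagonalising an operator whose chosen
  eigenvectors span a proper subspace conjugates it by a non-unitary isometry. The gap is closed by
  making room: compressing the space into the even coordinates is a combination of products of
  unitaries, and inside the enlarged space every isometry dilates to a unitary. Dyadic blocks fit
  the Ky Fan inequalities because superadditivity costs a factor 2 in the number of summands, which
  is one step from n to n + 1. The constant \<open>ln 2\<close> is the limit of the harmonic mass of
  a block, so the sequence 1/(k+1) corresponds to the constant 1. For surjectivity no decreasing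
  rearrangement has to be computed: if y has values in [1,2], then \<open>Dmap y\<close> is already
  decreasing, and every bounded x is affine in such a y. Normalisation of the functional attached to
  a trace comes last, through the harmonic sequence; hence the facts on Banach limits are stated for
  functionals without it.\<close>

lemma l2_mult_summable:
  assumes "x \<in> l2" "y \<in> l2"
  shows "summable (\<lambda>k. norm (x k * cnj (y k)))"
proof (rule summable_comparison_test')
  show "summable (\<lambda>k. (cmod (x k))\<^sup>2 + (cmod (y k))\<^sup>2)"
    using assms by (simp add: l2_def summable_add)
  show "norm (norm (x k * cnj (y k))) \<le> (cmod (x k))\<^sup>2 + (cmod (y k))\<^sup>2" for k
    using sum_squares_bound[of "cmod (x k)" "cmod (y k)"]
      mult_nonneg_nonneg[OF norm_ge_zero[of "x k"] norm_ge_zero[of "y k"]]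
    unfolding norm_mult complex_mod_cnj real_norm_def abs_mult abs_norm_cancel by linarith
qed

lemma l2_zero: "(\<lambda>_. 0) \<in> l2"
  by (simp add: l2_def)

lemma l2_add:
  assumes "x \<in> l2" "y \<in> l2"
  shows "(\<lambda>k. x k + y k) \<in> l2"
proof -
  have "summable (\<lambda>k. (cmod (x k + y k))\<^sup>2)"
  proof (rule summable_comparison_test')
    show "summable (\<lambda>k. 2 * (cmod (x k))\<^sup>2 + 2 * (cmod (y k))\<^sup>2)"
      using assms by (simp add: l2_def summable_add summable_mult)
    fix k
    have "(cmod (x k + y k))\<^sup>2 \<le> (cmod (x k) + cmod (y k))\<^sup>2"
      by (simp add: norm_triangle_ineq power_mono)
    then show "norm ((cmod (x k + y k))\<^sup>2) \<le> 2 * (cmod (x k))\<^sup>2 + 2 * (cmod (y k))\<^sup>2"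
      using sum_squares_bound[of "cmod (x k)" "cmod (y k)"] by (simp add: power2_sum)
  qed
  then show ?thesis by (simp add: l2_def)
qed

lemma l2_scale:
  assumes "x \<in> l2"
  shows "(\<lambda>k. c * x k) \<in> l2"
  using assms by (simp add: l2_def norm_mult power_mult_distrib summable_mult)

lemma l2_uminus: "x \<in> l2 \<Longrightarrow> (\<lambda>k. - x k) \<in> l2"
  by (simp add: l2_def)

lemma l2_diff: "x \<in> l2 \<Longrightarrow> y \<in> l2 \<Longrightarrow> (\<lambda>k. x k - y k) \<in> l2"
  using l2_add[of x "\<lambda>k. - y k"] l2_uminus[of y] by simp

typedef ell2 = l2
  using l2_zero by blast

setup_lifting type_definition_ell2

instantiation ell2 :: real_vector
begin

lift_definition zero_ell2 :: ell2 is "\<lambda>_. 0" by (rule l2_zero)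
lift_definition plus_ell2 :: "ell2 \<Rightarrow> ell2 \<Rightarrow> ell2" is "\<lambda>x y k. x k + y k" by (rule l2_add)
lift_definition minus_ell2 :: "ell2 \<Rightarrow> ell2 \<Rightarrow> ell2" is "\<lambda>x y k. x k - y k" by (rule l2_diff)
lift_definition uminus_ell2 :: "ell2 \<Rightarrow> ell2" is "\<lambda>x k. - x k" by (rule l2_uminus)
lift_definition scaleR_ell2 :: "real \<Rightarrow> ell2 \<Rightarrow> ell2" is "\<lambda>r x k. of_real r * x k"
  by (rule l2_scale)

instance
  by standard (transfer; simp add: fun_eq_iff algebra_simps)+

end

instantiation ell2 :: real_inner
begin

lift_definition inner_ell2 :: "ell2 \<Rightarrow> ell2 \<Rightarrow> real" is "\<lambda>x y. Re (l2inner x y)" .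
definition norm_ell2 :: "ell2 \<Rightarrow> real" where "norm_ell2 x = sqrt (inner x x)"
definition sgn_ell2 :: "ell2 \<Rightarrow> ell2" where "sgn_ell2 x = x /\<^sub>R norm x"
definition dist_ell2 :: "ell2 \<Rightarrow> ell2 \<Rightarrow> real" where "dist_ell2 x y = norm (x - y)"
definition uniformity_ell2 :: "(ell2 \<times> ell2) filter" where
  "uniformity_ell2 = (INF e\<in>{0<..}. principal {(x, y). dist x y < e})"
definition open_ell2 :: "ell2 set \<Rightarrow> bool" where
  "open_ell2 U \<longleftrightarrow> (\<forall>x\<in>U. \<forall>\<^sub>F (x', y) in uniformity. x' = x \<longrightarrow> y \<in> U)"

instance
proof
  fix x y z :: ell2 and a b :: real
  show "inner x y = inner y x"
  proof transfer
    fix x y :: vec assume "x \<in> l2" "y \<in> l2"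
    then have "summable (\<lambda>k. x k * cnj (y k))"
      by (rule summable_norm_cancel[OF l2_mult_summable])
    from bounded_linear.suminf[OF bounded_linear_cnj this]
    have "cnj (l2inner x y) = l2inner y x"
      by (simp add: l2inner_def mult.commute)
    from arg_cong[OF this, of Re] show "Re (l2inner x y) = Re (l2inner y x)"
      by simp
  qed
  show "inner (x + y) z = inner x z + inner y z"
  proof transfer
    fix x y z :: vec assume "x \<in> l2" "y \<in> l2" "z \<in> l2"
    from suminf_add[OF summable_norm_cancel[OF l2_mult_summable[OF this(1,3)]]
        summable_norm_cancel[OF l2_mult_summable[OF this(2,3)]]]
    show "Re (l2inner (\<lambda>k. x k + y k) z) = Re (l2inner x z) + Re (l2inner y z)"
      unfolding l2inner_def plus_complex.sel(1)[symmetric] by (simp only: distrib_right)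
  qed
  show "inner (a *\<^sub>R x) y = a * inner x y"
  proof transfer
    fix a :: real and x y :: vec assume "x \<in> l2" "y \<in> l2"
    from suminf_mult[OF summable_norm_cancel[OF l2_mult_summable[OF this]], of "of_real a"]
    show "Re (l2inner (\<lambda>k. of_real a * x k) y) = a * Re (l2inner x y)"
      by (simp add: l2inner_def mult.assoc)
  qed
  have sq: "l2inner u u = of_real (\<Sum>k. (cmod (u k))\<^sup>2)" if "u \<in> l2" for u
    using suminf_of_real[of "\<lambda>k. (cmod (u k))\<^sup>2", where 'a = complex] that
    by (simp add: l2inner_def l2_def complex_norm_square[symmetric])
  show "0 \<le> inner x x"
  proof transfer
    fix x :: vec assume "x \<in> l2"
    then show "0 \<le> Re (l2inner x x)"
      using suminf_nonneg[of "\<lambda>k. (cmod (x k))\<^sup>2"] by (simp only: sq Re_complex_of_real) (simp add: l2_def)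
  qed
  show "inner x x = 0 \<longleftrightarrow> x = 0"
  proof transfer
    fix x :: vec assume x: "x \<in> l2"
    have "Re (l2inner x x) = 0 \<longleftrightarrow> (\<Sum>k. (cmod (x k))\<^sup>2) = 0"
      by (simp only: sq[OF x] Re_complex_of_real)
    also have "\<dots> \<longleftrightarrow> (\<forall>k. (cmod (x k))\<^sup>2 = 0)"
      using x by (intro suminf_eq_zero_iff) (auto simp: l2_def)
    finally show "Re (l2inner x x) = 0 \<longleftrightarrow> x = (\<lambda>_. 0)"
      by (simp add: fun_eq_iff)
  qed
qed (rule norm_ell2_def sgn_ell2_def dist_ell2_def uniformity_ell2_def open_ell2_def)+

end

lift_definition cip :: "ell2 \<Rightarrow> ell2 \<Rightarrow> complex" is l2inner .
lift_definition cs :: "complex \<Rightarrow> ell2 \<Rightarrow> ell2" is "\<lambda>c x k. c * x k" by (rule l2_scale)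
lift_definition co :: "ell2 \<Rightarrow> nat \<Rightarrow> complex" is "\<lambda>x. x" .

lemma co_l2: "co x \<in> l2" by transfer

lemma ell2_eqI: "(\<And>k. co x k = co y k) \<Longrightarrow> x = y"
  by transfer auto

lemma co_simps [simp]:
  "co 0 k = 0" "co (x + y) k = co x k + co y k" "co (x - y) k = co x k - co y k"
  "co (- x) k = - co x k" "co (r *\<^sub>R x) k = of_real r * co x k" "co (cs c x) k = c * co x k"
  by (transfer; simp)+

lemma co_sum [simp]: "co (\<Sum>i\<in>A. f i) k = (\<Sum>i\<in>A. co (f i) k)"
  by (induction A rule: infinite_finite_induct) auto

lemma cip_def': "cip x y = (\<Sum>k. co x k * cnj (co y k))"
  by transfer (simp add: l2inner_def)

lemma cip_summable: "summable (\<lambda>k. co x k * cnj (co y k))"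
  by (rule summable_norm_cancel[OF l2_mult_summable[OF co_l2 co_l2]])

lemma co_summable: "summable (\<lambda>k. (cmod (co x k))\<^sup>2)"
  using co_l2[of x] by (simp add: l2_def)

lemma inner_cip: "inner x y = Re (cip x y)"
  by transfer simp

lemma norm_sq_co: "(norm x)\<^sup>2 = (\<Sum>k. (cmod (co x k))\<^sup>2)"
proof -
  have "cip x x = of_real (\<Sum>k. (cmod (co x k))\<^sup>2)"
    using suminf_of_real[OF co_summable[of x], where 'a = complex]
    by (simp add: cip_def' complex_norm_square[symmetric])
  then show ?thesis
    by (simp add: norm_ell2_def inner_cip suminf_nonneg[OF co_summable])
qed

lemma norm_ell2_l2norm: "norm x = l2norm (co x)"
proof -
  have "norm x = sqrt ((norm x)\<^sup>2)" by simp
  then show ?thesis unfolding norm_sq_co by (simp add: l2norm_def)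
qed

lemma cip_self: "cip x x = of_real ((norm x)\<^sup>2)"
  using suminf_of_real[OF co_summable[of x], where 'a = complex]
  unfolding norm_sq_co by (simp add: cip_def' complex_norm_square[symmetric])

lemma cip_add_left [simp]: "cip (x + y) z = cip x z + cip y z"
  by (simp add: cip_def' distrib_right suminf_add[OF cip_summable cip_summable, symmetric])

lemma cip_cs_left [simp]: "cip (cs c x) z = c * cip x z"
  by (simp add: cip_def' mult.assoc suminf_mult[OF cip_summable])

lemma cip_commute: "cip x y = cnj (cip y x)"
  using bounded_linear.suminf[OF bounded_linear_cnj cip_summable[of y x]]
  by (simp add: cip_def' mult.commute)

lemma cip_add_right [simp]: "cip x (y + z) = cip x y + cip x z"
  by (metis cip_add_left cip_commute complex_cnj_add)

lemma cip_cs_right [simp]: "cip x (cs c y) = cnj c * cip x y"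
  by (metis cip_cs_left cip_commute complex_cnj_mult)

lemma scaleR_cs: "r *\<^sub>R x = cs (of_real r) x"
  by (rule ell2_eqI) simp

lemma uminus_cs: "- x = cs (-1) x"
  by (rule ell2_eqI) simp

lemma cip_minus_left [simp]: "cip (- x) y = - cip x y"
  by (simp add: uminus_cs)
lemma cip_minus_right [simp]: "cip x (- y) = - cip x y"
  by (simp add: uminus_cs)
lemma cip_diff_left [simp]: "cip (x - y) z = cip x z - cip y z"
  using cip_add_left[of x "- y" z] by simp
lemma cip_diff_right [simp]: "cip z (x - y) = cip z x - cip z y"
  using cip_add_right[of z x "- y"] by simp
lemma cip_zero [simp]: "cip 0 y = 0" "cip y 0 = 0"
  using cip_add_left[of 0 0 y] cip_add_right[of y 0 0] by simp_all
lemma cip_scaleR [simp]: "cip (r *\<^sub>R x) y = of_real r * cip x y" "cip x (r *\<^sub>R y) = of_real r * cip x y"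
  by (simp_all add: scaleR_cs)
lemma cip_sum_left [simp]: "cip (\<Sum>i\<in>A. f i) y = (\<Sum>i\<in>A. cip (f i) y)"
  by (induction A rule: infinite_finite_induct) auto
lemma cip_sum_right [simp]: "cip y (\<Sum>i\<in>A. f i) = (\<Sum>i\<in>A. cip y (f i))"
  by (induction A rule: infinite_finite_induct) auto

lemma cs_simps [simp]:
  "cs c (x + y) = cs c x + cs c y" "cs c (x - y) = cs c x - cs c y" "cs c (- x) = - cs c x"
  "cs c 0 = 0" "cs 0 x = 0" "cs 1 x = x" "cs c (cs d x) = cs (c * d) x"
  by (rule ell2_eqI; simp add: algebra_simps)+

lemma cs_add: "cs (c + d) x = cs c x + cs d x"
  by (rule ell2_eqI) (simp add: algebra_simps)

lemma cs_sum: "cs c (\<Sum>i\<in>A. f i) = (\<Sum>i\<in>A. cs c (f i))"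
  by (induction A rule: infinite_finite_induct) auto

lemma norm_cs [simp]: "norm (cs c x) = cmod c * norm x"
proof -
  have "complex_of_real ((norm (cs c x))\<^sup>2) = of_real ((cmod c * norm x)\<^sup>2)"
    unfolding power_mult_distrib of_real_mult cip_self[symmetric] cip_cs_left cip_cs_right
      complex_norm_square by (simp add: mult.assoc)
  then have "(norm (cs c x))\<^sup>2 = (cmod c * norm x)\<^sup>2"
    using of_real_eq_iff by blast
  then show ?thesis by (simp add: power2_eq_iff_nonneg)
qed

lemma cip_eq_zero [simp]: "cip x x = 0 \<longleftrightarrow> x = 0"
  by (simp add: cip_self)

lemma cip_eqI: "(\<And>y. cip x y = cip z y) \<Longrightarrow> x = z"
  using cip_eq_zero[of "x - z"] by (simp del: cip_eq_zero)

lemma cip_Cauchy_Schwarz: "cmod (cip x y) \<le> norm x * norm y"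
proof (cases "cip x y = 0")
  case False
  define u where "u = cnj (cip x y) / of_real (cmod (cip x y))"
  have u: "cmod u = 1" using False by (simp add: u_def norm_divide)
  have "cip (cs u x) y = of_real (cmod (cip x y))"
    using False complex_norm_square[of "cip x y"]
    by (simp add: u_def field_simps power2_eq_square)
  then have "cmod (cip x y) = inner (cs u x) y"
    by (simp add: inner_cip)
  also have "\<dots> \<le> norm (cs u x) * norm y"
    by (rule norm_cauchy_schwarz)
  finally show ?thesis by (simp add: u)
qed simp

lemma norm_add_sq: "(norm (x + y))\<^sup>2 = (norm x)\<^sup>2 + (norm y)\<^sup>2 + 2 * Re (cip x y)"
  by (simp add: power2_norm_eq_inner inner_add_left inner_add_right inner_commute inner_cip[symmetric])

lemma pythagoras: "cip x y = 0 \<Longrightarrow> (norm (x + y))\<^sup>2 = (norm x)\<^sup>2 + (norm y)\<^sup>2"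
  by (simp add: norm_add_sq)

lemma norm_co_le: "cmod (co x k) \<le> norm x"
proof -
  have "(cmod (co x k))\<^sup>2 \<le> (norm x)\<^sup>2"
    unfolding norm_sq_co using sum_le_suminf[OF co_summable, of "{k}" x] by simp
  then show ?thesis by (simp add: power2_le_iff_abs_le)
qed

lemma co_partial_le: "(\<Sum>k<n. (cmod (co x k))\<^sup>2) \<le> (norm x)\<^sup>2"
  unfolding norm_sq_co by (intro sum_le_suminf co_summable) auto

definition of_seq :: "(nat \<Rightarrow> complex) \<Rightarrow> ell2" where "of_seq = Abs_ell2"

lemma co_of_seq: "f \<in> l2 \<Longrightarrow> co (of_seq f) = f"
  by (simp add: of_seq_def co.rep_eq Abs_ell2_inverse)

lemma of_seq_co [simp]: "of_seq (co x) = x"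
  by (simp add: of_seq_def co.rep_eq Rep_ell2_inverse)

text \<open>Membership and the norm bound are read off from uniformly bounded finite partial sums,
  so an operator given by a coordinate formula is handled through finite sums alone.\<close>

lemma l2_partialI:
  assumes "\<And>n. (\<Sum>k<n. (cmod (f k))\<^sup>2) \<le> C\<^sup>2" "0 \<le> C"
  shows "f \<in> l2" "norm (of_seq f) \<le> C"
proof -
  have s: "summable (\<lambda>k. (cmod (f k))\<^sup>2)"
    using assms(1)[of "Suc _"] by (intro bounded_imp_summable[of _ "C\<^sup>2"])
      (auto simp: lessThan_Suc_atMost[symmetric])
  then show f: "f \<in> l2" by (simp add: l2_def)
  have "(norm (of_seq f))\<^sup>2 \<le> C\<^sup>2"
    unfolding norm_sq_co co_of_seq[OF f] using assms s by (intro suminf_le_const) auto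
  then show "norm (of_seq f) \<le> C" using assms(2) by (simp add: power2_le_iff_abs_le)
qed

text \<open>The coordinates of a Cauchy sequence converge. On finitely many coordinates the Cauchy
  estimate passes to the limit, and the bound does not depend on how many are taken.\<close>

instance ell2 :: complete_space
proof
  fix X :: "nat \<Rightarrow> ell2" assume X: "Cauchy X"
  have "Cauchy (\<lambda>n. co (X n) k)" for k
  proof (rule metric_CauchyI)
    fix e :: real assume "0 < e"
    then obtain M where "\<forall>m\<ge>M. \<forall>n\<ge>M. dist (X m) (X n) < e" using X metric_CauchyD by blast
    then show "\<exists>M. \<forall>m\<ge>M. \<forall>n\<ge>M. dist (co (X m) k) (co (X n) k) < e"
      by (metis co_simps(3) dist_norm norm_co_le order_le_less_trans)
  qed
  then have "\<exists>l. (\<lambda>n. co (X n) k) \<longlonglongrightarrow> l" for k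
    using Cauchy_convergent convergent_def by blast
  then obtain l where l: "\<And>k. (\<lambda>n. co (X n) k) \<longlonglongrightarrow> l k" by metis
  have key: "(\<Sum>k<K. (cmod (co (X m) k - l k))\<^sup>2) \<le> e\<^sup>2"
    if "0 < e" and M: "\<forall>m\<ge>M. \<forall>n\<ge>M. dist (X m) (X n) < e" and "m \<ge> M" for K m e M
  proof (rule tendsto_upperbound)
    show "(\<lambda>n. \<Sum>k<K. (cmod (co (X m) k - co (X n) k))\<^sup>2) \<longlonglongrightarrow> (\<Sum>k<K. (cmod (co (X m) k - l k))\<^sup>2)"
      by (intro tendsto_intros l)
    have "(\<Sum>k<K. (cmod (co (X m) k - co (X n) k))\<^sup>2) \<le> e\<^sup>2" if "n \<ge> M" for n
    proof -
      have "(\<Sum>k<K. (cmod (co (X m) k - co (X n) k))\<^sup>2) \<le> (norm (X m - X n))\<^sup>2"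
        using co_partial_le[of "X m - X n" K] by simp
      also have "\<dots> \<le> e\<^sup>2"
        using M \<open>m \<ge> M\<close> \<open>n \<ge> M\<close> by (intro power_mono) (auto simp: dist_norm less_imp_le)
      finally show ?thesis .
    qed
    then show "\<forall>\<^sub>F n in sequentially. (\<Sum>k<K. (cmod (co (X m) k - co (X n) k))\<^sup>2) \<le> e\<^sup>2"
      using eventually_sequentially by blast
  qed simp
  obtain M0 where "\<forall>m\<ge>M0. \<forall>n\<ge>M0. dist (X m) (X n) < 1"
    using X metric_CauchyD zero_less_one by blast
  from key[OF zero_less_one this order_refl]
  have "(\<lambda>k. co (X M0) k - l k) \<in> l2" by (intro l2_partialI(1)[of _ 1]) auto
  from l2_diff[OF co_l2[of "X M0"] this] have l2: "l \<in> l2" by simp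
  have "X \<longlonglongrightarrow> of_seq l"
  proof (rule metric_LIMSEQ_I)
    fix e :: real assume "0 < e"
    then obtain M where M: "\<forall>m\<ge>M. \<forall>n\<ge>M. dist (X m) (X n) < e / 2"
      using X metric_CauchyD half_gt_zero by blast
    have "dist (X m) (of_seq l) < e" if "m \<ge> M" for m
    proof -
      have "norm (of_seq (\<lambda>k. co (X m) k - l k)) \<le> e / 2"
        using key[OF half_gt_zero[OF \<open>0 < e\<close>] M that] \<open>0 < e\<close> by (intro l2_partialI(2)) auto
      moreover have "of_seq (\<lambda>k. co (X m) k - l k) = X m - of_seq l"
        by (rule ell2_eqI) (simp add: co_of_seq l2 l2_diff co_l2)
      ultimately show ?thesis using \<open>0 < e\<close> by (simp add: dist_norm)
    qed
    then show "\<exists>M. \<forall>m\<ge>M. dist (X m) (of_seq l) < e" by blast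
  qed
  then show "convergent X" by (auto simp: convergent_def)
qed

section \<open>Basis vectors and orthogonal systems\<close>

definition bvec :: "nat \<Rightarrow> ell2" where "bvec j = of_seq (\<lambda>k. if k = j then 1 else 0)"

lemma co_bvec [simp]: "co (bvec j) k = (if k = j then 1 else 0)"
proof -
  have "(\<lambda>k. if k = j then 1 else 0 :: complex) \<in> l2"
    unfolding l2_def using sums_summable[OF sums_single[of j "\<lambda>_. 1::real"]]
    by (simp add: if_distrib[of cmod] if_distrib[of "\<lambda>x. x\<^sup>2"] cong: if_cong)
  then show ?thesis by (simp add: bvec_def co_of_seq)
qed

lemma cip_bvec [simp]: "cip x (bvec j) = co x j" "cip (bvec j) x = cnj (co x j)"
proof -
  show "cip x (bvec j) = co x j"
    using sums_unique[OF sums_single[of j "\<lambda>k. co x k"]]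
    by (simp add: cip_def' if_distrib[of cnj] if_distrib[of "\<lambda>y. _ * y"] cong: if_cong)
  then show "cip (bvec j) x = cnj (co x j)" by (metis cip_commute)
qed

lemma norm_bvec [simp]: "norm (bvec j) = 1"
proof -
  have "complex_of_real ((norm (bvec j))\<^sup>2) = of_real 1"
    using cip_self[of "bvec j"] by simp
  then have "(norm (bvec j))\<^sup>2 = 1" using of_real_eq_iff by blast
  then show ?thesis by (simp add: power2_eq_1_iff) (smt (verit) norm_ge_zero)
qed

text \<open>Zero vectors are admitted so that the singular vectors of a finite-rank operator and the
  output of the Gram-Schmidt process need no case distinction.\<close>

definition subortho :: "(nat \<Rightarrow> ell2) \<Rightarrow> bool" where
  "subortho e \<longleftrightarrow> (\<forall>i j. i \<noteq> j \<longrightarrow> cip (e i) (e j) = 0) \<and> (\<forall>i. norm (e i) = 0 \<or> norm (e i) = 1)"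

lemma subortho_cip:
  assumes "subortho e" shows "cip (e i) (e j) = (if i = j \<and> e i \<noteq> 0 then 1 else 0)"
  using assms by (auto simp: subortho_def cip_self)

lemma subortho_norm_sum:
  assumes "subortho e"
  shows "(norm (\<Sum>i\<in>I. cs (a i) (e i)))\<^sup>2 = (\<Sum>i\<in>I. (cmod (a i))\<^sup>2 * (norm (e i))\<^sup>2)"
proof (induction I rule: infinite_finite_induct)
  case (insert j I)
  have "cip (e j) (e i) = 0" if "i \<in> I" for i
    using insert that assms unfolding subortho_def by metis
  then have "cip (cs (a j) (e j)) (\<Sum>i\<in>I. cs (a i) (e i)) = 0"
    by simp
  from pythagoras[OF this] show ?case
    using insert by (simp add: power_mult_distrib)
qed auto

lemma subortho_residual_orth:
  assumes "subortho e" "finite I" "j \<in> I"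
  shows "cip (x - (\<Sum>i\<in>I. cs (cip x (e i)) (e i))) (e j) = 0"
proof (cases "e j = 0")
  case False
  have "cip (\<Sum>i\<in>I. cs (cip x (e i)) (e i)) (e j) = (\<Sum>i\<in>I. if i = j then cip x (e j) else 0)"
    unfolding cip_sum_left by (intro sum.cong) (auto simp: subortho_cip[OF assms(1)] False)
  then show ?thesis using assms by simp
qed simp

lemma subortho_residual_norm:
  assumes "subortho e" "finite I"
  shows "(norm (x - (\<Sum>i\<in>I. cs (cip x (e i)) (e i))))\<^sup>2
     = (norm x)\<^sup>2 - (\<Sum>i\<in>I. (cmod (cip x (e i)))\<^sup>2)"
proof -
  let ?P = "\<Sum>i\<in>I. cs (cip x (e i)) (e i)"
  have "cip (x - ?P) ?P = 0"
    using subortho_residual_orth[OF assms, of _ x] by (simp del: cip_diff_left)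
  from pythagoras[OF this] have "(norm x)\<^sup>2 = (norm (x - ?P))\<^sup>2 + (norm ?P)\<^sup>2" by simp
  moreover have "(norm ?P)\<^sup>2 = (\<Sum>i\<in>I. (cmod (cip x (e i)))\<^sup>2)"
    unfolding subortho_norm_sum[OF assms(1)]
  proof (intro sum.cong refl)
    fix i
    show "(cmod (cip x (e i)))\<^sup>2 * (norm (e i))\<^sup>2 = (cmod (cip x (e i)))\<^sup>2"
      using assms(1) by (cases "e i = 0") (auto simp: subortho_def)
  qed
  ultimately show ?thesis by simp
qed

lemma subortho_bessel:
  assumes "subortho e" "finite I"
  shows "(\<Sum>i\<in>I. (cmod (cip x (e i)))\<^sup>2) \<le> (norm x)\<^sup>2"
  using subortho_residual_norm[OF assms, of x] by (smt (verit) zero_le_power2)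

section \<open>Bounded operators\<close>

text \<open>\<open>bounded_linear\<close> means linearity over the reals, so complex homogeneity is
  a separate clause. As a type the operators form a \<open>ring_1\<close>, which turns the later
  operator identities into ring computations.\<close>

typedef bop = "{T :: ell2 \<Rightarrow> ell2. bounded_linear T \<and> (\<forall>c x. T (cs c x) = cs c (T x))}"
  morphisms app Abs_bop
  using bounded_linear_zero by force

setup_lifting type_definition_bop

lemma app_bounded_linear: "bounded_linear (app T)" and app_cs [simp]: "app T (cs c x) = cs c (app T x)"
  using app[of T] by auto

lemma app_add [simp]: "app T (x + y) = app T x + app T y"
  and app_diff [simp]: "app T (x - y) = app T x - app T y"
  and app_minus [simp]: "app T (- x) = - app T x"
  and app_zero [simp]: "app T 0 = 0"
  and app_scaleR [simp]: "app T (r *\<^sub>R x) = r *\<^sub>R app T x"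
  using app_bounded_linear[of T]
  by (simp_all add: linear_add linear_diff linear_neg linear_0 linear_scale bounded_linear.linear)

lemma app_sum [simp]: "app T (\<Sum>i\<in>A. f i) = (\<Sum>i\<in>A. app T (f i))"
  by (induction A rule: infinite_finite_induct) auto

lemma Abs_bop_app:
  assumes "\<And>x y. f (x + y) = f x + f y" "\<And>c x. f (cs c x) = cs c (f x)"
    "\<And>x. norm (f x) \<le> C * norm x"
  shows "app (Abs_bop f) = f"
proof -
  have "bounded_linear f"
    by (rule bounded_linear_intro[of _ C])
      (use assms in \<open>auto simp: scaleR_cs mult.commute\<close>)
  then show ?thesis using assms by (simp add: Abs_bop_inverse)
qed

instantiation bop :: ring_1
begin

lift_definition zero_bop :: bop is "\<lambda>_. 0" by simp
lift_definition one_bop :: bop is "\<lambda>x. x" by simp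
lift_definition plus_bop :: "bop \<Rightarrow> bop \<Rightarrow> bop" is "\<lambda>S T x. S x + T x"
  by (simp add: bounded_linear_add)
lift_definition minus_bop :: "bop \<Rightarrow> bop \<Rightarrow> bop" is "\<lambda>S T x. S x - T x"
  by (simp add: bounded_linear_sub)
lift_definition uminus_bop :: "bop \<Rightarrow> bop" is "\<lambda>S x. - S x"
  by (simp add: bounded_linear_minus)
lift_definition times_bop :: "bop \<Rightarrow> bop \<Rightarrow> bop" is "\<lambda>S T x. S (T x)"
  by (simp add: bounded_linear_compose)

instance
proof
  show "(0::bop) \<noteq> 1"
  proof transfer
    have "bvec 0 \<noteq> 0" by (metis norm_bvec norm_zero zero_neq_one)
    then show "(\<lambda>_. 0) \<noteq> (\<lambda>x::ell2. x)" by metis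
  qed
  fix a b c :: bop
  show "a * (b + c) = a * b + a * c"
    by transfer (simp add: fun_eq_iff linear_add bounded_linear.linear)
qed (transfer; simp add: fun_eq_iff algebra_simps)+

end

lemma app_simps [simp]:
  "app 0 x = 0" "app 1 x = x" "app (S + T) x = app S x + app T x" "app (S - T) x = app S x - app T x"
  "app (- S) x = - app S x" "app (S * T) x = app S (app T x)"
  by (transfer; simp)+

lemma bop_eqI: "(\<And>x. app S x = app T x) \<Longrightarrow> S = T"
  by (metis app_inject ext)

lift_definition sc :: "complex \<Rightarrow> bop" is "\<lambda>c x. cs c x"
proof (intro conjI allI)
  show "bounded_linear (cs c)" for c
    by (rule bounded_linear_intro[of _ "cmod c"]) (auto simp: scaleR_cs mult.commute)
qed (simp add: mult.commute)

lemma app_sc [simp]: "app (sc c) x = cs c x"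
  by transfer simp

lemma sc_commute: "T * sc c = sc c * T"
  by (rule bop_eqI) simp

lemma sc_simps [simp]: "sc 0 = 0" "sc 1 = 1" "sc (c + d) = sc c + sc d" "sc (- c) = - sc c"
  "sc (c * d) = sc c * sc d" "sc (c - d) = sc c - sc d"
  by (rule bop_eqI; rule ell2_eqI; simp add: algebra_simps)+

definition opn :: "bop \<Rightarrow> real" where "opn T = onorm (app T)"

lemma norm_app_le: "norm (app T x) \<le> opn T * norm x"
  unfolding opn_def by (rule onorm[OF app_bounded_linear])

lemma opn_nonneg: "0 \<le> opn T"
  unfolding opn_def by (rule onorm_pos_le[OF app_bounded_linear])

lemma opn_le: "0 \<le> C \<Longrightarrow> (\<And>x. norm (app T x) \<le> C * norm x) \<Longrightarrow> opn T \<le> C"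
  unfolding opn_def by (rule onorm_bound)

lemma app_tendsto: "X \<longlonglongrightarrow> x \<Longrightarrow> (\<lambda>n. app T (X n)) \<longlonglongrightarrow> app T x"
  by (rule bounded_linear.tendsto[OF app_bounded_linear])

text \<open>The adjoint is written down in coordinates, so no representation theorem is needed.\<close>

lemma adj_bound:
  "(\<Sum>k<n. (cmod (cip y (app T (bvec k))))\<^sup>2) \<le> (opn T * norm y)\<^sup>2"
proof -
  define a where "a k = cip y (app T (bvec k))" for k
  \<comment> \<open>x is the truncation of the candidate for \<open>adj T\<close> at y. Pairing y
    with T x therefore returns s, the squared norm of x, and Cauchy-Schwarz leaves the desired bound
    after one factor \<open>norm x\<close> is cancelled.\<close>
  define x where "x = (\<Sum>k<n. cs (a k) (bvec k))"
  define s where "s = (\<Sum>k<n. (cmod (a k))\<^sup>2)"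
  have "subortho bvec" by (simp add: subortho_def)
  from subortho_norm_sum[OF this, of a "{..<n}"] have xs: "(norm x)\<^sup>2 = s"
    by (simp add: x_def s_def)
  have "cip y (app T x) = of_real s"
    by (simp add: x_def s_def a_def[symmetric] complex_norm_square mult.commute flip: of_real_power)
  then have "\<bar>s\<bar> = cmod (cip y (app T x))" by (simp only: norm_of_real)
  also have "\<dots> \<le> norm y * norm (app T x)" by (rule cip_Cauchy_Schwarz)
  also have "\<dots> \<le> norm y * (opn T * norm x)" by (intro mult_left_mono norm_app_le norm_ge_zero)
  finally have "(norm x) * norm x \<le> (opn T * norm y) * norm x"
    using xs by (simp add: power2_eq_square mult_ac)
  then have "norm x \<le> opn T * norm y"
    by (cases "x = 0") (simp_all add: opn_nonneg)
  then have "(norm x)\<^sup>2 \<le> (opn T * norm y)\<^sup>2" by (intro power_mono) auto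
  then show ?thesis by (simp add: xs s_def a_def)
qed

definition adj :: "bop \<Rightarrow> bop" where
  "adj T = Abs_bop (\<lambda>y. of_seq (\<lambda>k. cip y (app T (bvec k))))"

lemma adj_l2: "(\<lambda>k. cip y (app T (bvec k))) \<in> l2"
  by (rule l2_partialI(1)[of _ "opn T * norm y"]) (simp_all add: adj_bound opn_nonneg)

lemma co_adj: "co (app (adj T) y) k = cip y (app T (bvec k))"
proof -
  have "app (adj T) = (\<lambda>y. of_seq (\<lambda>k. cip y (app T (bvec k))))"
    unfolding adj_def
  proof (rule Abs_bop_app[of _ "opn T"])
    show "norm (of_seq (\<lambda>k. cip x (app T (bvec k)))) \<le> opn T * norm x" for x
      by (rule l2_partialI(2)) (simp_all add: adj_bound opn_nonneg)
  qed (rule ell2_eqI, simp only: co_of_seq[OF adj_l2] co_simps, simp)+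
  then show ?thesis by (simp add: co_of_seq[OF adj_l2])
qed

lemma truncation_tendsto: "(\<lambda>n. \<Sum>k<n. cs (co x k) (bvec k)) \<longlonglongrightarrow> x"
proof -
  have on: "subortho bvec" by (simp add: subortho_def)
  have "(\<lambda>n. (norm x)\<^sup>2 - (\<Sum>k<n. (cmod (co x k))\<^sup>2)) \<longlonglongrightarrow> (norm x)\<^sup>2 - (norm x)\<^sup>2"
    using summable_LIMSEQ[OF co_summable[of x]] by (intro tendsto_diff tendsto_const) (simp add: norm_sq_co)
  then have "(\<lambda>n. (norm (x - (\<Sum>k<n. cs (co x k) (bvec k))))\<^sup>2) \<longlonglongrightarrow> 0"
    using subortho_residual_norm[OF on finite_lessThan, of x] by (simp only: cip_bvec) simp
  from tendsto_real_sqrt[OF this]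
  have "(\<lambda>n. norm (x - (\<Sum>k<n. cs (co x k) (bvec k)))) \<longlonglongrightarrow> 0" by simp
  then have "(\<lambda>n. (\<Sum>k<n. cs (co x k) (bvec k)) - x) \<longlonglongrightarrow> 0"
    by (subst (asm) norm_minus_commute) (rule tendsto_norm_zero_cancel)
  then show ?thesis by (rule LIM_zero_cancel)
qed

text \<open>Finite combinations of basis vectors are dense by \<open>truncation_tendsto\<close>, and
  operators are continuous.\<close>

lemma bop_eq_dlI: "(\<And>k. app S (bvec k) = app T (bvec k)) \<Longrightarrow> S = T"
proof (rule bop_eqI)
  fix x assume *: "\<And>k. app S (bvec k) = app T (bvec k)"
  have "(\<lambda>n. app S (\<Sum>k<n. cs (co x k) (bvec k))) = (\<lambda>n. app T (\<Sum>k<n. cs (co x k) (bvec k)))"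
    by (simp add: *)
  with app_tendsto[OF truncation_tendsto[of x], of S] app_tendsto[OF truncation_tendsto[of x], of T]
  show "app S x = app T x" by (metis LIMSEQ_unique)
qed

lemma cip_tendsto: "X \<longlonglongrightarrow> x \<Longrightarrow> (\<lambda>n. cip (X n) y) \<longlonglongrightarrow> cip x y"
proof (rule LIM_zero_cancel)
  assume "X \<longlonglongrightarrow> x"
  then have "(\<lambda>n. norm (X n - x) * norm y) \<longlonglongrightarrow> 0 * norm y"
    by (intro tendsto_mult tendsto_const) (simp add: LIM_zero tendsto_norm_zero)
  then show "(\<lambda>n. cip (X n) y - cip x y) \<longlonglongrightarrow> 0"
    unfolding cip_diff_left[symmetric]
    using Lim_null_comparison[OF always_eventually[OF allI[OF cip_Cauchy_Schwarz]],
        of "\<lambda>n. X n - x" "\<lambda>_. y"] by (simp only: mult_zero_left)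
qed

lemma cip_adj: "cip (app T x) y = cip x (app (adj T) y)"
proof (rule LIMSEQ_unique)
  let ?X = "\<lambda>n. \<Sum>k<n. cs (co x k) (bvec k)"
  show "(\<lambda>n. cip (app T (?X n)) y) \<longlonglongrightarrow> cip (app T x) y"
    by (intro cip_tendsto app_tendsto truncation_tendsto)
  have "cip (app T (?X n)) y = cip (?X n) (app (adj T) y)" for n
    by (simp add: co_adj) (metis cip_commute)
  then show "(\<lambda>n. cip (app T (?X n)) y) \<longlonglongrightarrow> cip x (app (adj T) y)"
    using cip_tendsto[OF truncation_tendsto] by simp
qed

lemma cip_adj': "cip (app (adj T) x) y = cip x (app T y)"
  by (metis cip_adj cip_commute)

lemma adj_unique: "(\<And>x y. cip (app S x) y = cip x (app T y)) \<Longrightarrow> adj S = T"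
  by (rule bop_eqI, rule cip_eqI) (metis cip_adj cip_commute)

lemma adj_adj [simp]: "adj (adj T) = T"
  by (rule adj_unique) (rule cip_adj')

lemma adj_simps [simp]: "adj (S * T) = adj T * adj S" "adj (S + T) = adj S + adj T"
  "adj 1 = 1" "adj (sc c) = sc (cnj c)" "adj 0 = 0" "adj (- T) = - adj T" "adj (S - T) = adj S - adj T"
  by (rule adj_unique; simp add: cip_adj)+

section \<open>Transfer between operators on sequences and the type of bounded operators\<close>

definition to_op :: "bop \<Rightarrow> op" where
  "to_op T = (\<lambda>v. if v \<in> l2 then co (app T (of_seq v)) else 0)"

lemma to_op_co [simp]: "to_op T (co x) = co (app T x)"
  by (simp add: to_op_def co_l2)

lemma to_op_notin: "x \<notin> l2 \<Longrightarrow> to_op T x = 0"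
  by (simp add: to_op_def)

lemma l2_cases: assumes "v \<in> l2" obtains x where "v = co x"
  using co_of_seq[OF assms] by metis

lemma Ball_l2: "(\<forall>v\<in>l2. P v) \<longleftrightarrow> (\<forall>x. P (co x))"
  using l2_cases co_l2 by metis

lemma co_plus: "co (x + y) = co x + co y" and co_minus: "co (x - y) = co x - co y"
  and co_cs: "co (cs c x) = (\<lambda>k. c * co x k)" and co_zero: "co 0 = 0"
  by (simp_all add: fun_eq_iff)

lemma co_inject: "co x = co y \<longleftrightarrow> x = y"
  by (metis of_seq_co)

lemma op_eqI: "(\<And>x. A (co x) = B (co x)) \<Longrightarrow> (\<And>v. v \<notin> l2 \<Longrightarrow> A v = B v) \<Longrightarrow> A = (B :: op)"
  by (metis ext l2_cases)

lemma to_op_inject: "to_op S = to_op T \<longleftrightarrow> S = T"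
  by (metis bop_eqI co_inject to_op_co)

lemma bounded_op_to_op: "bounded_op (to_op T)"
  unfolding bounded_op_def Ball_l2
  by (auto simp: co_l2 to_op_notin norm_ell2_l2norm[symmetric] simp flip: co_plus co_cs intro: norm_app_le)

lemma bounded_op_obtain:
  assumes "bounded_op A" obtains T where "A = to_op T"
proof -
  define f where "f x = of_seq (A (co x))" for x
  have cf: "co (f x) = A (co x)" for x
    using assms unfolding f_def bounded_op_def by (simp add: co_of_seq co_l2)
  obtain C where "\<And>v. v \<in> l2 \<Longrightarrow> l2norm (A v) \<le> C * l2norm v"
    using assms unfolding bounded_op_def by metis
  then have C: "norm (f x) \<le> C * norm x" for x
    by (simp add: norm_ell2_l2norm cf co_l2)
  have "app (Abs_bop f) = f"
  proof (rule Abs_bop_app[OF _ _ C])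
    show "f (x + y) = f x + f y" for x y
      unfolding co_inject[symmetric] co_plus cf using assms unfolding bounded_op_def
      by (simp add: co_l2)
    show "f (cs c x) = cs c (f x)" for c x
      unfolding co_inject[symmetric] co_cs cf using assms unfolding bounded_op_def
      by (simp add: co_l2)
  qed
  then have "A = to_op (Abs_bop f)"
    using assms unfolding bounded_op_def by (intro op_eqI) (auto simp: cf to_op_notin)
  then show ?thesis by (rule that)
qed

lemma to_op_zero [simp]: "to_op T 0 = 0"
  by (metis app_zero co_zero to_op_co)

lemma to_op_plus: "to_op (S + T) = to_op S + to_op T"
  and to_op_minus: "to_op (S - T) = to_op S - to_op T"
  and to_op_times: "to_op (S * T) = to_op S \<circ> to_op T"
  and to_op_sc: "to_op (sc c * T) = (\<lambda>x k. c * to_op T x k)"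
  by (rule op_eqI; simp add: to_op_notin co_plus co_minus co_cs zero_fun_def[symmetric])+

lemma opnorm_to_op: "opnorm (to_op T) = opn T"
proof -
  have set: "{l2norm (to_op T x) | x. x \<in> l2 \<and> l2norm x \<le> 1} = {norm (app T x) | x. norm x \<le> 1}"
    by (auto simp: norm_ell2_l2norm co_l2 elim!: l2_cases) (metis co_l2 norm_ell2_l2norm to_op_co)
  have bnd: "norm (app T x) \<le> opn T" if "norm x \<le> 1" for x
    using norm_app_le[of T x] mult_left_le[OF that opn_nonneg[of T]] by (simp add: mult.commute)
  have bdd: "bdd_above {norm (app T x) | x. norm x \<le> 1}"
    using bnd by (intro bdd_aboveI[of _ "opn T"]) auto
  show ?thesis unfolding opnorm_def set
  proof (rule antisym)
    show "Sup {norm (app T x) | x. norm x \<le> 1} \<le> opn T"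
      using bnd by (intro cSup_least) (auto intro: exI[of _ 0])
    show "opn T \<le> Sup {norm (app T x) | x. norm x \<le> 1}" (is "_ \<le> ?S")
    proof (rule opn_le)
      have "norm (app T 0) \<le> ?S" by (rule cSup_upper[OF _ bdd]) (auto intro: exI[of _ 0])
      then show "0 \<le> ?S" by simp
      fix x
      show "norm (app T x) \<le> ?S * norm x"
      proof (cases "x = 0")
        case False
        have "norm (app T (x /\<^sub>R norm x)) \<le> ?S"
          using False by (intro cSup_upper[OF _ bdd] CollectI exI[of _ "x /\<^sub>R norm x"]) simp
        then show ?thesis using False by (simp add: field_simps)
      qed simp
    qed
  qed
qed

definition unitary :: "bop \<Rightarrow> bool" where "unitary U \<longleftrightarrow> adj U * U = 1 \<and> U * adj U = 1"

definition posop :: "bop \<Rightarrow> bool" where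
  "posop T \<longleftrightarrow> (\<forall>x. Im (cip (app T x) x) = 0 \<and> 0 \<le> Re (cip (app T x) x))"

lemma l2inner_co: "l2inner (co x) (co y) = cip x y"
  by transfer simp

lemma positive_op_to_op: "positive_op (to_op T) \<longleftrightarrow> posop T"
  unfolding positive_op_def posop_def Ball_l2 by (simp add: bounded_op_to_op l2inner_co)

lemma is_adjoint_to_op: "is_adjoint (to_op S) (to_op T) \<longleftrightarrow> T = adj S"
  unfolding is_adjoint_def Ball_l2
  by (auto simp: bounded_op_to_op l2inner_co cip_adj) (metis adj_unique cip_adj)

text \<open>Polarisation: the norm of x + y determines the real part of the inner product, and
  replacing y by i y the imaginary part.\<close>

lemma isometry_iff: "(\<forall>x. norm (app U x) = norm x) \<longleftrightarrow> adj U * U = 1"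
proof
  assume "adj U * U = 1"
  then have "app (adj U) (app U x) = x" for x by (metis app_simps(2,6))
  then have "cip (app U x) (app U x) = cip x x" for x by (simp add: cip_adj)
  then have "complex_of_real ((norm (app U x))\<^sup>2) = of_real ((norm x)\<^sup>2)" for x by (simp only: cip_self)
  then have "(norm (app U x))\<^sup>2 = (norm x)\<^sup>2" for x using of_real_eq_iff by blast
  then show "\<forall>x. norm (app U x) = norm x" by (simp add: power2_eq_iff_nonneg)
next
  assume n: "\<forall>x. norm (app U x) = norm x"
  have re: "Re (cip (app U x) (app U y)) = Re (cip x y)" for x y
    using norm_add_sq[of x y] norm_add_sq[of "app U x" "app U y"] n
    by (simp flip: app_add)
  have "cip (app U x) (app U y) = cip x y" for x y
    using re[of x y] re[of x "cs \<i> y"] by (simp add: complex_eq_iff)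
  then show "adj U * U = 1"
    by (intro bop_eqI cip_eqI) (simp add: cip_adj')
qed

lemma unitary_op_to_op: "unitary_op (to_op U) \<longleftrightarrow> unitary U"
proof -
  have "unitary_op (to_op U) \<longleftrightarrow> (\<forall>x. norm (app U x) = norm x) \<and> surj (app U)"
  proof -
    have "to_op U ` l2 = l2 \<longleftrightarrow> surj (app U)"
    proof
      assume *: "to_op U ` l2 = l2"
      show "surj (app U)" unfolding surj_def
        by (metis (no_types, lifting) "*" co_inject co_l2 imageE l2_cases to_op_co)
    next
      assume *: "surj (app U)"
      have "v \<in> to_op U ` l2" if "v \<in> l2" for v
        using that * by (metis co_l2 image_eqI l2_cases surjD to_op_co)
      then show "to_op U ` l2 = l2"
        using bounded_op_to_op[of U] by (auto simp: bounded_op_def)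
    qed
    then show ?thesis
      unfolding unitary_op_def Ball_l2 by (simp add: bounded_op_to_op norm_ell2_l2norm)
  qed
  also have "\<dots> \<longleftrightarrow> unitary U"
    unfolding isometry_iff unitary_def
  proof (intro iffI conjI; elim conjE)
    assume a: "adj U * U = 1" "surj (app U)"
    show "U * adj U = 1"
    proof (rule bop_eqI)
      fix y obtain x where "y = app U x" using a(2) by (metis surjD)
      then show "app (U * adj U) y = app 1 y" using a(1) by (metis app_simps(2,6))
    qed
  next
    assume "U * adj U = 1"
    then show "surj (app U)" by (metis app_simps(2,6) surjI)
  qed auto
  finally show ?thesis .
qed

section \<open>Singular values\<close>

text \<open>Gaussian elimination for n equations in n + 1 unknowns. It supplies nonzero vectors
  annihilated by an operator of rank n, or orthogonal to n given vectors.\<close>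

lemma homogeneous_system_solvable:
  fixes c :: "'a \<Rightarrow> nat \<Rightarrow> complex"
  assumes "finite I" "card I = Suc n"
  shows "\<exists>a. (\<exists>i\<in>I. a i \<noteq> 0) \<and> (\<forall>j<n. (\<Sum>i\<in>I. a i * c i j) = 0)"
  using assms
proof (induction n arbitrary: I c)
  case 0
  then obtain p where "I = {p}" by (auto simp: card_1_singleton_iff)
  then show ?case by (intro exI[of _ "\<lambda>_. 1"]) auto
next
  case (Suc n)
  \<comment> \<open>The pivot for the last equation. If that equation is trivial, p is arbitrary;
    then \<open>c p n = 0\<close>, the quotients below are 0 by convention, and the same formulas
    remain correct.\<close>
  obtain p where p: "p \<in> I" "c p n = 0 \<longrightarrow> (\<forall>i\<in>I. c i n = 0)"
    by (metis Suc.prems(2) card.empty ex_in_conv nat.distinct(1))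
  let ?J = "I - {p}"
  have "finite ?J" "card ?J = Suc n" using Suc.prems p by auto
  from Suc.IH[OF this, of "\<lambda>i j. c i j - c i n / c p n * c p j"] obtain a where
    a: "\<exists>i\<in>?J. a i \<noteq> 0" "\<And>j. j < n \<Longrightarrow> (\<Sum>i\<in>?J. a i * (c i j - c i n / c p n * c p j)) = 0" by blast
  define b where "b = a(p := - (\<Sum>i\<in>?J. a i * (c i n / c p n)))"
  have "\<exists>i\<in>I. b i \<noteq> 0" using a(1) by (auto simp: b_def)
  moreover have "(\<Sum>i\<in>I. b i * c i j) = 0" if "j < Suc n" for j
  proof -
    have "(\<Sum>i\<in>I. b i * c i j) = b p * c p j + (\<Sum>i\<in>?J. b i * c i j)"
      using Suc.prems p by (intro sum.remove) auto
    also have "(\<Sum>i\<in>?J. b i * c i j) = (\<Sum>i\<in>?J. a i * c i j)"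
      by (intro sum.cong) (auto simp: b_def)
    also have "b p * c p j = - (\<Sum>i\<in>?J. a i * (c i n / c p n * c p j))"
      by (simp add: b_def sum_distrib_left mult_ac)
    finally have *: "(\<Sum>i\<in>I. b i * c i j) = (\<Sum>i\<in>?J. a i * (c i j - c i n / c p n * c p j))"
      by (simp add: right_diff_distrib sum_subtractf)
    show ?thesis
    proof (cases "j < n")
      case False
      then have "j = n" using that by simp
      then show ?thesis unfolding * using p by (intro sum.neutral) auto
    qed (simp only: * a(2))
  qed
  ultimately show ?case by blast
qed

definition sv :: "nat \<Rightarrow> bop \<Rightarrow> real" where "sv n T = sval n (to_op T)"

lemma rank_le_bounded: "rank_le A n \<Longrightarrow> bounded_op A"
  by (simp add: rank_le_def)

lemma sv_alt: "sv n T = Inf {opn (T - F) | F. rank_le (to_op F) n}"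
proof -
  have "{opnorm (to_op T - A) | A. rank_le A n} = {opn (T - F) | F. rank_le (to_op F) n}"
  proof (intro Collect_cong iffI; elim exE conjE)
    fix s A assume *: "s = opnorm (to_op T - A)" "rank_le A n"
    then obtain F where F: "A = to_op F" by (metis bounded_op_obtain rank_le_bounded)
    with * have "s = opn (T - F) \<and> rank_le (to_op F) n" by (simp add: opnorm_to_op flip: to_op_minus)
    then show "\<exists>F. s = opn (T - F) \<and> rank_le (to_op F) n" by blast
  next
    fix s F assume *: "s = opn (T - F)" "rank_le (to_op F) n"
    then have "s = opnorm (to_op T - to_op F)" by (simp add: opnorm_to_op flip: to_op_minus)
    with *(2) show "\<exists>A. s = opnorm (to_op T - A) \<and> rank_le A n" by blast
  qed
  then show ?thesis by (simp add: sv_def sval_def)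
qed

lemma rank_le_to_op:
  assumes "\<And>x. \<exists>c. app F x = (\<Sum>i<n. cs (c i) (h i))"
  shows "rank_le (to_op F) n"
  unfolding rank_le_def Ball_l2
proof (intro conjI bounded_op_to_op exI allI)
  fix x
  show "to_op F (co x) = (\<lambda>k. \<Sum>i<n. (SOME c. app F x = (\<Sum>i<n. cs (c i) (h i))) i * co (h i) k)"
    using someI_ex[OF assms[of x]] by (metis (no_types, lifting) co_simps(6) co_sum ext sum.cong to_op_co)
qed

lemma rank_le_0: "rank_le (to_op 0) n"
  by (rule rank_le_to_op) (auto intro!: exI[of _ "\<lambda>_. 0"])

lemma sv_le_opn: "rank_le (to_op F) n \<Longrightarrow> sv n T \<le> opn (T - F)"
  unfolding sv_alt by (intro cInf_lower bdd_belowI[of _ 0]) (auto simp: opn_nonneg)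

lemma sv_geI: "(\<And>F. rank_le (to_op F) n \<Longrightarrow> s \<le> opn (T - F)) \<Longrightarrow> s \<le> sv n T"
  unfolding sv_alt using rank_le_0 by (intro cInf_greatest) auto

lemma sv_nonneg: "0 \<le> sv n T"
  by (rule sv_geI) (rule opn_nonneg)

text \<open>Upper bounds on singular values come from an explicit approximant, a sum of n rank-one
  operators. C is automatically nonnegative, since it bounds a norm at a unit vector.\<close>

lemma sv_leI:
  assumes "\<And>x. norm (app T x - (\<Sum>i<n. cs (cip x (g i)) (h i))) \<le> C * norm x"
  shows "sv n T \<le> C"
proof -
  define F where "F = Abs_bop (\<lambda>x. \<Sum>i<n. cs (cip x (g i)) (h i))"
  have F: "app F = (\<lambda>x. \<Sum>i<n. cs (cip x (g i)) (h i))"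
    unfolding F_def
  proof (rule Abs_bop_app[of _ "\<Sum>i<n. norm (g i) * norm (h i)"])
    fix x
    have "norm (\<Sum>i<n. cs (cip x (g i)) (h i)) \<le> (\<Sum>i<n. norm x * norm (g i) * norm (h i))"
      by (intro sum_norm_le) (auto intro!: mult_right_mono cip_Cauchy_Schwarz)
    then show "norm (\<Sum>i<n. cs (cip x (g i)) (h i)) \<le> (\<Sum>i<n. norm (g i) * norm (h i)) * norm x"
      by (simp add: sum_distrib_left mult_ac)
  qed (simp_all add: cs_add sum.distrib cs_sum)
  have "rank_le (to_op F) n"
    by (rule rank_le_to_op) (auto simp: F)
  then have "sv n T \<le> opn (T - F)" by (rule sv_le_opn)
  also have "\<dots> \<le> C"
  proof (rule opn_le)
    show "norm (app (T - F) x) \<le> C * norm x" for x using assms by (simp add: F)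
    from this[of "bvec 0"] show "0 \<le> C" by (metis norm_bvec norm_ge_zero mult.right_neutral order_trans)
  qed
  finally show ?thesis .
qed

text \<open>The lower half of the min-max principle: a span of dimension n + 1 contains a nonzero
  vector killed by F, and on it T - F coincides with T.\<close>

lemma sv_ge_subortho:
  assumes e: "subortho e" "\<And>i. i \<le> n \<Longrightarrow> norm (e i) = 1"
    and s: "\<And>a. s * norm (\<Sum>i\<le>n. cs (a i) (e i)) \<le> norm (app T (\<Sum>i\<le>n. cs (a i) (e i)))"
  shows "s \<le> sv n T"
proof (rule sv_geI)
  fix F assume "rank_le (to_op F) n"
  then obtain v where v: "\<And>x. \<exists>c. to_op F (co x) = (\<lambda>k. \<Sum>i<n. c i * v i k)"
    unfolding rank_le_def Ball_l2 by blast
  have "\<forall>i. \<exists>c. co (app F (e i)) = (\<lambda>k. \<Sum>j<n. c j * v j k)"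
    using v[of "e _"] by simp
  from choice[OF this] obtain c where c: "\<And>i. co (app F (e i)) = (\<lambda>k. \<Sum>j<n. c i j * v j k)"
    by blast
  obtain a where a: "\<exists>i\<in>{..n}. a i \<noteq> 0" "\<forall>j<n. (\<Sum>i\<le>n. a i * c i j) = 0"
    using homogeneous_system_solvable[of "{..n}" n c] by auto
  define x where "x = (\<Sum>i\<le>n. cs (a i) (e i))"
  have "app F x = 0"
  proof (rule ell2_eqI)
    fix k
    have "co (app F x) k = (\<Sum>i\<le>n. \<Sum>j<n. a i * c i j * v j k)"
      by (simp add: x_def c sum_distrib_left mult.assoc)
    also have "\<dots> = (\<Sum>j<n. (\<Sum>i\<le>n. a i * c i j) * v j k)"
      by (subst sum.swap) (simp add: sum_distrib_right)
    finally show "co (app F x) k = co 0 k" using a(2) by simp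
  qed
  have "(norm x)\<^sup>2 = (\<Sum>i\<le>n. (cmod (a i))\<^sup>2)"
    unfolding x_def subortho_norm_sum[OF e(1)] using e(2) by simp
  moreover obtain i where "i \<le> n" "a i \<noteq> 0" using a(1) by auto
  then have "(\<Sum>i\<le>n. (cmod (a i))\<^sup>2) > 0"
    by (intro sum_pos2[of _ i]) auto
  ultimately have "x \<noteq> 0" by (metis less_irrefl norm_zero power_zero_numeral)
  then have "norm x > 0" by simp
  have "s * norm x \<le> norm (app (T - F) x)"
    using s[of a] \<open>app F x = 0\<close> unfolding x_def[symmetric] by simp
  also have "\<dots> \<le> opn (T - F) * norm x" by (rule norm_app_le)
  finally show "s \<le> opn (T - F)" using \<open>norm x > 0\<close> by simp
qed

section \<open>Compact operators and the ideal of weak trace class\<close>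

definition cpt :: "bop \<Rightarrow> bool" where
  "cpt T \<longleftrightarrow> (\<forall>x. (\<forall>j. norm (x j) \<le> 1) \<longrightarrow>
     (\<exists>r::nat \<Rightarrow> nat. strict_mono r \<and> Cauchy (\<lambda>n. app T (x (r n)))))"

lemma compact_l2op_to_op: "compact_l2op (to_op T) \<longleftrightarrow> cpt T"
proof -
  have seq: "(\<forall>x::nat \<Rightarrow> vec. (\<forall>j. x j \<in> l2 \<and> l2norm (x j) \<le> 1) \<longrightarrow> P x)
    \<longleftrightarrow> (\<forall>x. (\<forall>j. norm (x j) \<le> 1) \<longrightarrow> P (\<lambda>j. co (x j)))" for P
  proof (intro iffI allI impI)
    fix x :: "nat \<Rightarrow> vec"
    assume *: "\<forall>x. (\<forall>j. norm (x j) \<le> 1) \<longrightarrow> P (\<lambda>j. co (x j))" and x: "\<forall>j. x j \<in> l2 \<and> l2norm (x j) \<le> 1"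
    then show "P x" using *[rule_format, of "\<lambda>j. of_seq (x j)"] by (simp add: norm_ell2_l2norm co_of_seq)
  qed (simp add: norm_ell2_l2norm co_l2)
  show ?thesis
    unfolding compact_l2op_def seq cpt_def Cauchy_def dist_norm
    by (simp add: bounded_op_to_op norm_ell2_l2norm flip: co_minus)
qed

definition L1bop :: "bop set" where "L1bop = {T. to_op T \<in> L1inf}"

lemma L1bop_iff: "T \<in> L1bop \<longleftrightarrow> cpt T \<and> (\<exists>C. \<forall>n. real (n + 1) * sv n T \<le> C)"
  unfolding L1bop_def L1inf_def by (auto simp: compact_l2op_to_op sv_def bdd_above_def)

lemma L1inf_obtain:
  assumes "A \<in> L1inf" obtains T where "A = to_op T" "T \<in> L1bop"
proof -
  have "bounded_op A" using assms by (simp add: L1inf_def compact_l2op_def)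
  then obtain T where T: "A = to_op T" by (rule bounded_op_obtain)
  with assms show ?thesis by (intro that) (auto simp: L1bop_def)
qed

section \<open>The singular value decomposition\<close>

lemma parallelogram: "(norm (x - y))\<^sup>2 + (norm (x + y))\<^sup>2 = 2 * (norm x)\<^sup>2 + 2 * (norm (y::'a::real_inner))\<^sup>2"
  by (simp add: power2_norm_eq_inner inner_add_left inner_add_right inner_diff_left inner_diff_right)

text \<open>Compactness makes the images of a maximising sequence Cauchy along a subsequence. Since
  T is bounded by L on M, the parallelogram law for the images and for the vectors then makes the
  subsequence itself Cauchy, so a strong limit exists in M.\<close>

lemma norm_attained:
  assumes T: "cpt T"
    and M: "\<And>x y. x \<in> M \<Longrightarrow> y \<in> M \<Longrightarrow> x + y \<in> M" "\<And>c x. x \<in> M \<Longrightarrow> cs c x \<in> M"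
    and cl: "\<And>X x. (\<And>n. X n \<in> M) \<Longrightarrow> X \<longlonglongrightarrow> x \<Longrightarrow> x \<in> M"
    and z: "z \<in> M" "z \<noteq> 0"
  shows "\<exists>e\<in>M. norm e = 1 \<and> (\<forall>x\<in>M. norm (app T x) \<le> norm (app T e) * norm x)"
proof -
  define S where "S = {norm (app T x) | x. x \<in> M \<and> norm x = 1}"
  define L where "L = Sup S"
  have scM: "r *\<^sub>R x \<in> M" if "x \<in> M" for r x using M(2)[OF that] by (simp add: scaleR_cs)
  have unit: "x /\<^sub>R norm x \<in> M \<and> norm (x /\<^sub>R norm x) = 1" if "x \<in> M" "x \<noteq> 0" for x
    using that by (simp add: scM)
  have ne: "S \<noteq> {}" using unit[OF z] unfolding S_def by blast
  have bdd: "bdd_above S"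
  proof (rule bdd_aboveI)
    fix s assume "s \<in> S"
    then obtain x where "s = norm (app T x)" "norm x = 1" unfolding S_def by blast
    then show "s \<le> opn T" using norm_app_le[of T x] by simp
  qed
  have L: "norm (app T x) \<le> L * norm x" if "x \<in> M" for x
  proof (cases "x = 0")
    case False
    then have "norm (app T (x /\<^sub>R norm x)) \<le> L"
      unfolding L_def using unit[OF that False] by (intro cSup_upper[OF _ bdd]) (auto simp only: S_def)
    then show ?thesis using False by (simp add: field_simps)
  qed simp
  have "0 \<le> norm (app T (z /\<^sub>R norm z))" by simp
  also have "\<dots> \<le> L" using L[of "z /\<^sub>R norm z"] unit[OF z] by simp
  finally have "0 \<le> L" .
  show ?thesis
  proof (cases "L = 0")
    case True
    then have "norm (app T x) \<le> norm (app T (z /\<^sub>R norm z)) * norm x" if "x \<in> M" for x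
      using L[OF that] by (intro order_trans[OF _ mult_nonneg_nonneg]) auto
    then show ?thesis using unit[OF z] by blast
  next
    case False
    with \<open>0 \<le> L\<close> have "L > 0" by simp
    have "\<exists>x. x \<in> M \<and> norm x = 1 \<and> L - 1 / real (Suc n) < norm (app T x)" for n
    proof -
      have "L - 1 / real (Suc n) < Sup S" by (simp add: L_def)
      then obtain s where "s \<in> S" "L - 1 / real (Suc n) < s" using less_cSupD[OF ne] by blast
      then show ?thesis unfolding S_def by blast
    qed
    then obtain X where X: "\<And>n. X n \<in> M" "\<And>n. norm (X n) = 1"
      "\<And>n. L - 1 / real (Suc n) < norm (app T (X n))" by metis
    obtain r where r: "strict_mono r" "Cauchy (\<lambda>n. app T (X (r n)))"
      using T[unfolded cpt_def, rule_format, of X] by (auto simp: X(2))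
    define Y where "Y n = X (r n)" for n
    have Y: "Y n \<in> M" "norm (Y n) = 1" for n using X by (auto simp: Y_def)
    have lim: "(\<lambda>n. norm (app T (Y n))) \<longlonglongrightarrow> L"
    proof (rule tendsto_sandwich[of "\<lambda>n. L - 1 / real (Suc n)" _ _ "\<lambda>_. L"])
      have "L - 1 / real (Suc n) \<le> norm (app T (Y n))" for n
      proof -
        have "1 / real (Suc (r n)) \<le> 1 / real (Suc n)"
          using seq_suble[OF r(1), of n] by (intro divide_left_mono) auto
        then show ?thesis using X(3)[of "r n"] by (simp add: Y_def)
      qed
      then show "\<forall>\<^sub>F n in sequentially. L - 1 / real (Suc n) \<le> norm (app T (Y n))" by simp
      show "\<forall>\<^sub>F n in sequentially. norm (app T (Y n)) \<le> L" 
        using L[OF Y(1)] by (simp add: Y(2))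
      show "(\<lambda>n. L - 1 / real (Suc n)) \<longlonglongrightarrow> L"
        using tendsto_diff[OF tendsto_const[of L] LIMSEQ_Suc[OF lim_1_over_n]] by simp
    qed simp
    have "Cauchy Y"
    proof (rule metric_CauchyI)
      fix \<epsilon> :: real assume "0 < \<epsilon>"
      define q where "q n = L\<^sup>2 - (norm (app T (Y n)))\<^sup>2" for n
      have "q \<longlonglongrightarrow> L\<^sup>2 - L\<^sup>2" unfolding q_def by (intro tendsto_intros lim)
      then have "q \<longlonglongrightarrow> 0" by simp
      \<comment> \<open>With both defects q below (L \<epsilon>)^2 / 8 and the image distance below
        L \<epsilon> / 2, the parallelogram law leaves a total of at most (1/2 + 1/4) (L
        \<epsilon>)^2, which is less than (L \<epsilon>)^2.\<close>
      moreover have "0 < (L * \<epsilon>)\<^sup>2 / 8" using \<open>L > 0\<close> \<open>0 < \<epsilon>\<close> by simp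
      ultimately have "\<forall>\<^sub>F n in sequentially. q n < (L * \<epsilon>)\<^sup>2 / 8" by (rule order_tendstoD)
      then obtain N1 where N1: "\<And>n. n \<ge> N1 \<Longrightarrow> q n < (L * \<epsilon>)\<^sup>2 / 8"
        unfolding eventually_sequentially by blast
      have "0 < L * \<epsilon> / 2" using \<open>L > 0\<close> \<open>0 < \<epsilon>\<close> by simp
      then obtain N2 where N2: "\<And>m n. m \<ge> N2 \<Longrightarrow> n \<ge> N2 \<Longrightarrow> dist (app T (Y m)) (app T (Y n)) < L * \<epsilon> / 2"
        using metric_CauchyD[OF r(2)] unfolding Y_def by blast
      have "dist (Y m) (Y n) < \<epsilon>" if "m \<ge> max N1 N2" "n \<ge> max N1 N2" for m n
      proof -
        have "(norm (app T (Y m) + app T (Y n)))\<^sup>2 \<le> (L * norm (Y m + Y n))\<^sup>2"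
          using L[OF M(1)[OF Y(1)[of m] Y(1)[of n]]] by (intro power_mono) auto
        moreover have "(norm (app T (Y m) - app T (Y n)))\<^sup>2 < (L * \<epsilon> / 2)\<^sup>2"
          using N2[of m n] that by (intro power_strict_mono) (auto simp: dist_norm)
        moreover have "(norm (Y m - Y n))\<^sup>2 = 4 - (norm (Y m + Y n))\<^sup>2"
          using parallelogram[of "Y m" "Y n"] by (simp add: Y)
        then have "L\<^sup>2 * (norm (Y m - Y n))\<^sup>2 = L\<^sup>2 * 4 - (L * norm (Y m + Y n))\<^sup>2"
          by (simp add: power_mult_distrib right_diff_distrib)
        moreover have "q m < (L * \<epsilon>)\<^sup>2 / 8" "q n < (L * \<epsilon>)\<^sup>2 / 8" using N1 that by auto
        moreover have "(L * \<epsilon> / 2)\<^sup>2 = (L * \<epsilon>)\<^sup>2 / 4" by (simp add: power_divide)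
        ultimately have "L\<^sup>2 * (norm (Y m - Y n))\<^sup>2 < (L * \<epsilon>)\<^sup>2"
          using parallelogram[of "app T (Y m)" "app T (Y n)"] zero_le_power2[of "L * \<epsilon>"]
          unfolding q_def by linarith
        then have "(norm (Y m - Y n))\<^sup>2 < \<epsilon>\<^sup>2"
          using \<open>L > 0\<close> by (simp add: power_mult_distrib)
        then show ?thesis using \<open>0 < \<epsilon>\<close> by (simp add: dist_norm power_less_imp_less_base)
      qed
      then show "\<exists>M. \<forall>m\<ge>M. \<forall>n\<ge>M. dist (Y m) (Y n) < \<epsilon>" by blast
    qed
    then obtain e where e: "Y \<longlonglongrightarrow> e" using Cauchy_convergent convergent_def by blast
    have "e \<in> M" using cl[OF Y(1) e] .
    moreover have "norm e = 1" using LIMSEQ_unique[OF tendsto_norm[OF e]] Y(2) by simp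
    moreover have "norm (app T e) = L"
      using LIMSEQ_unique[OF tendsto_norm[OF app_tendsto[OF e, of T]] lim] .
    ultimately show ?thesis using L by blast
  qed
qed

text \<open>Right singular vectors obtained by successive maximisation on orthogonal complements,
  instead of as eigenvectors of \<open>adj T * T\<close>.\<close>

definition greedy :: "bop \<Rightarrow> (nat \<Rightarrow> ell2) \<Rightarrow> bool" where
  "greedy T e \<longleftrightarrow> (\<forall>n. norm (e n) = 1 \<and> (\<forall>i<n. cip (e n) (e i) = 0) \<and>
     (\<forall>x. (\<forall>i<n. cip x (e i) = 0) \<longrightarrow> norm (app T x) \<le> norm (app T (e n)) * norm x))"

text \<open>The complement of n vectors is nonzero because n + 1 basis vectors have a nontrivial
  combination satisfying n orthogonality conditions; it is closed, so \<open>norm_attained\<close>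
  applies at each stage.\<close>

lemma greedy_exists:
  assumes "cpt T" shows "\<exists>e. greedy T e"
  unfolding greedy_def
proof (rule dependent_wf_choice[OF wf_less])
  fix n :: nat and f :: "nat \<Rightarrow> ell2"
  let ?M = "{x. \<forall>i<n. cip x (f i) = 0}"
  obtain a where a: "\<exists>i\<in>{..n}. a i \<noteq> 0" "\<forall>j<n. (\<Sum>i\<le>n. a i * cip (bvec i) (f j)) = 0"
    using homogeneous_system_solvable[of "{..n}" n "\<lambda>i j. cip (bvec i) (f j)"] by auto
  define z where "z = (\<Sum>i\<le>n. cs (a i) (bvec i))"
  have "z \<in> ?M" using a(2) by (simp add: z_def)
  moreover have "z \<noteq> 0"
  proof -
    obtain i where i: "i \<le> n" "a i \<noteq> 0" using a(1) by auto
    have "co z i = a i" using i by (simp add: z_def if_distrib[of "\<lambda>y. _ * y"] cong: if_cong)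
    then show ?thesis using i by auto
  qed
  moreover have "x \<in> ?M" if "\<And>k. X k \<in> ?M" "X \<longlonglongrightarrow> x" for X x
  proof -
    have "cip x (f i) = 0" if "i < n" for i
      using cip_tendsto[OF \<open>X \<longlonglongrightarrow> x\<close>, of "f i"] \<open>\<And>k. X k \<in> ?M\<close> that by (simp add: LIMSEQ_const_iff)
    then show ?thesis by simp
  qed
  ultimately have "\<exists>e\<in>?M. norm e = 1 \<and> (\<forall>x\<in>?M. norm (app T x) \<le> norm (app T e) * norm x)"
    by (intro norm_attained[OF assms]) auto
  then show "\<exists>r. norm r = 1 \<and> (\<forall>i<n. cip r (f i) = 0) \<and>
     (\<forall>x. (\<forall>i<n. cip x (f i) = 0) \<longrightarrow> norm (app T x) \<le> norm (app T r) * norm x)" by auto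
qed auto

lemma greedy_subortho: assumes "greedy T e" shows "subortho e"
  unfolding subortho_def
proof (intro conjI allI impI)
  fix i j :: nat assume "i \<noteq> j"
  then show "cip (e i) (e j) = 0"
    using assms unfolding greedy_def by (cases "i < j") (metis cip_commute complex_cnj_zero, metis nat_neq_iff)
qed (use assms in \<open>simp add: greedy_def\<close>)

lemma greedy_norm: "greedy T e \<Longrightarrow> norm (e n) = 1"
  by (simp add: greedy_def)

lemma greedy_bound:
  "greedy T e \<Longrightarrow> (\<And>i. i < n \<Longrightarrow> cip x (e i) = 0) \<Longrightarrow> norm (app T x) \<le> norm (app T (e n)) * norm x"
  by (simp add: greedy_def)

lemma greedy_antimono:
  assumes "greedy T e" "m \<le> n" shows "norm (app T (e n)) \<le> norm (app T (e m))"
  using greedy_bound[OF assms(1), of m "e n"] greedy_norm[OF assms(1)] subortho_cip[OF greedy_subortho[OF assms(1)]] assms(2)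
  by simp

lemma linear_le_quadratic:
  fixes R K :: real
  assumes "\<And>t. t * R \<le> t\<^sup>2 * K"
  shows "R = 0"
proof (rule ccontr)
  assume "R \<noteq> 0"
  define M where "M = \<bar>K\<bar> + 1"
  have "M > 0" by (simp add: M_def)
  \<comment> \<open>The choice t = R / M with M > K makes the linear term win over the quadratic
    one.\<close>
  have "R / M * R \<le> (R / M)\<^sup>2 * K" by (rule assms)
  also have "\<dots> < (R / M)\<^sup>2 * M"
    using \<open>R \<noteq> 0\<close> \<open>M > 0\<close> by (intro mult_strict_left_mono) (auto simp: M_def)
  finally show False using \<open>M > 0\<close> by (simp add: power2_eq_square)
qed

text \<open>First variation at the maximiser.\<close>

lemma greedy_image_orth_aux:
  assumes "greedy T e" "\<And>i. i \<le> n \<Longrightarrow> cip x (e i) = 0"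
  shows "Re (cip (app T (e n)) (app T x)) = 0"
proof -
  let ?s = "norm (app T (e n))"
  have "t * (2 * Re (cip (app T (e n)) (app T x))) \<le> t\<^sup>2 * (?s\<^sup>2 * (norm x)\<^sup>2 - (norm (app T x))\<^sup>2)" for t :: real
  proof -
    have o: "cip (e n) (e i) = 0" if "i < n" for i
      using that subortho_cip[OF greedy_subortho[OF assms(1)]] by simp
    have "cip (e n) x = 0" using assms(2)[of n] by (metis cip_commute complex_cnj_zero order_refl)
    then have n: "(norm (e n + t *\<^sub>R x))\<^sup>2 = 1 + t\<^sup>2 * (norm x)\<^sup>2"
      by (simp add: norm_add_sq greedy_norm[OF assms(1)] power_mult_distrib)
    have "norm (app T (e n + t *\<^sub>R x)) \<le> ?s * norm (e n + t *\<^sub>R x)"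
      using assms(2) o by (intro greedy_bound[OF assms(1)]) simp
    from power_mono[OF this norm_ge_zero, of 2]
    have "(norm (app T (e n + t *\<^sub>R x)))\<^sup>2 \<le> ?s\<^sup>2 * (1 + t\<^sup>2 * (norm x)\<^sup>2)"
      unfolding power_mult_distrib n .
    then show ?thesis
      by (simp add: norm_add_sq power_mult_distrib algebra_simps)
  qed
  from linear_le_quadratic[OF this] show ?thesis by simp
qed

text \<open>The first variation controls only the real part; applying it to i x gives the imaginary
  part.\<close>

lemma greedy_image_orth_later:
  assumes "greedy T e" "\<And>i. i \<le> n \<Longrightarrow> cip x (e i) = 0"
  shows "cip (app T (e n)) (app T x) = 0"
  using greedy_image_orth_aux[OF assms] greedy_image_orth_aux[OF assms(1), of n "cs \<i> x"] assms(2)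
  by (simp add: complex_eq_iff)

lemma greedy_image_orth:
  assumes "greedy T e" "i \<noteq> j"
  shows "cip (app T (e i)) (app T (e j)) = 0"
proof -
  have *: "cip (app T (e i)) (app T (e j)) = 0" if "i < j" for i j
    using that subortho_cip[OF greedy_subortho[OF assms(1)]] by (intro greedy_image_orth_later[OF assms(1)]) auto
  show ?thesis
    using *[of i j] *[of j i] assms(2) by (metis cip_commute complex_cnj_zero nat_neq_iff)
qed

text \<open>Since \<open>inverse 0 = 0\<close>, the zero vector is sent to itself, so normalised
  images of singular vectors stay a \<open>subortho\<close> system when some of the images
  vanish.\<close>

definition unit_vec :: "ell2 \<Rightarrow> ell2" where "unit_vec x = x /\<^sub>R norm x"

lemma unit_vec_subortho:
  assumes "\<And>i j. i \<noteq> j \<Longrightarrow> cip (f i) (f j) = 0"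
  shows "subortho (\<lambda>i. unit_vec (f i))"
  unfolding subortho_def unit_vec_def
proof (intro conjI allI impI)
  show "norm (f i /\<^sub>R norm (f i)) = 0 \<or> norm (f i /\<^sub>R norm (f i)) = 1" for i
    by (cases "f i = 0") auto
qed (simp add: assms)

lemma scale_unit_vec: "cs (of_real (norm x)) (unit_vec x) = x"
  by (cases "x = 0") (simp_all add: unit_vec_def flip: scaleR_cs)

text \<open>Above: the approximant is T on the span of the first n vectors, and the residual is
  controlled by maximality. Below: the images of the first n + 1 vectors are orthogonal and at least
  as long as the last of them, so T expands their span by that factor.\<close>

lemma greedy_sv:
  assumes g: "greedy T e"
  shows "sv n T = norm (app T (e n))" (is "_ = ?s")
proof (rule antisym)
  note on = greedy_subortho[OF g]
  show "sv n T \<le> ?s"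
  proof (rule sv_leI[where g = e and h = "\<lambda>i. app T (e i)"])
    fix x
    let ?P = "\<Sum>i<n. cs (cip x (e i)) (e i)"
    have "norm (app T x - (\<Sum>i<n. cs (cip x (e i)) (app T (e i)))) = norm (app T (x - ?P))"
      by simp
    also have "\<dots> \<le> ?s * norm (x - ?P)"
      by (intro greedy_bound[OF g] subortho_residual_orth[OF on]) auto
    also have "(norm (x - ?P))\<^sup>2 \<le> (norm x)\<^sup>2"
      unfolding subortho_residual_norm[OF on finite_lessThan] by (simp add: sum_nonneg)
    then have "?s * norm (x - ?P) \<le> ?s * norm x"
      by (intro mult_left_mono) (auto simp: power2_le_iff_abs_le)
    finally show "norm (app T x - (\<Sum>i<n. cs (cip x (e i)) (app T (e i)))) \<le> ?s * norm x" .
  qed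
  show "?s \<le> sv n T"
  proof (rule sv_ge_subortho[OF on])
    fix a
    let ?x = "\<Sum>i\<le>n. cs (a i) (e i)" and ?f = "\<lambda>i. unit_vec (app T (e i))"
    have f: "subortho ?f" by (intro unit_vec_subortho greedy_image_orth[OF g])
    have "app T ?x = (\<Sum>i\<le>n. cs (a i * of_real (norm (app T (e i)))) (?f i))"
      by (simp add: scale_unit_vec flip: cs_simps(7))
    then have "(norm (app T ?x))\<^sup>2 = (\<Sum>i\<le>n. (cmod (a i * of_real (norm (app T (e i)))))\<^sup>2 * (norm (?f i))\<^sup>2)"
      using subortho_norm_sum[OF f] by simp
    also have "\<dots> = (\<Sum>i\<le>n. (cmod (a i))\<^sup>2 * (norm (app T (e i)))\<^sup>2)"
    proof (intro sum.cong refl)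
      fix i
      show "(cmod (a i * of_real (norm (app T (e i)))))\<^sup>2 * (norm (?f i))\<^sup>2 = (cmod (a i))\<^sup>2 * (norm (app T (e i)))\<^sup>2"
        by (cases "app T (e i) = 0") (simp_all add: unit_vec_def norm_mult power_mult_distrib)
    qed
    also have "\<dots> \<ge> (\<Sum>i\<le>n. (cmod (a i))\<^sup>2 * ?s\<^sup>2)"
      using greedy_antimono[OF g] by (intro sum_mono mult_left_mono power_mono) auto
    also (xtrans) have "(\<Sum>i\<le>n. (cmod (a i))\<^sup>2 * ?s\<^sup>2) = (?s * norm ?x)\<^sup>2"
      unfolding power_mult_distrib subortho_norm_sum[OF on] by (simp add: greedy_norm[OF g] sum_distrib_left mult.commute)
    finally show "?s * norm ?x \<le> norm (app T ?x)"
      by (simp add: power2_le_iff_abs_le abs_mult)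
  qed (rule greedy_norm[OF g])
qed

lemma sv_antimono:
  assumes "cpt T" "m \<le> n" shows "sv n T \<le> sv m T"
  using greedy_exists[OF assms(1)] greedy_antimono[OF _ assms(2)] greedy_sv by metis

section \<open>Analysis, synthesis and diagonal operators\<close>

definition rowop :: "(nat \<Rightarrow> ell2) \<Rightarrow> bop" where
  "rowop e = Abs_bop (\<lambda>x. of_seq (\<lambda>k. cip x (e k)))"

definition colop :: "(nat \<Rightarrow> ell2) \<Rightarrow> bop" where "colop e = adj (rowop e)"

text \<open>Bessel's inequality makes the coefficient sequence square summable with norm at most
  \<open>norm x\<close>, so the coordinate formula really defines a contraction.\<close>

lemma co_rowop:
  assumes "subortho e" shows "co (app (rowop e) x) k = cip x (e k)"
proof -
  have b: "(\<Sum>k<n. (cmod (cip x (e k)))\<^sup>2) \<le> (norm x)\<^sup>2" for x n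
    by (rule subortho_bessel[OF assms]) simp
  note m = co_of_seq[OF l2_partialI(1)[OF b norm_ge_zero]]
  have "app (rowop e) = (\<lambda>x. of_seq (\<lambda>k. cip x (e k)))"
    unfolding rowop_def
  proof (rule Abs_bop_app[of _ 1])
    show "norm (of_seq (\<lambda>k. cip x (e k))) \<le> 1 * norm x" for x
      using l2_partialI(2)[OF b] by simp
  qed (rule ell2_eqI, simp only: m co_simps, simp)+
  then show ?thesis by (simp add: m)
qed

lemma adj_colop [simp]: "adj (colop e) = rowop e" by (simp add: colop_def)

lemma app_colop_bvec: assumes "subortho e" shows "app (colop e) (bvec k) = e k"
proof (rule cip_eqI)
  fix y
  show "cip (app (colop e) (bvec k)) y = cip (e k) y"
    by (simp add: colop_def cip_adj' co_rowop[OF assms]) (metis cip_commute)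
qed

lemma rowop_colop: assumes "subortho e" "\<And>k. norm (e k) = 1" shows "rowop e * colop e = 1"
proof (rule bop_eq_dlI)
  fix k
  have "e k \<noteq> 0" using assms(2)[of k] by auto
  then show "app (rowop e * colop e) (bvec k) = app 1 (bvec k)"
    by (intro ell2_eqI) (auto simp: co_rowop[OF assms(1)] app_colop_bvec[OF assms(1)] subortho_cip[OF assms(1)])
qed

text \<open>Meaningful for bounded d only; otherwise the value is unspecified.\<close>

definition dg :: "(nat \<Rightarrow> complex) \<Rightarrow> bop" where
  "dg d = Abs_bop (\<lambda>x. of_seq (\<lambda>k. d k * co x k))"

lemma co_dg:
  assumes "bounded (range d)" shows "co (app (dg d) x) k = d k * co x k"
proof -
  obtain C where C: "\<And>k. cmod (d k) \<le> C" using assms by (auto simp: bounded_iff)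
  have C0: "0 \<le> C" using C[of 0] norm_ge_zero order_trans by blast
  have b: "(\<Sum>k<n. (cmod (d k * co x k))\<^sup>2) \<le> (C * norm x)\<^sup>2" for x n
  proof -
    have "(\<Sum>k<n. (cmod (d k * co x k))\<^sup>2) \<le> (\<Sum>k<n. C\<^sup>2 * (cmod (co x k))\<^sup>2)"
      unfolding norm_mult power_mult_distrib by (intro sum_mono mult_right_mono power_mono C) auto
    also have "\<dots> \<le> C\<^sup>2 * (norm x)\<^sup>2"
      unfolding sum_distrib_left[symmetric] by (intro mult_left_mono co_partial_le) auto
    finally show ?thesis by (simp add: power_mult_distrib)
  qed
  have nn: "0 \<le> C * norm x" for x using C0 by simp
  note m = co_of_seq[OF l2_partialI(1)[OF b nn]]
  have "app (dg d) = (\<lambda>x. of_seq (\<lambda>k. d k * co x k))"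
    unfolding dg_def
  proof (rule Abs_bop_app[of _ C])
    show "norm (of_seq (\<lambda>k. d k * co x k)) \<le> C * norm x" for x
      using l2_partialI(2)[OF b nn] .
  qed (rule ell2_eqI, simp only: m, simp only: co_simps m, simp add: algebra_simps)+
  then show ?thesis by (simp add: m)
qed

lemma app_dg_bvec: "bounded (range d) \<Longrightarrow> app (dg d) (bvec k) = cs (d k) (bvec k)"
  by (rule ell2_eqI) (simp add: co_dg)

lemma to_op_dg: assumes "bounded (range d)" shows "to_op (dg d) = diag d"
  by (rule op_eqI) (auto simp: diag_def co_l2 co_dg[OF assms] to_op_notin)

section \<open>Ideal properties of compact operators and of \<open>L1bop\<close>\<close>

lemma cpt_bounded:
  assumes "cpt T" "\<And>j. norm (x j) \<le> C"
  shows "\<exists>r::nat \<Rightarrow> nat. strict_mono r \<and> Cauchy (\<lambda>n. app T (x (r n)))"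
proof -
  define K where "K = \<bar>C\<bar> + 1"
  have K: "K > 0" by (simp add: K_def)
  have "norm (x j /\<^sub>R K) \<le> 1" for j
    using assms(2)[of j] K by (simp add: field_simps) (simp add: K_def)
  with assms(1)[unfolded cpt_def, rule_format, of "\<lambda>j. x j /\<^sub>R K"]
  obtain r where r: "strict_mono r" "Cauchy (\<lambda>n. app T (x (r n) /\<^sub>R K))"
    by auto
  from Cauchy_convergent[OF r(2)] obtain l where "(\<lambda>n. app T (x (r n) /\<^sub>R K)) \<longlonglongrightarrow> l"
    by (auto simp: convergent_def)
  from tendsto_scaleR[OF tendsto_const[of K] this] have "(\<lambda>n. app T (x (r n))) \<longlonglongrightarrow> K *\<^sub>R l"
    using K by simp
  then show ?thesis using r(1) LIMSEQ_imp_Cauchy by blast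
qed

lemma cpt_mult_right: assumes "cpt T" shows "cpt (T * S)"
  unfolding cpt_def
proof (intro allI impI)
  fix x :: "nat \<Rightarrow> ell2" assume "\<forall>j. norm (x j) \<le> 1"
  then have "norm (app S (x j)) \<le> opn S" for j
    using norm_app_le[of S "x j"] opn_nonneg[of S] by (metis mult.right_neutral mult_left_mono order_trans)
  from cpt_bounded[OF assms this] show "\<exists>r::nat \<Rightarrow> nat. strict_mono r \<and> Cauchy (\<lambda>n. app (T * S) (x (r n)))"
    by simp
qed

lemma cpt_mult_left: assumes "cpt T" shows "cpt (S * T)"
  unfolding cpt_def
proof (intro allI impI)
  fix x :: "nat \<Rightarrow> ell2" assume "\<forall>j. norm (x j) \<le> 1"
  then obtain r where r: "strict_mono r" "Cauchy (\<lambda>n. app T (x (r n)))"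
    using assms unfolding cpt_def by blast
  then show "\<exists>r::nat \<Rightarrow> nat. strict_mono r \<and> Cauchy (\<lambda>n. app (S * T) (x (r n)))"
    using bounded_linear.Cauchy[OF app_bounded_linear r(2), of S] by (intro exI[of _ r]) simp
qed

lemma cpt_add: assumes "cpt S" "cpt T" shows "cpt (S + T)"
  unfolding cpt_def
proof (intro allI impI)
  fix x :: "nat \<Rightarrow> ell2" assume x: "\<forall>j. norm (x j) \<le> 1"
  then obtain r where r: "strict_mono r" "Cauchy (\<lambda>n. app S (x (r n)))"
    using assms unfolding cpt_def by blast
  obtain q where q: "strict_mono q" "Cauchy (\<lambda>n. app T (x (r (q n))))"
    using assms(2)[unfolded cpt_def, rule_format, of "\<lambda>n. x (r n)"] x by auto
  have "Cauchy (\<lambda>n. app S (x (r (q n))))"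
    using Cauchy_subseq_Cauchy[OF r(2) q(1)] by (simp add: o_def)
  then have "Cauchy (\<lambda>n. app S (x (r (q n))) + app T (x (r (q n))))"
    using q(2) by (simp add: Cauchy_convergent_iff convergent_add)
  then show "\<exists>r::nat \<Rightarrow> nat. strict_mono r \<and> Cauchy (\<lambda>n. app (S + T) (x (r n)))"
    using strict_mono_o[OF r(1) q(1)] by (intro exI[of _ "r \<circ> q"]) simp
qed

text \<open>The rank-n truncation of T along its greedy system, multiplied by X and Y, approximates
  the product.\<close>

lemma sv_mult:
  assumes "cpt T" shows "sv n (X * T * Y) \<le> opn X * opn Y * sv n T"
proof -
  obtain e where g: "greedy T e" using greedy_exists[OF assms] by blast
  note on = greedy_subortho[OF g]
  show ?thesis
  proof (rule sv_leI[where g = "\<lambda>i. app (adj Y) (e i)" and h = "\<lambda>i. app X (app T (e i))"])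
    fix x
    let ?y = "app Y x" let ?P = "\<Sum>i<n. cs (cip ?y (e i)) (e i)"
    have "norm (app (X * T * Y) x - (\<Sum>i<n. cs (cip x (app (adj Y) (e i))) (app X (app T (e i)))))
       = norm (app X (app T (?y - ?P)))"
      by (simp flip: cip_adj)
    also have "\<dots> \<le> opn X * norm (app T (?y - ?P))" by (rule norm_app_le)
    also have "\<dots> \<le> opn X * (sv n T * norm (?y - ?P))"
      by (intro mult_left_mono opn_nonneg greedy_bound[OF g, folded greedy_sv[OF g]]
          subortho_residual_orth[OF on]) auto
    also have "(norm (?y - ?P))\<^sup>2 \<le> (norm ?y)\<^sup>2"
      unfolding subortho_residual_norm[OF on finite_lessThan] by (simp add: sum_nonneg)
    then have "norm (?y - ?P) \<le> norm ?y" by (simp add: power2_le_iff_abs_le)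
    then have "opn X * (sv n T * norm (?y - ?P)) \<le> opn X * (sv n T * (opn Y * norm x))"
      using norm_app_le[of Y x] by (intro mult_left_mono opn_nonneg sv_nonneg) auto
    finally show "norm (app (X * T * Y) x - (\<Sum>i<n. cs (cip x (app (adj Y) (e i))) (app X (app T (e i)))))
      \<le> opn X * opn Y * sv n T * norm x" by (simp add: mult_ac)
  qed
qed

text \<open>Truncations of S and T of ranks m and n, concatenated in u and w, form one approximant
  of rank m + n.\<close>

lemma sv_add:
  assumes "cpt S" "cpt T" shows "sv (m + n) (S + T) \<le> sv m S + sv n T"
proof -
  obtain e where g: "greedy S e" using greedy_exists[OF assms(1)] by blast
  obtain f where h: "greedy T f" using greedy_exists[OF assms(2)] by blast
  have *: "norm (app S (x - (\<Sum>i<n. cs (cip x (e i)) (e i)))) \<le> sv n S * norm x" if g: "greedy S e" for S e n x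
  proof -
    let ?P = "\<Sum>i<n. cs (cip x (e i)) (e i)"
    note on = greedy_subortho[OF g]
    have "norm (app S (x - ?P)) \<le> sv n S * norm (x - ?P)"
      by (intro greedy_bound[OF g, folded greedy_sv[OF g]] subortho_residual_orth[OF on]) auto
    also have "(norm (x - ?P))\<^sup>2 \<le> (norm x)\<^sup>2"
      unfolding subortho_residual_norm[OF on finite_lessThan] by (simp add: sum_nonneg)
    then have "sv n S * norm (x - ?P) \<le> sv n S * norm x"
      by (intro mult_left_mono sv_nonneg) (auto simp: power2_le_iff_abs_le)
    finally show ?thesis .
  qed
  define u where "u i = (if i < m then e i else f (i - m))" for i
  define w where "w i = (if i < m then app S (e i) else app T (f (i - m)))" for i
  show ?thesis
  proof (rule sv_leI[where g = u and h = w])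
    fix x
    have split: "(\<Sum>i<m + n. G i) = (\<Sum>i<m. G i) + (\<Sum>i<n. G (m + i))" for G :: "nat \<Rightarrow> ell2"
      by (induction n) (auto simp: add.assoc)
    have "app (S + T) x - (\<Sum>i<m + n. cs (cip x (u i)) (w i)) =
       app S (x - (\<Sum>i<m. cs (cip x (e i)) (e i))) + app T (x - (\<Sum>i<n. cs (cip x (f i)) (f i)))"
      by (simp add: split u_def w_def)
    then show "norm (app (S + T) x - (\<Sum>i<m + n. cs (cip x (u i)) (w i))) \<le> (sv m S + sv n T) * norm x"
      using *[OF g, of x m] *[OF h, of x n] norm_triangle_ineq by (smt (verit) distrib_right)
  qed
qed

lemma L1bop_cpt: "T \<in> L1bop \<Longrightarrow> cpt T" by (simp add: L1bop_iff)

lemma L1bop_mult: assumes "T \<in> L1bop" shows "X * T * Y \<in> L1bop"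
proof -
  obtain C where C: "\<And>n. real (n + 1) * sv n T \<le> C" using assms by (auto simp: L1bop_iff)
  have "real (n + 1) * sv n (X * T * Y) \<le> opn X * opn Y * C" for n
  proof -
    have "real (n + 1) * sv n (X * T * Y) \<le> real (n + 1) * (opn X * opn Y * sv n T)"
      by (intro mult_left_mono sv_mult L1bop_cpt assms) auto
    also have "\<dots> = opn X * opn Y * (real (n + 1) * sv n T)" by simp
    also have "\<dots> \<le> opn X * opn Y * C" by (intro mult_left_mono C) (simp add: opn_nonneg)
    finally show ?thesis .
  qed
  then show ?thesis using L1bop_cpt[OF assms] by (auto simp: L1bop_iff intro: cpt_mult_left cpt_mult_right)
qed

lemma L1bop_left: "T \<in> L1bop \<Longrightarrow> X * T \<in> L1bop" and L1bop_right: "T \<in> L1bop \<Longrightarrow> T * X \<in> L1bop"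
  using L1bop_mult[of T X 1] L1bop_mult[of T 1 X] by simp_all

lemma L1bop_add: assumes "S \<in> L1bop" "T \<in> L1bop" shows "S + T \<in> L1bop"
proof -
  obtain C where C: "\<And>n. real (n + 1) * sv n S \<le> C" using assms by (auto simp: L1bop_iff)
  obtain D where D: "\<And>n. real (n + 1) * sv n T \<le> D" using assms by (auto simp: L1bop_iff)
  have cm: "cpt (S + T)" using assms L1bop_cpt cpt_add by blast
  have "real (n + 1) * sv n (S + T) \<le> 2 * (C + D)" for n
  proof -
    \<comment> \<open>The index is split evenly between the summands; since n + 1 is at most 2 (n
      div 2 + 1), only a factor 2 is lost.\<close>
    let ?h = "n div 2"
    have "sv n (S + T) \<le> sv (?h + ?h) (S + T)" by (rule sv_antimono[OF cm]) simp
    also have "\<dots> \<le> sv ?h S + sv ?h T" using assms by (intro sv_add L1bop_cpt)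
    finally have "real (n + 1) * sv n (S + T) \<le> real (2 * (?h + 1)) * (sv ?h S + sv ?h T)"
      by (intro mult_mono) (auto intro!: add_nonneg_nonneg sv_nonneg)
    also have "\<dots> \<le> 2 * (C + D)" using C[of ?h] D[of ?h] by (simp add: algebra_simps)
    finally show ?thesis .
  qed
  then show ?thesis using cm by (auto simp: L1bop_iff)
qed

text \<open>V and \<open>adj V\<close> are contractions, and T is recovered from its conjugate by
  compressing with V again, so \<open>sv_mult\<close> gives both inequalities.\<close>

lemma sv_conj:
  assumes "cpt T" "adj V * V = 1" shows "sv n (V * T * adj V) = sv n T"
proof (rule antisym)
  have le: "opn V \<le> 1" if "adj V * V = 1" for V
    using that isometry_iff[of V] by (intro opn_le) auto
  have le': "opn (adj V) \<le> 1"
  proof (rule opn_le)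
    fix y
    have "(norm (app (adj V) y))\<^sup>2 = cmod (cip (app V (app (adj V) y)) y)"
      by (simp add: cip_adj cip_self norm_power)
    also have "\<dots> \<le> norm (app V (app (adj V) y)) * norm y" by (rule cip_Cauchy_Schwarz)
    also have "\<dots> = norm (app (adj V) y) * norm y" using assms(2) isometry_iff[of V] by simp
    finally show "norm (app (adj V) y) \<le> 1 * norm y"
      by (cases "app (adj V) y = 0") (auto simp: power2_eq_square)
  qed simp
  show "sv n (V * T * adj V) \<le> sv n T"
    using sv_mult[OF assms(1), of n V "adj V"] mult_le_one[OF le[OF assms(2)] opn_nonneg le'] sv_nonneg[of n T]
    by (smt (verit) mult_left_le mult_left_mono mult_right_mono mult.commute mult.left_neutral)
  have "adj V * (V * T * adj V) * V = T"
    using assms(2) by (metis mult.assoc mult.left_neutral mult.right_neutral)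
  then show "sv n T \<le> sv n (V * T * adj V)"
    using sv_mult[OF cpt_mult_right[OF cpt_mult_left[OF assms(1)]], of n "adj V" V "adj V" V]
      mult_le_one[OF le' opn_nonneg le[OF assms(2)]] sv_nonneg[of n "V * T * adj V"]
    by (smt (verit) mult_left_le mult_left_mono mult_right_mono mult.commute mult.left_neutral)
qed

lemma norm_le_coordinates:
  assumes "0 \<le> s" "\<And>k. cmod (co y k) \<le> s * cmod (co x k)"
  shows "norm y \<le> s * norm x"
proof -
  have "(norm y)\<^sup>2 \<le> (\<Sum>k. s\<^sup>2 * (cmod (co x k))\<^sup>2)"
    unfolding norm_sq_co
  proof (intro suminf_le co_summable summable_mult)
    show "(cmod (co y k))\<^sup>2 \<le> s\<^sup>2 * (cmod (co x k))\<^sup>2" for k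
      using power_mono[OF assms(2) norm_ge_zero, of k 2] by (simp add: power_mult_distrib)
  qed
  also have "\<dots> = (s * norm x)\<^sup>2"
    by (simp add: norm_sq_co power_mult_distrib suminf_mult[OF co_summable])
  finally show ?thesis using assms(1) by (simp add: power2_le_iff_abs_le)
qed

lemma dg_tail:
  assumes "bounded (range d)" "0 \<le> s" "\<And>k. n \<le> k \<Longrightarrow> cmod (d k) \<le> s"
  shows "norm (app (dg d) x - (\<Sum>i<n. cs (d i * co x i) (bvec i))) \<le> s * norm x"
proof (rule norm_le_coordinates[OF assms(2)])
  fix k
  have "co (app (dg d) x - (\<Sum>i<n. cs (d i * co x i) (bvec i))) k = (if k < n then 0 else d k * co x k)"
    by (simp add: co_dg[OF assms(1)] if_distrib[of "\<lambda>y. _ * y"] cong: if_cong)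
  then show "cmod (co (app (dg d) x - (\<Sum>i<n. cs (d i * co x i) (bvec i))) k) \<le> s * cmod (co x k)"
    using assms(2,3) by (auto simp: norm_mult intro!: mult_right_mono)
qed

lemma sv_dg_le:
  assumes "bounded (range d)" "0 \<le> s" "\<And>k. n \<le> k \<Longrightarrow> cmod (d k) \<le> s"
  shows "sv n (dg d) \<le> s"
proof (rule sv_leI[where g = bvec and h = "\<lambda>i. cs (d i) (bvec i)"])
  show "norm (app (dg d) x - (\<Sum>i<n. cs (cip x (bvec i)) (cs (d i) (bvec i)))) \<le> s * norm x" for x
    using dg_tail[OF assms] by (simp add: mult.commute)
qed

lemma subortho_bvec: "subortho bvec" by (simp add: subortho_def)

text \<open>Truncation after n entries bounds from above; on the span of the first n + 1 basis
  vectors the diagonal operator expands by at least a n.\<close>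

lemma sv_dg_antimono:
  assumes "\<And>k. 0 \<le> a k" "\<And>m n. m \<le> n \<Longrightarrow> a n \<le> a m"
  shows "sv n (dg (\<lambda>k. of_real (a k))) = a n"
proof (rule antisym)
  have b: "bounded (range (\<lambda>k. complex_of_real (a k)))"
    using assms by (auto simp: bounded_iff intro!: exI[of _ "a 0"])
  show "sv n (dg (\<lambda>k. of_real (a k))) \<le> a n"
    using assms by (intro sv_dg_le[OF b]) auto
  show "a n \<le> sv n (dg (\<lambda>k. of_real (a k)))"
  proof (rule sv_ge_subortho[OF subortho_bvec norm_bvec])
    fix c
    let ?x = "\<Sum>i\<le>n. cs (c i) (bvec i)"
    have cx: "co ?x k = (if k \<le> n then c k else 0)" for k
      by (simp add: if_distrib[of "\<lambda>y. _ * y"] cong: if_cong)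
    have "norm (cs (of_real (a n)) ?x) \<le> 1 * norm (app (dg (\<lambda>k. of_real (a k))) ?x)"
    proof (rule norm_le_coordinates)
      fix k
      show "cmod (co (cs (of_real (a n)) ?x) k) \<le> 1 * cmod (co (app (dg (\<lambda>k. of_real (a k))) ?x) k)"
        unfolding co_dg[OF b] co_simps(6) cx using assms(1) assms(2)[of k n]
        by (auto simp: norm_mult intro!: mult_right_mono)
    qed simp
    then show "a n * norm ?x \<le> norm (app (dg (\<lambda>k. of_real (a k))) ?x)"
      unfolding norm_cs using assms(1) by simp
  qed
qed

text \<open>Tychonoff's theorem for a countable product of closed discs, where compactness implies
  sequential compactness; it takes the place of a diagonal argument.\<close>

lemma pointwise_convergent_subsequence:
  fixes f :: "nat \<Rightarrow> nat \<Rightarrow> complex"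
  assumes "\<And>n k. cmod (f n k) \<le> 1"
  obtains r l where "strict_mono (r :: nat \<Rightarrow> nat)" "\<And>k. (\<lambda>n. f (r n) k) \<longlonglongrightarrow> l k"
proof -
  let ?S = "PiE UNIV (\<lambda>_::nat. cball (0::complex) 1)"
  have "compactin (product_topology (\<lambda>_. euclidean) UNIV) ?S"
    unfolding compactin_PiE by (auto simp: compactin_euclidean_iff)
  then have "seq_compact ?S"
    unfolding euclidean_product_topology compactin_euclidean_iff by (rule compact_imp_seq_compact)
  moreover have "\<forall>n. f n \<in> ?S" using assms by auto
  ultimately obtain l r where "strict_mono r" and r: "(f \<circ> r) \<longlonglongrightarrow> l"
    by (rule seq_compactE)
  have "isCont (\<lambda>x::nat \<Rightarrow> complex. x k) l" for k
  proof -
    have "continuous_on UNIV (\<lambda>x::nat \<Rightarrow> complex. x k)" by (rule continuous_on_product_coordinates)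
    then show ?thesis unfolding continuous_on_eq_continuous_at[OF open_UNIV] by blast
  qed
  from isCont_tendsto_compose[OF this r] show ?thesis
    by (intro that[OF \<open>strict_mono r\<close>]) (simp add: o_def)
qed

text \<open>Entries beyond K are uniformly small, and the finitely many coordinates before K
  converge along the subsequence. Each of the two head terms costs \<epsilon> / 4, and the tail
  costs \<epsilon> / 4 times the diameter 2 of the unit ball.\<close>

lemma cpt_dg:
  assumes b: "bounded (range d)" and "d \<longlonglongrightarrow> 0"
  shows "cpt (dg d)"
  unfolding cpt_def
proof (intro allI impI)
  fix x :: "nat \<Rightarrow> ell2" assume x: "\<forall>j. norm (x j) \<le> 1"
  then have "cmod (co (x n) k) \<le> 1" for n k
    using norm_co_le[of "x n" k] by (meson order_trans)
  then obtain r l where r: "strict_mono r" and l: "\<And>k. (\<lambda>n. co (x (r n)) k) \<longlonglongrightarrow> l k"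
    using pointwise_convergent_subsequence[of "\<lambda>n. co (x n)"] by blast
  have "Cauchy (\<lambda>n. app (dg d) (x (r n)))"
  proof (rule metric_CauchyI)
    fix \<epsilon> :: real assume \<epsilon>: "0 < \<epsilon>"
    then have "\<forall>\<^sub>F k in sequentially. dist (d k) 0 < \<epsilon> / 4"
      using assms(2) by (intro tendstoD) auto
    then obtain K where K: "\<And>k. k \<ge> K \<Longrightarrow> cmod (d k) \<le> \<epsilon> / 4"
      unfolding eventually_sequentially by (auto intro: less_imp_le)
    define S where "S n = (\<Sum>k<K. cmod (d k) * cmod (co (x (r n)) k - l k))" for n
    have "S \<longlonglongrightarrow> (\<Sum>k<K. cmod (d k) * cmod (l k - l k))"
      unfolding S_def by (intro tendsto_intros l)
    then have "S \<longlonglongrightarrow> 0" by simp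
    then have "\<forall>\<^sub>F n in sequentially. S n < \<epsilon> / 4" using \<epsilon> by (intro order_tendstoD(2)) auto
    then obtain N where N: "\<And>n. n \<ge> N \<Longrightarrow> S n < \<epsilon> / 4"
      unfolding eventually_sequentially by blast
    have "dist (app (dg d) (x (r m))) (app (dg d) (x (r n))) < \<epsilon>" if "m \<ge> N" "n \<ge> N" for m n
    proof -
      let ?z = "x (r m) - x (r n)" let ?P = "\<Sum>k<K. cs (d k * co ?z k) (bvec k)"
      have "norm ?P \<le> (\<Sum>k<K. cmod (d k) * cmod (co (x (r m)) k - l k) + cmod (d k) * cmod (co (x (r n)) k - l k))"
      proof (rule sum_norm_le)
        fix k
        have "cmod (co ?z k) \<le> cmod (co (x (r m)) k - l k) + cmod (co (x (r n)) k - l k)"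
          using norm_triangle_ineq4[of "co (x (r m)) k - l k" "co (x (r n)) k - l k"] by simp
        then show "norm (cs (d k * co ?z k) (bvec k))
            \<le> cmod (d k) * cmod (co (x (r m)) k - l k) + cmod (d k) * cmod (co (x (r n)) k - l k)"
          unfolding norm_cs norm_mult norm_bvec distrib_left[symmetric] mult_1_right
          by (rule mult_left_mono) simp
      qed
      also have "\<dots> = S m + S n" by (simp add: S_def sum.distrib)
      finally have 1: "norm ?P < \<epsilon> / 2" using N[OF that(1)] N[OF that(2)] by linarith
      have "norm ?z \<le> 2"
        using norm_triangle_ineq4[of "x (r m)" "x (r n)"] x[rule_format, of "r m"] x[rule_format, of "r n"]
        by linarith
      have "norm (app (dg d) ?z - ?P) \<le> \<epsilon> / 4 * norm ?z" using \<epsilon> by (intro dg_tail[OF b] K) auto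
      also have "\<dots> \<le> \<epsilon> / 4 * 2" using \<epsilon> \<open>norm ?z \<le> 2\<close> by (intro mult_left_mono) auto
      finally have "norm (app (dg d) ?z - ?P) \<le> \<epsilon> / 2" by simp
      then have "norm (app (dg d) ?z) < \<epsilon>"
        using 1 norm_triangle_sub[of "app (dg d) ?z" ?P] by linarith
      then show ?thesis by (simp add: dist_norm)
    qed
    then show "\<exists>M. \<forall>m\<ge>M. \<forall>n\<ge>M. dist (app (dg d) (x (r m))) (app (dg d) (x (r n))) < \<epsilon>" by blast
  qed
  then show "\<exists>r::nat \<Rightarrow> nat. strict_mono r \<and> Cauchy (\<lambda>n. app (dg d) (x (r n)))" using r by blast
qed

definition weak_l1 :: "(nat \<Rightarrow> complex) \<Rightarrow> bool" where
  "weak_l1 d \<longleftrightarrow> (\<exists>C. \<forall>k. cmod (d k) \<le> C / real (k + 1))"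

lemma weak_l1_tendsto: assumes "weak_l1 d" shows "d \<longlonglongrightarrow> 0"
proof -
  obtain C where C: "\<And>k. cmod (d k) \<le> C / real (k + 1)" using assms by (auto simp: weak_l1_def)
  have "(\<lambda>k. C / real (k + 1)) \<longlonglongrightarrow> C * 0"
    using tendsto_mult[OF tendsto_const[of C] LIMSEQ_Suc[OF lim_1_over_n]] by simp
  then have "(\<lambda>k. C / real (k + 1)) \<longlonglongrightarrow> 0" by simp
  then show ?thesis by (rule Lim_null_comparison[OF always_eventually[OF allI[OF C]]])
qed

lemma weak_l1_bounded: "weak_l1 d \<Longrightarrow> bounded (range d)"
  by (rule convergent_imp_bounded[OF weak_l1_tendsto])

lemma L1bop_dg: assumes "weak_l1 d" shows "dg d \<in> L1bop"
proof -
  obtain C where C: "\<And>k. cmod (d k) \<le> C / real (k + 1)" using assms by (auto simp: weak_l1_def)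
  have "0 \<le> C" using order_trans[OF norm_ge_zero C[of 0]] by simp
  note b = weak_l1_bounded[OF assms]
  have "real (n + 1) * sv n (dg d) \<le> C" for n
  proof -
    have "sv n (dg d) \<le> C / real (n + 1)"
    proof (rule sv_dg_le[OF b])
      fix k assume "n \<le> k"
      then have "C / real (k + 1) \<le> C / real (n + 1)" using \<open>0 \<le> C\<close> by (intro divide_left_mono) auto
      then show "cmod (d k) \<le> C / real (n + 1)" using C[of k] by linarith
    qed (simp add: \<open>0 \<le> C\<close>)
    then show ?thesis by (simp add: field_simps)
  qed
  then show ?thesis using cpt_dg[OF b weak_l1_tendsto[OF assms]] by (auto simp: L1bop_iff)
qed

lemma weak_l1_sv: assumes "T \<in> L1bop" shows "weak_l1 (\<lambda>k. of_real (sv k T))"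
proof -
  obtain C where "\<And>n. real (n + 1) * sv n T \<le> C" using assms by (auto simp: L1bop_iff)
  then have "cmod (of_real (sv k T)) \<le> C / real (k + 1)" for k
    by (simp add: field_simps sv_nonneg)
  then show ?thesis unfolding weak_l1_def by blast
qed

section \<open>Positive operators and the spectral theorem\<close>

text \<open>Polarisation over the complex scalars: the test vectors x + y and x + i y give the sum
  and the difference of the two mixed terms.\<close>

lemma quadratic_form_zero:
  assumes "\<And>x. cip (app D x) x = 0" shows "D = 0"
proof (rule bop_eqI, rule cip_eqI)
  fix x y
  have "cip (app D x) y + cip (app D y) x = 0"
    using assms[of "x + y"] assms[of x] assms[of y] by (simp add: add.commute)
  moreover have "cip (app D x) y - cip (app D y) x = 0"
    using assms[of "x + cs \<i> y"] assms[of x] assms[of y] by (simp add: algebra_simps)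
  ultimately show "cip (app D x) y = cip (app 0 x) y" by (simp add: complex_eq_iff)
qed

lemma posop_self_adjoint: assumes "posop T" shows "adj T = T"
proof -
  have "cip (app (T - adj T) x) x = 0" for x
    using assms cip_commute[of x "app T x"] unfolding posop_def by (simp add: cip_adj' complex_eq_iff)
  then show ?thesis using quadratic_form_zero[of "T - adj T"] by simp
qed

text \<open>Maximality forces T (T e) = s^2 e, and T + s is injective for s > 0.\<close>

lemma greedy_eigenvector:
  assumes g: "greedy T e" and T: "posop T"
  shows "app T (e n) = cs (of_real (sv n T)) (e n)"
proof (induction n rule: less_induct)
  case (less n)
  have sa: "cip (app T x) y = cip x (app T y)" for x y using posop_self_adjoint[OF T] cip_adj by metis
  define s where "s = sv n T"
  have s: "norm (app T (e n)) = s" using greedy_sv[OF g] by (simp add: s_def)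
  \<comment> \<open>The earlier vectors are already known to be eigenvectors, so T e_n stays in the
    complement on which e_n is the maximiser; maximality may then be applied to T e_n
    itself.\<close>
  have "cip (app T (e n)) (e i) = 0" if "i < n" for i
    using that less[OF that] subortho_cip[OF greedy_subortho[OF g]] by (simp add: sa)
  then have 1: "norm (app T (app T (e n))) \<le> s\<^sup>2"
    using greedy_bound[OF g, of n "app T (e n)"] by (simp add: s power2_eq_square)
  \<comment> \<open>By self-adjointness the mixed term is -2 s^2 times the squared norm of T e_n,
    that is -2 s^4, which exactly uses up the bound just obtained.\<close>
  have "(norm (app T (app T (e n)) + (- s\<^sup>2) *\<^sub>R e n))\<^sup>2
      = (norm (app T (app T (e n))))\<^sup>2 + s ^ 4 - 2 * s ^ 4"
    unfolding norm_add_sq by (simp add: sa cip_self s greedy_norm[OF g] power_mult_distrib flip: power_mult power_add of_real_power)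
  also have "\<dots> \<le> (s\<^sup>2)\<^sup>2 + s ^ 4 - 2 * s ^ 4"
    using power_mono[OF 1 norm_ge_zero, of 2] by simp
  finally have TT: "app T (app T (e n)) = (s\<^sup>2) *\<^sub>R e n"
    by (simp flip: power_mult add: add_eq_0_iff2)
  define w where "w = app T (e n) - s *\<^sub>R e n"
  have "app T w = (- s) *\<^sub>R w" by (simp add: w_def TT scaleR_diff_right power2_eq_square)
  then have "cip (app T w) w = of_real (- s * (norm w)\<^sup>2)" by (simp add: cip_self)
  then have "0 \<le> - s * (norm w)\<^sup>2" using T unfolding posop_def by (metis Re_complex_of_real)
  moreover have "0 \<le> s" using s norm_ge_zero by metis
  ultimately have "s = 0 \<or> w = 0" by (auto simp: mult_le_0_iff zero_le_mult_iff)
  then show ?case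
  proof
    assume "s = 0" then show ?thesis using s by (simp add: s_def)
  next
    assume "w = 0" then show ?thesis by (simp add: w_def s_def scaleR_cs)
  qed
qed

text \<open>The difference R vanishes on the range of \<open>colop e\<close> by its values on the
  basis. On the orthogonal complement of the e k, T is bounded by every singular value, and these
  tend to 0.\<close>

lemma svd_factorization:
  assumes T: "T \<in> L1bop" and g: "greedy T e" and f: "subortho f"
    and Te: "\<And>k. app T (e k) = cs (of_real (sv k T)) (f k)"
  shows "T = colop f * dg (\<lambda>k. of_real (sv k T)) * rowop e"
proof -
  let ?S = "dg (\<lambda>k. of_real (sv k T))"
  note on = greedy_subortho[OF g] and wl1 = weak_l1_sv[OF T]
  note rc = rowop_colop[OF on greedy_norm[OF g]]
  have rc': "app (rowop e) (app (colop e) x) = x" for x using rc by (metis app_simps(2,6))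
  have re: "app (rowop e) (e k) = bvec k" for k using rc'[of "bvec k"] by (simp add: app_colop_bvec[OF on])
  define R where "R = T - colop f * ?S * rowop e"
  have Rc: "R * colop e = 0"
    by (rule bop_eq_dlI) (simp add: R_def re app_colop_bvec[OF on] Te app_colop_bvec[OF f] app_dg_bvec[OF weak_l1_bounded[OF wl1]])
  have "R = 0"
  proof (rule bop_eqI)
    fix x
    define y where "y = x - app (colop e) (app (rowop e) x)"
    have r0: "app (rowop e) y = 0" by (simp add: y_def rc')
    then have "cip y (e k) = 0" for k using co_rowop[OF on, of y k] by simp
    then have "norm (app T y) \<le> sv n T * norm y" for n
      using greedy_bound[OF g] greedy_sv[OF g] by simp
    moreover have "(\<lambda>n. sv n T * norm y) \<longlonglongrightarrow> 0 * norm y"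
      using weak_l1_tendsto[OF wl1] tendsto_of_real_iff[of "\<lambda>n. sv n T" 0, where 'a = complex]
      by (intro tendsto_mult tendsto_const) simp
    ultimately have "norm (app T y) \<le> 0 * norm y"
      by (intro LIMSEQ_le_const[of _ "0 * norm y"]) auto
    then have "app R y = 0" by (simp add: R_def r0)
    moreover have "app R (app (colop e) (app (rowop e) x)) = 0"
      using Rc by (metis app_simps(1,6))
    ultimately show "app R x = app 0 x" by (simp add: y_def)
  qed
  then show ?thesis by (simp add: R_def)
qed

lemma spectral_theorem:
  assumes "T \<in> L1bop" "posop T"
  obtains e where "subortho e" "\<And>k. norm (e k) = 1" "\<And>k. app T (e k) = cs (of_real (sv k T)) (e k)"
    "T = colop e * dg (\<lambda>k. of_real (sv k T)) * rowop e"
proof -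
  obtain e where g: "greedy T e" using greedy_exists[OF L1bop_cpt[OF assms(1)]] by blast
  show ?thesis
    using svd_factorization[OF assms(1) g greedy_subortho[OF g] greedy_eigenvector[OF g assms(2)]]
    by (intro that[of e] greedy_subortho[OF g] greedy_norm[OF g] greedy_eigenvector[OF g assms(2)])
qed

lemma cip_dg_real:
  assumes "bounded (range a)"
  shows "cip (app (dg (\<lambda>k. of_real (a k))) x) x = of_real (\<Sum>k. a k * (cmod (co x k))\<^sup>2)"
    and "summable (\<lambda>k. a k * (cmod (co x k))\<^sup>2)"
proof -
  have b: "bounded (range (\<lambda>k. complex_of_real (a k)))" using assms by (auto simp: bounded_iff)
  have eq: "co (app (dg (\<lambda>k. of_real (a k))) x) k * cnj (co x k) = of_real (a k * (cmod (co x k))\<^sup>2)" for k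
    unfolding co_dg[OF b] of_real_mult complex_norm_square by (simp add: mult.assoc)
  have "summable (\<lambda>k. complex_of_real (a k * (cmod (co x k))\<^sup>2))"
    unfolding eq[symmetric] by (rule cip_summable)
  then show s: "summable (\<lambda>k. a k * (cmod (co x k))\<^sup>2)" by (simp only: summable_complex_of_real)
  show "cip (app (dg (\<lambda>k. of_real (a k))) x) x = of_real (\<Sum>k. a k * (cmod (co x k))\<^sup>2)"
    unfolding cip_def' eq by (rule suminf_of_real[OF s, symmetric])
qed

lemma posop_dg: assumes "bounded (range a)" "\<And>k. 0 \<le> a k" shows "posop (dg (\<lambda>k. of_real (a k)))"
  unfolding posop_def cip_dg_real[OF assms(1)]
  using cip_dg_real(2)[OF assms(1)] assms(2) by (auto intro!: suminf_nonneg)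

lemma posop_conj: "posop T \<Longrightarrow> posop (X * T * adj X)"
  unfolding posop_def by (simp add: cip_adj[of X])

lemma posop_add: "posop S \<Longrightarrow> posop T \<Longrightarrow> posop (S + T)"
  unfolding posop_def by simp

lemma posop_scale: "0 \<le> r \<Longrightarrow> posop T \<Longrightarrow> posop (sc (of_real r) * T)"
  unfolding posop_def by simp

lemma bounded_sv: "T \<in> L1bop \<Longrightarrow> bounded (range (\<lambda>k. sv k T))"
  using weak_l1_bounded[OF weak_l1_sv, of T] by (auto simp: bounded_iff)

text \<open>Polarisation of the singular value decomposition T = F D E*.\<close>

lemma positive_decomposition:
  assumes "T \<in> L1bop"
  obtains P Q R S where "P \<in> L1bop" "Q \<in> L1bop" "R \<in> L1bop" "S \<in> L1bop" "posop P" "posop Q" "posop R" "posop S"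
    "T = P - Q + sc \<i> * (R - S)"
proof -
  obtain e where g: "greedy T e" using greedy_exists[OF L1bop_cpt[OF assms]] by blast
  define f where "f k = unit_vec (app T (e k))" for k
  have f: "subortho f" unfolding f_def by (intro unit_vec_subortho greedy_image_orth[OF g])
  define D where "D = dg (\<lambda>k. of_real (sv k T))"
  have D: "D \<in> L1bop" "posop D"
    unfolding D_def using assms by (auto intro!: L1bop_dg weak_l1_sv posop_dg bounded_sv sv_nonneg)
  have T: "T = colop f * D * rowop e"
    unfolding D_def by (rule svd_factorization[OF assms g f]) (simp add: f_def greedy_sv[OF g] scale_unit_vec)
  \<comment> \<open>With F = \<open>colop f\<close> and E = \<open>colop e\<close>, the conjugate by
    F + c E contains F D \<open>adj E\<close> with factor \<open>cnj c\<close>. The weights c = 1,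
    -1, i, -i cancel all other terms and sum this one to 4, hence the 1/4.\<close>
  define P where "P c = sc (of_real (1/4)) * ((colop f + sc c * colop e) * D * adj (colop f + sc c * colop e))" for c
  have "P c \<in> L1bop" "posop (P c)" for c
    unfolding P_def by (intro L1bop_left L1bop_mult D, intro posop_scale posop_conj D) simp
  moreover have "T = P 1 - P (- 1) + sc \<i> * (P \<i> - P (- \<i>))"
    by (rule bop_eqI, rule ell2_eqI) (simp add: T P_def field_simps)
  ultimately show ?thesis by (intro that)
qed

section \<open>Ky Fan inequalities\<close>

lemma quadratic_form_series:
  assumes "T \<in> L1bop" "T = colop e * dg (\<lambda>k. of_real (sv k T)) * rowop e" "subortho e"
  shows "Re (cip (app T x) x) = (\<Sum>k. sv k T * (cmod (cip x (e k)))\<^sup>2)"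
    and "summable (\<lambda>k. sv k T * (cmod (cip x (e k)))\<^sup>2)"
proof -
  have "cip (app T x) x = cip (app (dg (\<lambda>k. of_real (sv k T))) (app (rowop e) x)) (app (rowop e) x)"
    by (subst assms(2)) (simp add: cip_adj)
  then show "Re (cip (app T x) x) = (\<Sum>k. sv k T * (cmod (cip x (e k)))\<^sup>2)"
    by (simp add: cip_dg_real(1)[OF bounded_sv[OF assms(1)]] co_rowop[OF assms(3)])
  show "summable (\<lambda>k. sv k T * (cmod (cip x (e k)))\<^sup>2)"
    using cip_dg_real(2)[OF bounded_sv[OF assms(1)], of "app (rowop e) x"] by (simp add: co_rowop[OF assms(3)])
qed

lemma cmod_cip_commute: "cmod (cip x y) = cmod (cip y x)"
  by (metis cip_commute complex_mod_cnj)

text \<open>In an eigenbasis of T the left side is the sum of \<open>sv k T * w k\<close> with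
  weights in [0,1] of total mass at most N; for decreasing singular values it is largest when the
  mass sits on the first N of them.\<close>

lemma ky_fan_upper:
  assumes T: "T \<in> L1bop" "posop T" and g: "subortho g"
  shows "(\<Sum>j<N. Re (cip (app T (g j)) (g j))) \<le> (\<Sum>k<N. sv k T)"
proof -
  obtain e where e: "subortho e" "\<And>k. norm (e k) = 1" "\<And>k. app T (e k) = cs (of_real (sv k T)) (e k)"
    "T = colop e * dg (\<lambda>k. of_real (sv k T)) * rowop e"
    using spectral_theorem[OF T] by blast
  define w where "w k = (\<Sum>j<N. (cmod (cip (g j) (e k)))\<^sup>2)" for k
  have w1: "w k \<le> 1" for k
    using subortho_bessel[OF g finite_lessThan, of "e k" N] by (simp add: w_def e(2) cmod_cip_commute[of "g _"])
  have w0: "0 \<le> w k" for k by (simp add: w_def sum_nonneg)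
  have bes: "(\<Sum>k<n. (cmod (cip x (e k)))\<^sup>2) \<le> (norm x)\<^sup>2" for n x
    by (rule subortho_bessel[OF e(1)]) simp
  have sm: "summable (\<lambda>k. (cmod (cip x (e k)))\<^sup>2)" for x
    using bes[of x "Suc _"] by (intro bounded_imp_summable[of _ "(norm x)\<^sup>2"]) (auto simp: lessThan_Suc_atMost[symmetric])
  have ws: "summable w" unfolding w_def by (intro summable_sum sm)
  have "suminf w = (\<Sum>j<N. \<Sum>k. (cmod (cip (g j) (e k)))\<^sup>2)"
    unfolding w_def by (rule suminf_sum[OF sm])
  also have "\<dots> \<le> (\<Sum>j<N. 1)"
  proof (rule sum_mono)
    fix j
    have "(\<Sum>k. (cmod (cip (g j) (e k)))\<^sup>2) \<le> (norm (g j))\<^sup>2"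
      using bes by (intro suminf_le_const sm)
    also have "\<dots> \<le> 1" using g unfolding subortho_def by (metis order_refl power_one zero_le_one zero_power2)
    finally show "(\<Sum>k. (cmod (cip (g j) (e k)))\<^sup>2) \<le> 1" .
  qed
  finally have wN: "suminf w \<le> real N" by simp
  have "(\<Sum>j<N. Re (cip (app T (g j)) (g j))) = (\<Sum>j<N. \<Sum>k. sv k T * (cmod (cip (g j) (e k)))\<^sup>2)"
    by (simp add: quadratic_form_series(1)[OF T(1) e(4,1)])
  also have "\<dots> = (\<Sum>k. sv k T * w k)"
    unfolding w_def sum_distrib_left
    by (rule suminf_sum[symmetric]) (rule quadratic_form_series(2)[OF T(1) e(4,1)])
  \<comment> \<open>Termwise this says that the product of \<open>sv k T - sv N T\<close> with w k
    minus the indicator of k < N is nonpositive: the factors have opposite signs on both sides of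
    N.\<close>
  also have "\<dots> \<le> (\<Sum>k. sv N T * w k + (if k \<in> {..<N} then sv k T - sv N T else 0))"
  proof (rule suminf_le)
    show "summable (\<lambda>k. sv k T * w k)"
      unfolding w_def sum_distrib_left by (intro summable_sum quadratic_form_series(2)[OF T(1) e(4,1)])
    show "summable (\<lambda>k. sv N T * w k + (if k \<in> {..<N} then sv k T - sv N T else 0))"
      by (intro summable_add summable_mult ws summable_If_finite_set) simp
    fix k
    note am = sv_antimono[OF L1bop_cpt[OF T(1)]]
    show "sv k T * w k \<le> sv N T * w k + (if k \<in> {..<N} then sv k T - sv N T else 0)"
    proof (cases "k < N")
      case True
      then have "(sv k T - sv N T) * w k \<le> (sv k T - sv N T) * 1"
        using am[of k N] w1 by (intro mult_left_mono) auto
      then show ?thesis using True by (simp add: algebra_simps)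
    next
      case False
      then show ?thesis using am[of N k] w0 by (simp add: mult_right_mono)
    qed
  qed
  also have "\<dots> = sv N T * suminf w + (\<Sum>k<N. sv k T - sv N T)"
    using suminf_add[OF summable_mult[OF ws, of "sv N T"] summable_If_finite_set[of "{..<N}" "\<lambda>k. sv k T - sv N T"]]
      sums_unique[OF sums_If_finite_set[of "{..<N}" "\<lambda>k. sv k T - sv N T"]]
    by (simp add: suminf_mult[OF ws])
  also have "\<dots> \<le> sv N T * real N + (\<Sum>k<N. sv k T - sv N T)"
    using wN sv_nonneg by (intro add_right_mono mult_left_mono)
  finally show ?thesis by (simp add: sum_subtractf mult.commute)
qed

text \<open>The e i lie in the span of the g j, so the projection onto the former is dominated by
  the projection onto the latter. The inequality is checked on each eigenvector of T and summed with
  the singular values as weights.\<close>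

lemma trace_mono_span:
  assumes T: "T \<in> L1bop" "posop T" and e: "subortho e" and g: "subortho g"
    and span: "\<And>i. i < N \<Longrightarrow> e i = (\<Sum>j<M. cs (cip (e i) (g j)) (g j))"
  shows "(\<Sum>i<N. Re (cip (app T (e i)) (e i))) \<le> (\<Sum>j<M. Re (cip (app T (g j)) (g j)))"
proof -
  obtain h where h: "subortho h" "\<And>k. norm (h k) = 1" "\<And>k. app T (h k) = cs (of_real (sv k T)) (h k)"
    "T = colop h * dg (\<lambda>k. of_real (sv k T)) * rowop h"
    using spectral_theorem[OF T] by blast
  have le: "(\<Sum>i<N. (cmod (cip (e i) x))\<^sup>2) \<le> (\<Sum>j<M. (cmod (cip (g j) x))\<^sup>2)" for x
  proof -
    \<comment> \<open>The projection of x onto the span of the g j; the e i do not distinguish it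
      from x, and Bessel's inequality for y is sharper than for x.\<close>
    define y where "y = (\<Sum>j<M. cs (cip x (g j)) (g j))"
    have "cip (e i) x = cip (e i) y" if "i < N" for i
    proof -
      have "cip (e i) x = (\<Sum>j<M. cip (e i) (g j) * cip (g j) x)"
        by (subst span[OF that]) simp
      also have "\<dots> = cip (e i) y"
        unfolding y_def by (simp add: cip_commute[of "g _" x] mult.commute)
      finally show ?thesis .
    qed
    then have "(\<Sum>i<N. (cmod (cip (e i) x))\<^sup>2) = (\<Sum>i<N. (cmod (cip y (e i)))\<^sup>2)"
      by (simp add: cmod_cip_commute[of y])
    also have "\<dots> \<le> (norm y)\<^sup>2" by (rule subortho_bessel[OF e]) simp
    also have "\<dots> = (\<Sum>j<M. (cmod (cip x (g j)))\<^sup>2 * (norm (g j))\<^sup>2)"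
      unfolding y_def by (rule subortho_norm_sum[OF g])
    also have "\<dots> \<le> (\<Sum>j<M. (cmod (cip (g j) x))\<^sup>2)"
    proof (rule sum_mono)
      fix j
      have "norm (g j) \<le> 1" using g unfolding subortho_def by (metis order_refl zero_le_one)
      then have "(norm (g j))\<^sup>2 \<le> 1" by (simp add: power_le_one)
      then show "(cmod (cip x (g j)))\<^sup>2 * (norm (g j))\<^sup>2 \<le> (cmod (cip (g j) x))\<^sup>2"
        by (simp add: cmod_cip_commute[of x] mult_left_le)
    qed
    finally show ?thesis .
  qed
  have series: "(\<Sum>j<n. Re (cip (app T (b j)) (b j))) = (\<Sum>k. sv k T * (\<Sum>j<n. (cmod (cip (b j) (h k)))\<^sup>2))"
    and summ: "summable (\<lambda>k. sv k T * (\<Sum>j<n. (cmod (cip (b j) (h k)))\<^sup>2))" for b n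
    unfolding sum_distrib_left quadratic_form_series(1)[OF T(1) h(4,1)]
    by (rule suminf_sum[symmetric] summable_sum; rule quadratic_form_series(2)[OF T(1) h(4,1)])+
  show ?thesis unfolding series
    by (intro suminf_le summ mult_left_mono le sv_nonneg)
qed

lemma gram_schmidt:
  "\<exists>g. subortho g \<and> (\<forall>i<m. v i = (\<Sum>j<m. cs (cip (v i) (g j)) (g j))) \<and> (\<forall>j\<ge>m. g j = 0)"
proof (induction m)
  case 0
  show ?case by (intro exI[of _ "\<lambda>_. 0"]) (simp add: subortho_def)
next
  case (Suc m)
  then obtain g where g: "subortho g" "\<And>i. i < m \<Longrightarrow> v i = (\<Sum>j<m. cs (cip (v i) (g j)) (g j))"
    "\<And>j. j \<ge> m \<Longrightarrow> g j = 0" by blast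
  define w where "w = v m - (\<Sum>j<m. cs (cip (v m) (g j)) (g j))"
  \<comment> \<open>If v m depends on its predecessors, then w = 0 and a zero vector is appended.
    That g vanishes from index m on makes w orthogonal to every g j.\<close>
  define h where "h = g(m := unit_vec w)"
  have wg: "cip w (g j) = 0" for j
  proof (cases "j < m")
    case True
    then show ?thesis unfolding w_def by (intro subortho_residual_orth[OF g(1)]) auto
  qed (simp add: g(3))
  then have gw: "cip (g j) w = 0" for j by (metis cip_commute complex_cnj_zero)
  have "subortho h"
    using g(1) wg gw unfolding subortho_def h_def by (cases "w = 0") (auto simp: unit_vec_def)
  moreover have "v i = (\<Sum>j<Suc m. cs (cip (v i) (h j)) (h j))" if "i < Suc m" for i
  proof (cases "i = m")
    case True
    have "cip (v m) w = cip w w"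
    proof -
      have "v m = w + (\<Sum>j<m. cs (cip (v m) (g j)) (g j))" by (simp add: w_def)
      then have "cip (v m) w = cip (w + (\<Sum>j<m. cs (cip (v m) (g j)) (g j))) w" by simp
      then show ?thesis by (simp add: gw)
    qed
    moreover have "inverse a * (a * a) * inverse a = 1" if "a \<noteq> 0" for a :: complex
      using that by (simp add: field_simps)
    ultimately have "cs (cip (v m) (unit_vec w)) (unit_vec w) = w"
      by (cases "w = 0") (simp_all add: unit_vec_def scaleR_cs cip_self power2_eq_square)
    then show ?thesis using True by (simp add: h_def w_def)
  next
    case False
    then have "i < m" using that by simp
    have "cip (v i) w = 0"
      by (subst g(2)[OF \<open>i < m\<close>]) (simp add: gw)
    then have "cip (v i) (unit_vec w) = 0" by (simp add: unit_vec_def)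
    then show ?thesis using g(2)[OF \<open>i < m\<close>] by (simp add: h_def)
  qed
  moreover have "h j = 0" if "j \<ge> Suc m" for j using g(3)[of j] that by (simp add: h_def)
  ultimately show ?case by blast
qed

lemma sv_sum_eq_trace:
  assumes "T \<in> L1bop" "posop T"
  obtains e where "subortho e" "\<And>N. (\<Sum>k<N. sv k T) = (\<Sum>k<N. Re (cip (app T (e k)) (e k)))"
proof -
  obtain e where e: "subortho e" "\<And>k. norm (e k) = 1" "\<And>k. app T (e k) = cs (of_real (sv k T)) (e k)"
    "T = colop e * dg (\<lambda>k. of_real (sv k T)) * rowop e"
    using spectral_theorem[OF assms] by blast
  then show ?thesis by (intro that[OF e(1)]) (simp add: cip_self)
qed

text \<open>The eigenvectors of S + T are merely competitors in the Ky Fan bounds for S and for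
  T.\<close>

lemma sv_sum_subadditive:
  assumes "S \<in> L1bop" "posop S" "T \<in> L1bop" "posop T"
  shows "(\<Sum>k<N. sv k (S + T)) \<le> (\<Sum>k<N. sv k S) + (\<Sum>k<N. sv k T)"
proof -
  obtain e where e: "subortho e" "\<And>N. (\<Sum>k<N. sv k (S + T)) = (\<Sum>k<N. Re (cip (app (S + T) (e k)) (e k)))"
    using sv_sum_eq_trace[OF L1bop_add[OF assms(1,3)] posop_add[OF assms(2,4)]] by blast
  then show ?thesis
    using ky_fan_upper[OF assms(1,2) e(1), of N] ky_fan_upper[OF assms(3,4) e(1), of N]
    by (simp add: sum.distrib)
qed

text \<open>N eigenvectors of S and N of T together span at most 2 N dimensions. An
  orthonormalisation of them gives traces at least as large for both operators, and it competes in
  the Ky Fan bound for S + T.\<close>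

lemma sv_sum_superadditive:
  assumes "S \<in> L1bop" "posop S" "T \<in> L1bop" "posop T"
  shows "(\<Sum>k<N. sv k S) + (\<Sum>k<N. sv k T) \<le> (\<Sum>k<2 * N. sv k (S + T))"
proof -
  obtain e where e: "subortho e" "\<And>N. (\<Sum>k<N. sv k S) = (\<Sum>k<N. Re (cip (app S (e k)) (e k)))"
    using sv_sum_eq_trace[OF assms(1,2)] by blast
  obtain f where f: "subortho f" "\<And>N. (\<Sum>k<N. sv k T) = (\<Sum>k<N. Re (cip (app T (f k)) (f k)))"
    using sv_sum_eq_trace[OF assms(3,4)] by blast
  define v where "v i = (if i < N then e i else f (i - N))" for i
  obtain g where g: "subortho g" "\<And>i. i < 2 * N \<Longrightarrow> v i = (\<Sum>j<2 * N. cs (cip (v i) (g j)) (g j))"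
    using gram_schmidt[of "2 * N" v] by blast
  have 1: "(\<Sum>k<N. sv k S) \<le> (\<Sum>j<2 * N. Re (cip (app S (g j)) (g j)))"
    unfolding e(2)
  proof (rule trace_mono_span[OF assms(1,2) e(1) g(1)])
    fix i assume "i < N"
    then show "e i = (\<Sum>j<2 * N. cs (cip (e i) (g j)) (g j))" using g(2)[of i] by (simp add: v_def)
  qed
  have 2: "(\<Sum>k<N. sv k T) \<le> (\<Sum>j<2 * N. Re (cip (app T (g j)) (g j)))"
    unfolding f(2)
  proof (rule trace_mono_span[OF assms(3,4) f(1) g(1)])
    fix i assume "i < N"
    then show "f i = (\<Sum>j<2 * N. cs (cip (f i) (g j)) (g j))" using g(2)[of "N + i"] by (simp add: v_def)
  qed
  have "(\<Sum>j<2 * N. Re (cip (app (S + T) (g j)) (g j))) \<le> (\<Sum>k<2 * N. sv k (S + T))"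
    by (rule ky_fan_upper[OF L1bop_add[OF assms(1,3)] posop_add[OF assms(2,4)] g(1)])
  then show ?thesis using 1 2 by (simp add: sum.distrib)
qed

section \<open>Banach limits\<close>

text \<open>A Banach limit without its normalisation. The functional attached to a trace is handled
  in this form until its value at the constant 1 is computed.\<close>

definition pos_shift_functional :: "((nat \<Rightarrow> real) \<Rightarrow> real) \<Rightarrow> bool" where
  "pos_shift_functional B \<longleftrightarrow>
     (\<forall>x\<in>linf. \<forall>y\<in>linf. B (x + y) = B x + B y) \<and>
     (\<forall>x\<in>linf. \<forall>c. B (\<lambda>n. c * x n) = c * B x) \<and>
     (\<forall>x\<in>linf. (\<forall>n. x n \<ge> 0) \<longrightarrow> B x \<ge> 0) \<and>
     (\<forall>x\<in>linf. B (shift x) = B x)"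

lemma banach_limit_alt: "banach_limit B \<longleftrightarrow> pos_shift_functional B \<and> B (\<lambda>_. 1) = 1"
  unfolding banach_limit_def pos_shift_functional_def by blast

lemma linf_iff: "x \<in> linf \<longleftrightarrow> (\<exists>C. \<forall>n. \<bar>x n\<bar> \<le> C)"
  by (auto simp: linf_def bounded_iff)

lemma linf_const: "(\<lambda>_. c) \<in> linf"
  by (auto simp: linf_iff)

lemma linf_add: assumes "x \<in> linf" "y \<in> linf" shows "(\<lambda>n. x n + y n) \<in> linf"
proof -
  obtain C D where "\<And>n. \<bar>x n\<bar> \<le> C" "\<And>n. \<bar>y n\<bar> \<le> D" using assms by (auto simp: linf_iff)
  then have "\<bar>x n + y n\<bar> \<le> C + D" for n by (meson abs_triangle_ineq add_mono order_trans)
  then show ?thesis by (auto simp: linf_iff)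
qed

lemma linf_scale: assumes "x \<in> linf" shows "(\<lambda>n. c * x n) \<in> linf"
proof -
  obtain C where "\<And>n. \<bar>x n\<bar> \<le> C" using assms by (auto simp: linf_iff)
  then have "\<bar>c * x n\<bar> \<le> \<bar>c\<bar> * C" for n by (simp add: abs_mult mult_left_mono)
  then show ?thesis by (auto simp: linf_iff)
qed

lemma linf_diff: assumes "x \<in> linf" "y \<in> linf" shows "(\<lambda>n. x n - y n) \<in> linf"
  using linf_add[OF assms(1) linf_scale[OF assms(2), of "-1"]] by simp

lemma linf_comp: "x \<in> linf \<Longrightarrow> (\<lambda>n. x (f n)) \<in> linf"
  by (auto simp: linf_iff)

lemma linf_indicator: "(\<lambda>n. if P n then 1 else 0) \<in> linf"
  by (auto simp: linf_iff intro!: exI[of _ 1])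

context
  fixes B assumes B: "pos_shift_functional B"
begin

lemma psf_add: "x \<in> linf \<Longrightarrow> y \<in> linf \<Longrightarrow> B (\<lambda>n. x n + y n) = B x + B y"
  using B unfolding pos_shift_functional_def plus_fun_def by blast

lemma psf_scale: "x \<in> linf \<Longrightarrow> B (\<lambda>n. c * x n) = c * B x"
  using B unfolding pos_shift_functional_def by blast

lemma psf_diff: "x \<in> linf \<Longrightarrow> y \<in> linf \<Longrightarrow> B (\<lambda>n. x n - y n) = B x - B y"
  using psf_add[OF _ linf_scale[of y "-1"], of x] psf_scale[of y "-1"] by simp

lemma psf_nonneg: "x \<in> linf \<Longrightarrow> (\<And>n. 0 \<le> x n) \<Longrightarrow> 0 \<le> B x"
  using B unfolding pos_shift_functional_def by blast

lemma psf_mono: "x \<in> linf \<Longrightarrow> y \<in> linf \<Longrightarrow> (\<And>n. x n \<le> y n) \<Longrightarrow> B x \<le> B y"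
  using psf_nonneg[OF linf_diff[of y x]] psf_diff[of y x] by simp

lemma psf_shift: "x \<in> linf \<Longrightarrow> B (shift x) = B x"
  using B unfolding pos_shift_functional_def by blast

text \<open>By shift invariance all indicators of single points have the same value, and n times
  this value stays below the value at the constant 1.\<close>

lemma psf_initial_segment: "B (\<lambda>k. if k < n then 1 else 0) = 0"
proof -
  define u where "u n = B (\<lambda>k. if k = n then 1 else 0)" for n :: nat
  have "u (Suc n) = u n" for n
  proof -
    have "shift (\<lambda>k. if k = n then 1 else 0) = (\<lambda>k. if k = Suc n then 1 else 0)"
      by (auto simp: shift_def fun_eq_iff)
    with psf_shift[OF linf_indicator[of "\<lambda>k. k = n"]] show ?thesis by (simp add: u_def)
  qed
  then have u: "u n = u 0" for n by (induction n) auto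
  have 1: "B (\<lambda>k. if k < n then 1 else 0) = real n * u 0" for n
  proof (induction n)
    case 0
    have "B (\<lambda>n. 0 * (1::real)) = 0 * B (\<lambda>_. 1)" by (rule psf_scale[OF linf_const])
    then show ?case by simp
  next
    case (Suc n)
    have "(\<lambda>k. if k < Suc n then 1 else 0 :: real) = (\<lambda>k. (if k < n then 1 else 0) + (if k = n then 1 else 0))"
      by (auto simp: fun_eq_iff)
    then have "B (\<lambda>k. if k < Suc n then 1 else 0) = real n * u 0 + u n"
      by (simp only: psf_add[OF linf_indicator linf_indicator] Suc u_def)
    then show ?case by (simp add: u[of n] algebra_simps)
  qed
  have "real n * u 0 \<le> B (\<lambda>_. 1)" for n
    unfolding 1[symmetric] by (intro psf_mono linf_indicator linf_const) auto
  moreover have "0 \<le> u 0" unfolding u_def by (intro psf_nonneg linf_indicator) auto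
  ultimately have "u 0 = 0" by (metis ex_less_of_nat_mult linorder_not_le order_le_less)
  then show ?thesis by (simp add: 1)
qed

lemma psf_tendsto:
  assumes "x \<longlonglongrightarrow> L" shows "B x = L * B (\<lambda>_. 1)"
proof -
  have lx: "x \<in> linf" using convergent_imp_bounded[OF assms] by (simp add: linf_def)
  define y where "y n = x n - L" for n
  have ly: "y \<in> linf" unfolding y_def by (intro linf_diff lx linf_const)
  then obtain M where M: "\<And>n. \<bar>y n\<bar> \<le> M" by (auto simp: linf_iff)
  have M0: "0 \<le> M" using M[of 0] by linarith
  define b where "b = B (\<lambda>_. 1)"
  have b: "0 \<le> b" unfolding b_def by (intro psf_nonneg linf_const) auto
  have bound: "\<bar>B y\<bar> \<le> e * b" if "0 < e" for e
  proof -
    have "\<forall>\<^sub>F n in sequentially. dist (x n) L < e" by (rule tendstoD[OF assms that])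
    then obtain N where N: "\<And>n. n \<ge> N \<Longrightarrow> \<bar>y n\<bar> < e"
      unfolding eventually_sequentially by (auto simp: dist_real_def y_def)
    \<comment> \<open>The constant e dominates y from N on; the multiple of the indicator dominates
      it before N and contributes nothing to B.\<close>
    define z where "z n = e * 1 + M * (if n < N then 1 else 0)" for n
    have lz: "z \<in> linf" unfolding z_def by (intro linf_add linf_scale linf_const linf_indicator)
    have "B z = e * b + M * 0"
      unfolding z_def b_def
      by (simp only: psf_add[OF linf_scale[OF linf_const] linf_scale[OF linf_indicator]]
          psf_scale[OF linf_const] psf_scale[OF linf_indicator] psf_initial_segment)
    moreover have le: "\<bar>y n\<bar> \<le> z n" for n
      using N[of n] M[of n] that by (cases "n < N") (auto simp: z_def)
    have "B y \<le> B z" using le by (intro psf_mono ly lz) (simp add: abs_le_iff)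
    moreover have "B (\<lambda>n. - 1 * y n) \<le> B z" using le by (intro psf_mono linf_scale ly lz) (simp add: abs_le_iff)
    then have "- B y \<le> B z" using psf_scale[OF ly, of "-1"] by simp
    ultimately show ?thesis by simp
  qed
  have "B y = 0"
  proof (rule ccontr)
    assume "B y \<noteq> 0"
    define e where "e = \<bar>B y\<bar> / (2 * (b + 1))"
    have "0 < e" using \<open>B y \<noteq> 0\<close> b by (simp add: e_def)
    have "e * b < e * (2 * (b + 1))" using \<open>0 < e\<close> b by (intro mult_strict_left_mono) auto
    also have "\<dots> = \<bar>B y\<bar>" using b by (simp add: e_def)
    finally show False using bound[OF \<open>0 < e\<close>] by simp
  qed
  moreover have "B y = B x - L * b"
    unfolding y_def b_def using psf_diff[OF lx linf_scale[OF linf_const[of 1], of L]] psf_scale[OF linf_const[of 1], of L]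
    by simp
  ultimately show ?thesis by (simp add: b_def)
qed

text \<open>Shifting the truncated sequence back restores x except at index 0, and B ignores a
  change there.\<close>

lemma psf_unshift:
  assumes "x \<in> linf" shows "B (\<lambda>n. x (Suc n)) = B x"
proof -
  have "shift (\<lambda>n. x (Suc n)) = (\<lambda>n. x n - x 0 * (if n < 1 then 1 else 0))"
    by (auto simp: shift_def fun_eq_iff)
  then have "B (\<lambda>n. x (Suc n)) = B (\<lambda>n. x n - x 0 * (if n < 1 then 1 else 0))"
    using psf_shift[OF linf_comp[OF assms, of Suc]] by simp
  also have "\<dots> = B x"
    by (simp only: psf_diff[OF assms linf_scale[OF linf_indicator]] psf_scale[OF linf_indicator] psf_initial_segment)
  finally show ?thesis .
qed

end

section \<open>Dyadic blocks\<close>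

lemma dyad_bounds: "2 ^ dyad k \<le> k + 1" "k + 1 < 2 ^ Suc (dyad k)"
proof -
  have l: "0 \<le> log 2 (real k + 1)" by simp
  then have f: "real (dyad k) \<le> log 2 (real k + 1)" "log 2 (real k + 1) < real (dyad k) + 1"
    unfolding dyad_def by linarith+
  have "2 powr real (dyad k) \<le> real k + 1" using f(1) by (simp add: le_log_iff)
  then have "real (2 ^ dyad k) \<le> real (k + 1)" by (simp add: powr_realpow)
  then show "2 ^ dyad k \<le> k + 1" by (simp only: of_nat_le_iff)
  have "real k + 1 < 2 powr (real (dyad k) + 1)" using f(2) by (simp add: log_less_iff)
  then have "real (k + 1) < real (2 ^ Suc (dyad k))" by (simp add: powr_add powr_realpow)
  then show "k + 1 < 2 ^ Suc (dyad k)" by (simp only: of_nat_less_iff)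
qed

lemma dyad_eqI: assumes "2 ^ n \<le> k + 1" "k + 1 < 2 ^ Suc n" shows "dyad k = n"
proof -
  have "2 ^ n < (2::nat) ^ Suc (dyad k)" "2 ^ dyad k < (2::nat) ^ Suc n"
    using assms dyad_bounds[of k] by linarith+
  then have "n < Suc (dyad k)" "dyad k < Suc n"
    by (simp_all only: power_strict_increasing_iff one_less_numeral_iff semiring_norm)
  then show ?thesis by simp
qed

definition block :: "nat \<Rightarrow> nat set" where "block n = {2 ^ n - 1..<2 ^ Suc n - 1}"

lemma block_iff: "k \<in> block n \<longleftrightarrow> dyad k = n"
proof
  assume "k \<in> block n"
  moreover have "(1::nat) \<le> 2 ^ n" by simp
  ultimately show "dyad k = n" unfolding block_def by (intro dyad_eqI) auto
next
  assume "dyad k = n"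
  then show "k \<in> block n" using dyad_bounds[of k] by (auto simp: block_def)
qed

lemma card_block: "card (block n) = 2 ^ n"
  by (simp add: block_def)

lemma dyad_mono: assumes "j \<le> k" shows "dyad j \<le> dyad k"
proof -
  have "(2::nat) ^ dyad j < 2 ^ Suc (dyad k)" using dyad_bounds[of j] dyad_bounds[of k] assms by linarith
  then have "dyad j < Suc (dyad k)"
    by (simp only: power_strict_increasing_iff one_less_numeral_iff semiring_norm)
  then show ?thesis by simp
qed

lemma inverse_power_dyad: "1 / 2 ^ dyad k \<le> 2 / real (k + 1)"
proof -
  have "real (k + 1) \<le> real (2 ^ Suc (dyad k))" using dyad_bounds(2)[of k] by (simp only: of_nat_le_iff)
  then show ?thesis by (simp add: field_simps)
qed

text \<open>A left inverse of \<open>Dmap\<close>: dividing by \<open>ln 2\<close> cancels the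
  factor in its definition.\<close>

definition blk :: "(nat \<Rightarrow> real) \<Rightarrow> nat \<Rightarrow> real" where
  "blk a n = (\<Sum>k\<in>block n. a k) / ln 2"

lemma blk_eq_diff: "blk a n = ((\<Sum>k<2 ^ Suc n - 1. a k) - (\<Sum>k<2 ^ n - 1. a k)) / ln 2"
proof -
  have "(\<Sum>k<2 ^ Suc n - 1. a k) = (\<Sum>k<2 ^ n - 1. a k) + (\<Sum>k\<in>block n. a k)"
    unfolding block_def lessThan_atLeast0 by (rule sum.atLeastLessThan_concat[symmetric]) (simp_all add: diff_le_mono)
  then show ?thesis by (simp add: blk_def)
qed

lemma blk_linf: assumes "\<And>k. \<bar>a k\<bar> \<le> C / real (k + 1)" shows "blk a \<in> linf"
proof -
  have C: "0 \<le> C" using assms[of 0] by simp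
  have "\<bar>blk a n\<bar> \<le> C / ln 2" for n
  proof -
    have "\<bar>\<Sum>k\<in>block n. a k\<bar> \<le> (\<Sum>k\<in>block n. C / 2 ^ n)"
    proof (rule order_trans[OF sum_abs sum_mono])
      fix k assume "k \<in> block n"
      then have "2 ^ n \<le> k + 1" using dyad_bounds(1)[of k] by (simp add: block_iff)
      then have "(2::real) ^ n \<le> real (k + 1)" by (metis of_nat_le_iff of_nat_numeral of_nat_power)
      then have "C / real (k + 1) \<le> C / 2 ^ n" using C by (intro divide_left_mono) auto
      then show "\<bar>a k\<bar> \<le> C / 2 ^ n" using assms[of k] by linarith
    qed
    then have "\<bar>\<Sum>k\<in>block n. a k\<bar> \<le> C" by (simp add: card_block)
    then show ?thesis by (simp add: blk_def divide_right_mono)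
  qed
  then show ?thesis by (auto simp: linf_iff)
qed

lemma blk_Dmap: "blk (Dmap x) n = x n"
proof -
  have "(\<Sum>k\<in>block n. Dmap x k) = (\<Sum>k\<in>block n. ln 2 * x n / 2 ^ n)"
    by (intro sum.cong) (auto simp: Dmap_def block_iff)
  then show ?thesis by (simp add: blk_def card_block)
qed

lemma Dmap_bound: assumes "\<And>n. \<bar>x n\<bar> \<le> M" shows "\<bar>Dmap x k\<bar> \<le> 2 * ln 2 * M / real (k + 1)"
proof -
  have M: "0 \<le> M" using assms[of 0] by linarith
  have "\<bar>Dmap x k\<bar> = ln 2 * \<bar>x (dyad k)\<bar> * (1 / 2 ^ dyad k)"
    by (simp add: Dmap_def abs_mult)
  also have "\<dots> \<le> ln 2 * M * (2 / real (k + 1))"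
    using M by (intro mult_mono inverse_power_dyad assms) (auto intro!: mult_nonneg_nonneg)
  finally show ?thesis by (simp add: mult_ac)
qed

lemma weak_l1_Dmap: assumes "x \<in> linf" shows "weak_l1 (\<lambda>k. of_real (Dmap x k))"
proof -
  obtain M where M: "\<And>n. \<bar>x n\<bar> \<le> M" using assms by (auto simp: linf_iff)
  have "\<bar>Dmap x k\<bar> \<le> 2 * ln 2 * M / real (k + 1)" for k by (rule Dmap_bound[OF M])
  then show ?thesis unfolding weak_l1_def norm_of_real by blast
qed

text \<open>Passing to the next block at least halves the weight, while a sequence with values in
  [1,2] can grow by a factor of at most 2.\<close>

lemma Dmap_antimono:
  assumes y: "\<And>n. 1 \<le> y n" "\<And>n. y n \<le> 2" and "j \<le> k"
  shows "Dmap y k \<le> Dmap y j"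
proof (cases "dyad j = dyad k")
  case False
  then have lt: "Suc (dyad j) \<le> dyad k" using dyad_mono[OF \<open>j \<le> k\<close>] by simp
  have "y (dyad k) / 2 ^ dyad k \<le> 2 / 2 ^ dyad k" using y by (intro divide_right_mono) auto
  also have "\<dots> \<le> 2 / 2 ^ Suc (dyad j)" using lt by (intro divide_left_mono power_increasing) auto
  also have "\<dots> \<le> y (dyad j) / 2 ^ dyad j" using y by (simp add: divide_right_mono)
  finally have "ln 2 * (y (dyad k) / 2 ^ dyad k) \<le> ln 2 * (y (dyad j) / 2 ^ dyad j)"
    by (intro mult_left_mono) auto
  then show ?thesis by (simp add: Dmap_def)
qed (simp add: Dmap_def)

lemma blk_harmonic: "blk (\<lambda>k. 1 / real (k + 1)) \<longlonglongrightarrow> 1"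
proof -
  define h where "h n = (harm (2 ^ n) :: real) - ln (real (2 ^ n))" for n :: nat
  have sm: "filterlim (\<lambda>n::nat. 2 ^ n :: nat) at_top sequentially"
    by (rule filterlim_subseq) (simp add: strict_mono_def)
  have h: "h \<longlonglongrightarrow> euler_mascheroni"
    unfolding h_def using filterlim_compose[OF euler_mascheroni_LIMSEQ sm] by simp
  have hs: "(\<Sum>k<m - 1. 1 / real (k + 1)) = harm m - 1 / real m" if "1 \<le> m" for m
  proof -
    have "(\<Sum>k<m. 1 / real (k + 1)) = harm m" for m
      by (induction m) (simp_all add: harm_Suc harm_expand(1) field_simps)
    then have "(\<Sum>k<m - 1. 1 / real (k + 1)) = harm (m - 1)" by simp
    also have "\<dots> = harm m - 1 / real m" using that by (cases m) (simp_all add: harm_Suc inverse_eq_divide)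
    finally show ?thesis .
  qed
  \<comment> \<open>A block starts at 2^n - 1, so both partial sums stop one term short of a
    harmonic number with dyadic index; the two missing terms leave (1/2)^(n+1). The rest is a
    difference of two terms converging to Euler's constant, plus \<open>ln 2\<close>.\<close>
  have eq: "blk (\<lambda>k. 1 / real (k + 1)) n = (h (Suc n) - h n + ln 2 + (1 / 2) ^ Suc n) / ln 2" for n
  proof -
    have "ln (real (2 ^ Suc n)) = ln (real (2 ^ n)) + ln 2" by (simp add: ln_mult)
    moreover have "1 / real (2 ^ n) - 1 / real (2 ^ Suc n) = (1 / 2) ^ Suc n"
      by (simp add: field_simps power_one_over)
    ultimately show ?thesis unfolding blk_eq_diff h_def using hs[of "2 ^ n"] hs[of "2 ^ Suc n"] by simp
  qed
  have "(\<lambda>n. (h (Suc n) - h n + ln 2 + (1 / 2) ^ Suc n) / ln 2)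
      \<longlonglongrightarrow> (euler_mascheroni - euler_mascheroni + ln 2 + 0) / ln 2"
    by (intro tendsto_intros LIMSEQ_Suc[OF h] h LIMSEQ_Suc[OF LIMSEQ_power_zero]) auto
  then show ?thesis unfolding eq by simp
qed

section \<open>The trace induced by a Banach limit\<close>

lemma L1bop_zero: "0 \<in> L1bop"
proof -
  have "weak_l1 (\<lambda>_. 0)" by (auto simp: weak_l1_def intro!: exI[of _ 0])
  from L1bop_left[OF L1bop_dg[OF this], of 0] show ?thesis by simp
qed

lemma posop_zero: "posop 0" by (simp add: posop_def)

lemma opn_sc: "opn (sc c) \<le> cmod c"
  by (rule opn_le) auto

lemma sv_scale:
  assumes "cpt T" "0 \<le> r" shows "sv k (sc (of_real r) * T) = r * sv k T"
proof -
  have le: "sv k (sc (of_real r) * T) \<le> r * sv k T" if "cpt T" "0 \<le> r" for r T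
  proof -
    have "sv k (sc (of_real r) * T) \<le> opn (sc (of_real r)) * opn 1 * sv k T"
      using sv_mult[OF that(1), of k "sc (of_real r)" 1] by simp
    also have "\<dots> \<le> r * 1 * sv k T"
      using opn_sc[of "of_real r"] opn_sc[of 1] that(2)
      by (intro mult_mono sv_nonneg opn_nonneg mult_nonneg_nonneg) auto
    finally show ?thesis by simp
  qed
  show ?thesis
  proof (cases "r = 0")
    case True
    then show ?thesis using le[OF assms] sv_nonneg[of k "sc (of_real r) * T"] by simp
  next
    case False
    have "sc (of_real (1 / r)) * (sc (of_real r) * T) = T"
      using False by (simp add: mult.assoc[symmetric] flip: sc_simps(5) of_real_mult)
    then have "sv k T \<le> 1 / r * sv k (sc (of_real r) * T)"
      using le[OF cpt_mult_left[OF assms(1)], of "1 / r" "sc (of_real r)"] assms(2) by simp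
    then show ?thesis using le[OF assms] False assms(2) by (simp add: field_simps)
  qed
qed

lemma sv_blk_linf: assumes "T \<in> L1bop" shows "blk (\<lambda>k. sv k T) \<in> linf"
proof -
  obtain C where C: "\<And>k. cmod (of_real (sv k T)) \<le> C / real (k + 1)"
    using weak_l1_sv[OF assms] unfolding weak_l1_def by blast
  show ?thesis by (rule blk_linf[where C = C]) (use C in simp)
qed

context
  fixes B assumes B: "banach_limit B"
begin

lemma psf: "pos_shift_functional B" using B by (simp add: banach_limit_alt)

definition phi :: "bop \<Rightarrow> real" where "phi T = B (blk (\<lambda>k. sv k T))"

text \<open>Ky Fan bounds the defect of additivity of the partial sums by one dyadic block; hence the
  defect of the block sums has the form d (n + 1) - d n with bounded d.\<close>

lemma phi_add:
  assumes S: "S \<in> L1bop" "posop S" and T: "T \<in> L1bop" "posop T"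
  shows "phi (S + T) = phi S + phi T"
proof -
  note ST = L1bop_add[OF S(1) T(1)]
  define d where "d n = ((\<Sum>k<2 ^ n - 1. sv k S) + (\<Sum>k<2 ^ n - 1. sv k T) - (\<Sum>k<2 ^ n - 1. sv k (S + T))) / ln 2" for n
  have d0: "0 \<le> d n" for n
    using sv_sum_subadditive[OF S T, of "2 ^ n - 1"] by (simp add: d_def)
  have d1: "d n \<le> blk (\<lambda>k. sv k (S + T)) n" for n
  proof -
    have "(\<Sum>k<2 ^ n - 1. sv k S) + (\<Sum>k<2 ^ n - 1. sv k T) \<le> (\<Sum>k<2 * (2 ^ n - 1). sv k (S + T))"
      by (rule sv_sum_superadditive[OF S T])
    also have "\<dots> \<le> (\<Sum>k<2 ^ Suc n - 1. sv k (S + T))"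
      by (intro sum_mono2 sv_nonneg) auto
    finally show ?thesis by (simp add: d_def blk_eq_diff divide_right_mono)
  qed
  obtain C where C: "\<And>n. \<bar>blk (\<lambda>k. sv k (S + T)) n\<bar> \<le> C"
    using sv_blk_linf[OF ST] by (auto simp: linf_iff)
  have "\<bar>d n\<bar> \<le> C" for n using d0[of n] d1[of n] C[of n] by linarith
  then have ld: "d \<in> linf" by (auto simp: linf_iff)
  have eq: "blk (\<lambda>k. sv k (S + T)) = (\<lambda>n. (blk (\<lambda>k. sv k S) n + blk (\<lambda>k. sv k T) n) - (d (Suc n) - d n))"
    by (rule ext) (simp add: blk_eq_diff d_def field_simps)
  have "phi (S + T) = (phi S + phi T) - (B (\<lambda>n. d (Suc n)) - B d)"
    unfolding phi_def eq
    by (simp add: psf_diff[OF psf] psf_add[OF psf] linf_add linf_diff sv_blk_linf S T ld linf_comp)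
  then show ?thesis by (simp add: psf_unshift[OF psf ld])
qed

lemma phi_scale:
  assumes "T \<in> L1bop" "0 \<le> r" shows "phi (sc (of_real r) * T) = r * phi T"
proof -
  have "blk (\<lambda>k. sv k (sc (of_real r) * T)) = (\<lambda>n. r * blk (\<lambda>k. sv k T) n)"
    by (rule ext) (simp add: blk_def sv_scale[OF L1bop_cpt[OF assms(1)] assms(2)] sum_distrib_left)
  then show ?thesis by (simp add: phi_def psf_scale[OF psf sv_blk_linf[OF assms(1)]])
qed

lemma phi_zero: "phi 0 = 0"
  using phi_scale[OF L1bop_zero, of 0] by simp

lemma phi_nonneg: "T \<in> L1bop \<Longrightarrow> 0 \<le> phi T"
  unfolding phi_def by (intro psf_nonneg[OF psf] sv_blk_linf) (auto simp: blk_def sv_nonneg intro!: divide_nonneg_pos sum_nonneg)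

lemma phi_conj: "T \<in> L1bop \<Longrightarrow> unitary U \<Longrightarrow> phi (U * T * adj U) = phi T"
  unfolding phi_def unitary_def by (simp add: sv_conj L1bop_cpt)

section \<open>Extension of \<open>phi\<close> from the positive cone to a complex linear
  trace\<close>

definition dec :: "bop \<Rightarrow> bop \<Rightarrow> bop \<Rightarrow> bop \<Rightarrow> bop \<Rightarrow> bool" where
  "dec T P Q R S \<longleftrightarrow> P \<in> L1bop \<and> Q \<in> L1bop \<and> R \<in> L1bop \<and> S \<in> L1bop \<and> posop P \<and> posop Q \<and> posop R \<and> posop S \<and>
     T = P - Q + sc \<i> * (R - S)"

text \<open>P - Q and R - S are the self-adjoint real and imaginary parts of T; taking adjoints
  separates them.\<close>

lemma dec_unique:
  assumes "dec T P Q R S" "dec T P' Q' R' S'"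
  shows "P - Q = P' - Q'" "R - S = R' - S'"
proof -
  define X Y where "X = (P - Q) - (P' - Q')" and "Y = (R - S) - (R' - S')"
  have eq: "X + sc \<i> * Y = 0"
    using assms unfolding dec_def X_def Y_def by (simp add: algebra_simps)
  have "adj X = X" "adj Y = Y"
    using assms unfolding dec_def X_def Y_def by (simp_all add: posop_self_adjoint)
  then have eq2: "X - sc \<i> * Y = 0"
    using arg_cong[OF eq, of adj] by (simp add: sc_commute[of Y])
  have half: "Z = 0" if "Z + Z = 0" for Z :: bop
  proof (rule bop_eqI)
    fix x
    have "app Z x + app Z x = 0" using that by (metis app_simps(1,3))
    then have "2 *\<^sub>R app Z x = 0" by (simp add: scaleR_2)
    then show "app Z x = app 0 x" by simp
  qed
  have "X + X = (X + sc \<i> * Y) + (X - sc \<i> * Y)" by simp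
  also have "\<dots> = 0" unfolding eq eq2 by simp
  finally have X0: "X = 0" by (rule half)
  then show "P - Q = P' - Q'" by (simp add: X_def)
  from X0 eq have "sc \<i> * Y = 0" by simp
  then have "sc (- \<i>) * (sc \<i> * Y) = 0" by simp
  then have "Y = 0" unfolding mult.assoc[symmetric] sc_simps(5)[symmetric] by simp
  then show "R - S = R' - S'" by (simp add: Y_def)
qed

text \<open>The choice runs over the value and not over the decomposition; \<open>dec_unique\<close>
  together with \<open>phi_diff_cong\<close> leaves exactly one value.\<close>

definition ext_trace :: "bop \<Rightarrow> complex" where
  "ext_trace T = (SOME z. \<exists>P Q R S. dec T P Q R S \<and> z = Complex (phi P - phi Q) (phi R - phi S))"

text \<open>Moving terms across turns the equality of differences into one of sums of positive
  operators, on which \<open>phi\<close> is additive.\<close>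

lemma phi_diff_cong:
  assumes "P \<in> L1bop" "Q \<in> L1bop" "P' \<in> L1bop" "Q' \<in> L1bop" "posop P" "posop Q" "posop P'" "posop Q'" "P - Q = P' - Q'"
  shows "phi P - phi Q = phi P' - phi Q'"
proof -
  have "P + Q' = P' + Q" using assms(9) by (simp add: algebra_simps)
  then have "phi P + phi Q' = phi P' + phi Q" using assms by (metis phi_add)
  then show ?thesis by simp
qed

lemma ext_trace_eq:
  assumes "dec T P Q R S" shows "ext_trace T = Complex (phi P - phi Q) (phi R - phi S)"
  unfolding ext_trace_def
proof (rule some_equality)
  show "\<exists>P' Q' R' S'. dec T P' Q' R' S' \<and>
      Complex (phi P - phi Q) (phi R - phi S) = Complex (phi P' - phi Q') (phi R' - phi S')"
    using assms by blast
next
  fix z assume "\<exists>P Q R S. dec T P Q R S \<and> z = Complex (phi P - phi Q) (phi R - phi S)"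
  then obtain P' Q' R' S' where *: "dec T P' Q' R' S'" "z = Complex (phi P' - phi Q') (phi R' - phi S')"
    by blast
  have "phi P - phi Q = phi P' - phi Q'" "phi R - phi S = phi R' - phi S'"
    using dec_unique[OF assms *(1)] assms *(1) unfolding dec_def by (auto intro!: phi_diff_cong)
  then show "z = Complex (phi P - phi Q) (phi R - phi S)" using * by simp
qed

lemma dec_exists: assumes "T \<in> L1bop" obtains P Q R S where "dec T P Q R S"
  using positive_decomposition[OF assms] unfolding dec_def by metis

lemma ext_trace_add: assumes "S \<in> L1bop" "T \<in> L1bop" shows "ext_trace (S + T) = ext_trace S + ext_trace T"
proof -
  obtain P Q R S' where a: "dec S P Q R S'" using dec_exists[OF assms(1)] .
  obtain P' Q' R' S'' where b: "dec T P' Q' R' S''" using dec_exists[OF assms(2)] .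
  have "S + T = (P - Q + sc \<i> * (R - S')) + (P' - Q' + sc \<i> * (R' - S''))"
    using a b unfolding dec_def by metis
  also have "\<dots> = (P + P') - (Q + Q') + sc \<i> * ((R + R') - (S' + S''))"
    by (simp add: algebra_simps)
  finally have "dec (S + T) (P + P') (Q + Q') (R + R') (S' + S'')"
    using a b unfolding dec_def by (simp add: L1bop_add posop_add)
  from ext_trace_eq[OF this] show ?thesis
    using a b unfolding ext_trace_eq[OF a] ext_trace_eq[OF b] dec_def by (simp add: phi_add complex_eq_iff)
qed

lemma ext_trace_i: assumes "T \<in> L1bop" shows "ext_trace (sc \<i> * T) = \<i> * ext_trace T"
proof -
  obtain P Q R S where a: "dec T P Q R S" using dec_exists[OF assms] .
  have ii: "sc \<i> * (sc \<i> * X) = - X" for X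
    unfolding mult.assoc[symmetric] sc_simps(5)[symmetric] by simp
  \<comment> \<open>Multiplication by i turns the old real part into the imaginary part and the old
    imaginary part, negated, into the real part; negation is a swap of R and S.\<close>
  have "dec (sc \<i> * T) S R P Q"
    using a unfolding dec_def by (auto simp: distrib_left right_diff_distrib ii)
  from ext_trace_eq[OF this] show ?thesis by (simp add: ext_trace_eq[OF a] complex_eq_iff)
qed

lemma ext_trace_nonneg_scale: assumes "T \<in> L1bop" "0 \<le> r" shows "ext_trace (sc (of_real r) * T) = of_real r * ext_trace T"
proof -
  obtain P Q R S where a: "dec T P Q R S" using dec_exists[OF assms(1)] .
  let ?s = "sc (of_real r)"
  have "?s * (P - Q + sc \<i> * (R - S)) = ?s * P - ?s * Q + sc \<i> * (?s * R - ?s * S)"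
    by (simp add: distrib_left right_diff_distrib mult.assoc[symmetric] sc_commute[of "sc \<i>" "of_real r"])
  then have "dec (?s * T) (?s * P) (?s * Q) (?s * R) (?s * S)"
    using a unfolding dec_def by (simp add: L1bop_left posop_scale assms(2))
  from ext_trace_eq[OF this] show ?thesis
    using a unfolding ext_trace_eq[OF a] dec_def by (simp add: phi_scale assms(2) complex_eq_iff right_diff_distrib del: minus_complex.simps)
qed

text \<open>Two multiplications by i give negation; with nonnegative scalars this yields all real
  ones, and a further factor i all complex ones.\<close>

lemma ext_trace_scale: assumes "T \<in> L1bop" shows "ext_trace (sc c * T) = c * ext_trace T"
proof -
  have m1: "ext_trace (- T) = - ext_trace T" if "T \<in> L1bop" for T
  proof -
    have "sc \<i> * (sc \<i> * T) = - T" unfolding mult.assoc[symmetric] sc_simps(5)[symmetric] by simp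
    then show ?thesis using ext_trace_i[OF L1bop_left[OF that], of "sc \<i>"] ext_trace_i[OF that] by simp
  qed
  have re: "ext_trace (sc (of_real r) * T) = of_real r * ext_trace T" if "T \<in> L1bop" for r T
  proof (cases "0 \<le> r")
    case False
    have "sc (of_real r) * T = - (sc (of_real (- r)) * T)" by simp
    then show ?thesis
      using m1[OF L1bop_left[OF that], of "sc (of_real (- r))"] ext_trace_nonneg_scale[OF that, of "- r"] False
      by (metis add.inverse_inverse linear mult_minus_left neg_0_le_iff_le of_real_minus)
  qed (rule ext_trace_nonneg_scale[OF that])
  have "c = of_real (Re c) + \<i> * of_real (Im c)" by (rule complex_eq)
  then have "sc c * T = sc (of_real (Re c)) * T + sc \<i> * (sc (of_real (Im c)) * T)"
    by (metis distrib_right mult.assoc sc_simps(3,5))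
  then have "ext_trace (sc c * T) = of_real (Re c) * ext_trace T + \<i> * (of_real (Im c) * ext_trace T)"
    by (simp add: ext_trace_add ext_trace_i re L1bop_left assms)
  also have "\<dots> = (of_real (Re c) + \<i> * of_real (Im c)) * ext_trace T" by (simp add: algebra_simps)
  finally show ?thesis by (simp add: complex_eq[symmetric])
qed

lemma ext_trace_conj: assumes "T \<in> L1bop" "unitary U" shows "ext_trace (U * T * adj U) = ext_trace T"
proof -
  obtain P Q R S where a: "dec T P Q R S" using dec_exists[OF assms(1)] .
  have "U * (sc \<i> * X) * adj U = sc \<i> * (U * X * adj U)" for X
    by (metis mult.assoc sc_commute)
  then have "dec (U * T * adj U) (U * P * adj U) (U * Q * adj U) (U * R * adj U) (U * S * adj U)"
    using a unfolding dec_def by (simp add: L1bop_mult posop_conj distrib_left distrib_right left_diff_distrib right_diff_distrib)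
  from ext_trace_eq[OF this] show ?thesis
    using a unfolding ext_trace_eq[OF a] dec_def by (simp add: phi_conj assms(2))
qed

lemma ext_trace_posop: assumes "T \<in> L1bop" "posop T" shows "ext_trace T = of_real (phi T)"
proof -
  have "dec T T 0 0 0" using assms by (simp add: dec_def L1bop_zero posop_zero)
  from ext_trace_eq[OF this] show ?thesis by (simp add: phi_zero complex_eq_iff)
qed

text \<open>By injectivity of \<open>to_op\<close> the choice is unique for bounded operators; any
  other argument lies outside \<open>L1inf\<close> and receives an unspecified value.\<close>

definition trace_of :: "op \<Rightarrow> complex" where
  "trace_of A = ext_trace (SOME T. to_op T = A)"

lemma trace_of_to_op: "trace_of (to_op T) = ext_trace T"
  by (simp add: trace_of_def to_op_inject)

lemma trace_of_PT: "trace_of \<in> PT"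
  unfolding PT_def
proof (intro CollectI conjI)
  have "trace_of (A + A') = trace_of A + trace_of A'" if A: "A \<in> L1inf" "A' \<in> L1inf" for A A'
  proof -
    obtain S where "A = to_op S" "S \<in> L1bop" using L1inf_obtain[OF A(1)] .
    moreover obtain T where "A' = to_op T" "T \<in> L1bop" using L1inf_obtain[OF A(2)] .
    ultimately show ?thesis by (simp add: trace_of_to_op ext_trace_add flip: to_op_plus)
  qed
  moreover have "trace_of (\<lambda>x k. c * A x k) = c * trace_of A" if A: "A \<in> L1inf" for A c
  proof -
    obtain T where "A = to_op T" "T \<in> L1bop" using L1inf_obtain[OF A] .
    then show ?thesis by (simp add: trace_of_to_op ext_trace_scale flip: to_op_sc)
  qed
  moreover have "trace_of (U \<circ> A \<circ> V) = trace_of A"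
    if A: "A \<in> L1inf" and U: "unitary_op U" and V: "is_adjoint U V" for A U V
  proof -
    obtain T where T: "A = to_op T" "T \<in> L1bop" using L1inf_obtain[OF A] .
    obtain u where u: "U = to_op u" using U bounded_op_obtain unfolding unitary_op_def by metis
    obtain v where v: "V = to_op v" using V bounded_op_obtain unfolding is_adjoint_def by metis
    have "unitary u" "v = adj u" using U V by (simp_all add: u v unitary_op_to_op is_adjoint_to_op)
    then show ?thesis using T by (simp add: u v trace_of_to_op ext_trace_conj o_assoc flip: to_op_times)
  qed
  moreover have "Im (trace_of A) = 0 \<and> 0 \<le> Re (trace_of A)" if A: "A \<in> L1inf" "positive_op A" for A
  proof -
    obtain T where T: "A = to_op T" "T \<in> L1bop" using L1inf_obtain[OF A(1)] .
    then show ?thesis using A(2) by (simp add: positive_op_to_op trace_of_to_op ext_trace_posop phi_nonneg)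
  qed
  ultimately show "positive_trace trace_of" unfolding positive_trace_def is_trace_def by blast
  show "normalised trace_of"
    unfolding normalised_def
  proof (intro ballI impI)
    fix A assume A: "A \<in> L1inf" "positive_op A \<and> (\<forall>n. sval n A = 1 / real (n + 1))"
    obtain T where T: "A = to_op T" "T \<in> L1bop" using L1inf_obtain[OF A(1)] .
    have "(\<lambda>k. sv k T) = (\<lambda>k. 1 / real (k + 1))" using A(2) T(1) by (simp add: sv_def)
    then have "phi T = 1"
      unfolding phi_def using psf_tendsto[OF psf blk_harmonic] B by (simp add: banach_limit_def)
    then show "trace_of A = 1" using T A(2) by (simp add: trace_of_to_op positive_op_to_op ext_trace_posop)
  qed
qed

text \<open>For values in [1,2] the diagonal is decreasing, hence is its own list of singular
  values, and \<open>blk\<close> undoes \<open>Dmap\<close>.\<close>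

lemma trace_of_Dmap_special:
  assumes "\<And>n. 1 \<le> y n" "\<And>n. y n \<le> 2"
  shows "trace_of (diag (\<lambda>k. of_real (Dmap y k))) = of_real (B y)"
proof -
  have y: "y \<in> linf" unfolding linf_iff using assms by (intro exI[of _ 2]) (smt (verit))
  note wl1 = weak_l1_Dmap[OF y]
  have nn: "0 \<le> Dmap y k" for k
    unfolding Dmap_def using assms(1)[of "dyad k"] by (intro divide_nonneg_pos mult_nonneg_nonneg) auto
  have bd: "bounded (range (Dmap y))" using weak_l1_bounded[OF wl1] by (auto simp: bounded_iff)
  have "phi (dg (\<lambda>k. of_real (Dmap y k))) = B y"
    unfolding phi_def by (simp add: sv_dg_antimono nn Dmap_antimono[OF assms] ext[OF blk_Dmap])
  then show ?thesis
    by (simp add: to_op_dg[OF weak_l1_bounded[OF wl1], symmetric] trace_of_to_op ext_trace_posop L1bop_dg[OF wl1] posop_dg[OF bd nn])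
qed

end

section \<open>Invariance of traces under isometries\<close>

text \<open>Both complements are countably infinite and can be matched with each other.\<close>

lemma extend_to_permutation:
  fixes h :: "nat \<Rightarrow> nat"
  assumes "inj_on h A" "infinite (- A)" "infinite (- h ` A)"
  obtains p where "bij p" "\<And>a. a \<in> A \<Longrightarrow> p a = h a"
proof -
  have "bij_betw (enumerate (- A)) UNIV (- A)" "bij_betw (enumerate (- h ` A)) UNIV (- h ` A)"
    using assms by (simp_all add: bij_enumerate)
  then obtain g where g: "bij_betw g (- A) (- h ` A)"
    by (metis bij_betw_inv_into bij_betw_trans)
  define p where "p a = (if a \<in> A then h a else g a)" for a
  have "bij_betw p (A \<union> - A) (h ` A \<union> - h ` A)"
    using assms(1) g unfolding p_def by (intro bij_betw_disjoint_Un) (auto simp: inj_on_imp_bij_betw)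
  then show ?thesis by (intro that[of p]) (auto simp: p_def)
qed

definition iop :: "(nat \<Rightarrow> nat) \<Rightarrow> bop" where "iop h = colop (\<lambda>k. bvec (h k))"

lemma subortho_bvec_inj: "inj h \<Longrightarrow> subortho (\<lambda>k. bvec (h k))"
  by (auto simp: subortho_def inj_eq)

lemma iop_bvec: "inj h \<Longrightarrow> app (iop h) (bvec k) = bvec (h k)"
  unfolding iop_def by (rule app_colop_bvec[OF subortho_bvec_inj])

lemma co_adj_iop: "inj h \<Longrightarrow> co (app (adj (iop h)) x) k = co x (h k)"
  by (simp add: iop_def co_rowop[OF subortho_bvec_inj])

lemma iop_isometry: "inj h \<Longrightarrow> adj (iop h) * iop h = 1"
  unfolding iop_def adj_colop by (rule rowop_colop[OF subortho_bvec_inj]) auto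

lemma adj_iop_bvec: assumes "inj h" shows "app (adj (iop h)) (bvec (h k)) = bvec k"
  by (rule ell2_eqI) (simp add: co_adj_iop[OF assms] inj_eq[OF assms])

lemma adj_iop_bvec_notin: assumes "inj h" "j \<notin> range h" shows "app (adj (iop h)) (bvec j) = 0"
  by (rule ell2_eqI) (use assms(2) in \<open>auto simp: co_adj_iop[OF assms(1)]\<close>)

lemma iop_unitary: assumes "bij h" shows "unitary (iop h)"
proof -
  note i = bij_is_inj[OF assms]
  have "iop h * adj (iop h) = 1"
  proof (rule bop_eq_dlI)
    fix j obtain k where "j = h k" using assms by (metis bij_pointE)
    then show "app (iop h * adj (iop h)) (bvec j) = app 1 (bvec j)" by (simp add: adj_iop_bvec[OF i] iop_bvec[OF i])
  qed
  then show ?thesis by (simp add: unitary_def iop_isometry[OF i])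
qed

lemma adj_dg: assumes "bounded (range d)" shows "adj (dg d) = dg (\<lambda>k. cnj (d k))"
proof -
  have b: "bounded (range (\<lambda>k. cnj (d k)))" using assms by (auto simp: bounded_iff)
  show ?thesis by (rule bop_eqI, rule ell2_eqI) (simp add: co_adj app_dg_bvec[OF assms] co_dg[OF b])
qed

text \<open>Two isometries with complementary ranges identify the space with two copies of itself;
  the relations below are those of the Cuntz algebra with two generators.\<close>

definition even_iso :: bop where "even_iso = iop (\<lambda>k. 2 * k)"
definition odd_iso :: bop where "odd_iso = iop (\<lambda>k. 2 * k + 1)"

lemma inj_even: "inj (\<lambda>k::nat. 2 * k)" and inj_odd: "inj (\<lambda>k::nat. 2 * k + 1)"
  by (simp_all add: inj_def)

lemma even_iso_odd_iso_relations: "adj even_iso * even_iso = 1" "adj odd_iso * odd_iso = 1" "adj even_iso * odd_iso = 0" "adj odd_iso * even_iso = 0"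
  "even_iso * adj even_iso + odd_iso * adj odd_iso = 1"
proof -
  show 1: "adj even_iso * even_iso = 1" "adj odd_iso * odd_iso = 1"
    unfolding even_iso_def odd_iso_def by (rule iop_isometry inj_even inj_odd)+
  show 2: "adj even_iso * odd_iso = 0"
    unfolding even_iso_def odd_iso_def
    by (rule bop_eq_dlI, rule ell2_eqI) (simp add: iop_bvec[OF inj_odd, simplified] co_adj_iop[OF inj_even], presburger)
  from arg_cong[OF this, of adj] show "adj odd_iso * even_iso = 0" by simp
  show "even_iso * adj even_iso + odd_iso * adj odd_iso = 1"
  proof (rule bop_eq_dlI)
    fix k
    show "app (even_iso * adj even_iso + odd_iso * adj odd_iso) (bvec k) = app 1 (bvec k)"
    proof (cases "even k")
      case True
      then obtain j where j: "k = 2 * j" by blast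
      have "k \<notin> range (\<lambda>k. 2 * k + 1)" using True by auto
      then show ?thesis
        using adj_iop_bvec_notin[OF inj_odd] adj_iop_bvec[OF inj_even, of j] iop_bvec[OF inj_even, of j]
        unfolding even_iso_def odd_iso_def j by simp
    next
      case False
      then obtain j where j: "k = 2 * j + 1" using oddE by blast
      have "k \<notin> range (\<lambda>k. 2 * k)" using False by auto
      then show ?thesis
        using adj_iop_bvec_notin[OF inj_even] adj_iop_bvec[OF inj_odd, of j] iop_bvec[OF inj_odd, of j]
        unfolding even_iso_def odd_iso_def j by simp
    qed
  qed
qed

text \<open>With R the diagonal of alternating signs, (1 + R) / 2 and (1 - R) / 2 project onto the
  even and odd coordinates. On each half doubling agrees with a permutation of all indices, since
  half of the indices and their doubles both have infinite complements; U1 and U2 are the two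
  permutation operators.\<close>

lemma even_iso_unitary_combination:
  obtains U1 U2 R where "unitary U1" "unitary U2" "unitary R"
    "even_iso = sc (1/2) * (U1 + U1 * R + U2 + sc (-1) * (U2 * R))"
proof -
  have ie: "infinite (- range (\<lambda>k::nat. 2 * k))"
    by (rule infinite_super[OF _ range_inj_infinite[OF inj_odd]]) (auto, presburger)
  have io: "infinite (- range (\<lambda>k::nat. 2 * k + 1))"
    by (rule infinite_super[OF _ range_inj_infinite[OF inj_even]]) (auto, presburger)
  have i4: "infinite (- (\<lambda>k::nat. 2 * k) ` A)" for A
    by (rule infinite_super[OF _ range_inj_infinite[OF inj_odd]]) (auto, presburger)
  note ij = inj_on_subset[OF inj_even subset_UNIV]
  obtain p :: "nat \<Rightarrow> nat" where p: "bij p" "\<And>a. a \<in> range (\<lambda>k. 2 * k) \<Longrightarrow> p a = 2 * a"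
    using extend_to_permutation[OF ij ie i4] by blast
  obtain q :: "nat \<Rightarrow> nat" where q: "bij q" "\<And>a. a \<in> range (\<lambda>k. 2 * k + 1) \<Longrightarrow> q a = 2 * a"
    using extend_to_permutation[OF ij io i4] by blast
  define d where "d k = (if even k then 1 else -1 :: complex)" for k :: nat
  have bd: "bounded (range d)" by (auto simp: bounded_iff d_def intro!: exI[of _ 1])
  have "(\<lambda>k. cnj (d k)) = d" by (auto simp: d_def)
  then have "adj (dg d) = dg d" by (simp add: adj_dg[OF bd])
  moreover have "dg d * dg d = 1"
    by (rule bop_eq_dlI) (simp add: app_dg_bvec[OF bd] d_def)
  ultimately have R: "unitary (dg d)" by (simp add: unitary_def)
  have "even_iso = sc (1/2) * (iop p + iop p * dg d + iop q + sc (-1) * (iop q * dg d))"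
  proof (rule bop_eq_dlI)
    fix k
    have half: "cs (1/2) (x + x) = x" for x by (rule ell2_eqI) simp
    show "app even_iso (bvec k) = app (sc (1/2) * (iop p + iop p * dg d + iop q + sc (-1) * (iop q * dg d))) (bvec k)"
    proof (cases "even k")
      case True
      then have "p k = 2 * k" by (intro p(2)) auto
      then show ?thesis using True half
        by (simp add: even_iso_def iop_bvec[OF inj_even] iop_bvec[OF bij_is_inj[OF p(1)]] iop_bvec[OF bij_is_inj[OF q(1)]]
            app_dg_bvec[OF bd] d_def uminus_cs[symmetric] flip: cs_simps(1))
    next
      case False
      then obtain j where "k = 2 * j + 1" using oddE by blast
      then have "q k = 2 * k" by (intro q(2)) auto
      then show ?thesis using False half
        by (simp add: even_iso_def iop_bvec[OF inj_even] iop_bvec[OF bij_is_inj[OF p(1)]] iop_bvec[OF bij_is_inj[OF q(1)]]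
            app_dg_bvec[OF bd] d_def uminus_cs[symmetric] flip: cs_simps(1))
    qed
  qed
  then show ?thesis using that iop_unitary[OF p(1)] iop_unitary[OF q(1)] R by blast
qed

text \<open>The Halmos dilation of the isometry V, with the doubled space identified with the space itself
  through even and odd indices.\<close>

definition halmos :: "bop \<Rightarrow> bop" where
  "halmos V = even_iso * V * adj even_iso + even_iso * (1 - V * adj V) * adj odd_iso + odd_iso * adj V * adj odd_iso"

text \<open>In block form the rows are V, 1 - V \<open>adj V\<close> and 0, \<open>adj V\<close>.
  The products collapse because 1 - V \<open>adj V\<close> is the projection that kills the range of
  V. The second equation says that the unitary restricts to V on the even copy.\<close>

lemma halmos:
  assumes "adj V * V = 1"
  shows "unitary (halmos V)" "halmos V * even_iso = even_iso * V"
proof -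
  have r: "adj even_iso * (even_iso * X) = X" "adj odd_iso * (odd_iso * X) = X" "adj even_iso * (odd_iso * X) = 0" "adj odd_iso * (even_iso * X) = 0"
    "adj V * (V * X) = X" for X
    using even_iso_odd_iso_relations(1-4) assms by (simp_all add: mult.assoc[symmetric])
  note rr = r even_iso_odd_iso_relations(1-4) assms
  show "unitary (halmos V)"
    unfolding unitary_def
  proof
    have "adj (halmos V) * halmos V = even_iso * adj even_iso + odd_iso * adj odd_iso"
      unfolding halmos_def by (simp add: distrib_left distrib_right left_diff_distrib right_diff_distrib mult.assoc rr)
    then show "adj (halmos V) * halmos V = 1" by (simp add: even_iso_odd_iso_relations(5))
    have "halmos V * adj (halmos V) = even_iso * adj even_iso + odd_iso * adj odd_iso"
      unfolding halmos_def by (simp add: distrib_left distrib_right left_diff_distrib right_diff_distrib mult.assoc rr)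
    then show "halmos V * adj (halmos V) = 1" by (simp add: even_iso_odd_iso_relations(5))
  qed
  show "halmos V * even_iso = even_iso * V"
    unfolding halmos_def by (simp add: distrib_right mult.assoc rr)
qed

section \<open>Cyclicity of a trace and conjugation by isometries\<close>

context
  fixes \<tau> assumes \<tau>: "\<tau> \<in> PT"
begin

definition btrace :: "bop \<Rightarrow> complex" where "btrace T = \<tau> (to_op T)"

lemma btrace_add: "S \<in> L1bop \<Longrightarrow> T \<in> L1bop \<Longrightarrow> btrace (S + T) = btrace S + btrace T"
  using \<tau> unfolding PT_def positive_trace_def is_trace_def btrace_def L1bop_def to_op_plus by blast

lemma btrace_scale: "T \<in> L1bop \<Longrightarrow> btrace (sc c * T) = c * btrace T"
  using \<tau> unfolding PT_def positive_trace_def is_trace_def btrace_def L1bop_def to_op_sc by blast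

lemma btrace_conj: assumes "T \<in> L1bop" "unitary U" shows "btrace (U * T * adj U) = btrace T"
proof -
  have "\<forall>A\<in>L1inf. \<forall>U V. unitary_op U \<and> is_adjoint U V \<longrightarrow> \<tau> (U \<circ> A \<circ> V) = \<tau> A"
    using \<tau> unfolding PT_def positive_trace_def is_trace_def by blast
  moreover have "to_op T \<in> L1inf" "unitary_op (to_op U)" "is_adjoint (to_op U) (to_op (adj U))"
    using assms by (simp_all add: L1bop_def unitary_op_to_op is_adjoint_to_op)
  ultimately show ?thesis unfolding btrace_def to_op_times by blast
qed

lemma btrace_posop: "T \<in> L1bop \<Longrightarrow> posop T \<Longrightarrow> Im (btrace T) = 0" "T \<in> L1bop \<Longrightarrow> posop T \<Longrightarrow> 0 \<le> Re (btrace T)"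
  using \<tau> positive_op_to_op[of T] unfolding PT_def positive_trace_def btrace_def L1bop_def by blast+

lemma btrace_normalised: "T \<in> L1bop \<Longrightarrow> posop T \<Longrightarrow> (\<And>n. sv n T = 1 / real (n + 1)) \<Longrightarrow> btrace T = 1"
  using \<tau> positive_op_to_op[of T] unfolding PT_def normalised_def btrace_def L1bop_def sv_def by blast

text \<open>The multipliers with this property are closed under sums, scalar multiples and products
  and contain the unitaries, hence also \<open>even_iso\<close>.\<close>

definition commutes_under_trace :: "bop \<Rightarrow> bool" where
  "commutes_under_trace X \<longleftrightarrow> (\<forall>T\<in>L1bop. btrace (X * T) = btrace (T * X))"

lemma cut_unitary: assumes "unitary U" shows "commutes_under_trace U"
  unfolding commutes_under_trace_def
proof
  fix T assume "T \<in> L1bop"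
  then have "btrace (U * (T * U) * adj U) = btrace (T * U)" by (intro btrace_conj L1bop_right assms)
  moreover have "U * (T * U) * adj U = U * T" using assms unfolding unitary_def by (simp add: mult.assoc)
  ultimately show "btrace (U * T) = btrace (T * U)" by simp
qed

lemma cut_add: "commutes_under_trace X \<Longrightarrow> commutes_under_trace Y \<Longrightarrow> commutes_under_trace (X + Y)"
  unfolding commutes_under_trace_def by (simp add: distrib_left distrib_right btrace_add L1bop_left L1bop_right)

lemma cut_scale: assumes "commutes_under_trace X" shows "commutes_under_trace (sc c * X)"
proof -
  have "T * (sc c * X) = sc c * (T * X)" for T by (metis mult.assoc sc_commute)
  then show ?thesis
    using assms unfolding commutes_under_trace_def by (simp add: mult.assoc btrace_scale L1bop_left L1bop_right)
qed

lemma cut_mult: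
  assumes "commutes_under_trace X" "commutes_under_trace Y" shows "commutes_under_trace (X * Y)"
  unfolding commutes_under_trace_def
proof
  fix T assume T: "T \<in> L1bop"
  have "btrace (X * (Y * T)) = btrace (Y * T * X)" using assms(1) L1bop_left[OF T] unfolding commutes_under_trace_def by blast
  also have "\<dots> = btrace (Y * (T * X))" by (simp add: mult.assoc)
  also have "\<dots> = btrace (T * X * Y)" using assms(2) L1bop_right[OF T] unfolding commutes_under_trace_def by blast
  finally show "btrace (X * Y * T) = btrace (T * (X * Y))" by (simp add: mult.assoc)
qed

lemma btrace_even_iso: assumes "T \<in> L1bop" shows "btrace (even_iso * T * adj even_iso) = btrace T"
proof -
  obtain U1 U2 R where U: "unitary U1" "unitary U2" "unitary R"
    "even_iso = sc (1/2) * (U1 + U1 * R + U2 + sc (-1) * (U2 * R))" using even_iso_unitary_combination .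
  have "commutes_under_trace even_iso"
    unfolding U(4) by (intro cut_scale cut_add cut_mult cut_unitary U)
  then have "btrace (even_iso * (T * adj even_iso)) = btrace (T * adj even_iso * even_iso)"
    using L1bop_right[OF assms] unfolding commutes_under_trace_def by blast
  then show ?thesis by (simp add: mult.assoc even_iso_odd_iso_relations(1))
qed

text \<open>Conjugation by \<open>even_iso\<close> preserves the trace and moves the operator to the
  even copy, where V is the restriction of the unitary \<open>halmos V\<close>; unitary invariance
  finishes.\<close>

lemma btrace_isometry: assumes "T \<in> L1bop" "adj V * V = 1" shows "btrace (V * T * adj V) = btrace T"
proof -
  let ?H = "halmos V"
  have "btrace (V * T * adj V) = btrace (even_iso * (V * T * adj V) * adj even_iso)"
    by (rule btrace_even_iso[symmetric]) (rule L1bop_mult[OF assms(1)])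
  also have "even_iso * (V * T * adj V) * adj even_iso = (?H * even_iso) * T * adj (?H * even_iso)"
    unfolding halmos(2)[OF assms(2)] by (simp add: mult.assoc)
  also have "\<dots> = ?H * (even_iso * T * adj even_iso) * adj ?H" by (simp add: mult.assoc)
  also have "btrace \<dots> = btrace (even_iso * T * adj even_iso)" by (rule btrace_conj[OF L1bop_mult[OF assms(1)] halmos(1)[OF assms(2)]])
  also have "\<dots> = btrace T" by (rule btrace_even_iso[OF assms(1)])
  finally show ?thesis .
qed

lemma btrace_eq_diagonal: assumes "T \<in> L1bop" "posop T" shows "btrace T = btrace (dg (\<lambda>k. of_real (sv k T)))"
proof -
  obtain e where e: "subortho e" "\<And>k. norm (e k) = 1" "\<And>k. app T (e k) = cs (of_real (sv k T)) (e k)"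
    "T = colop e * dg (\<lambda>k. of_real (sv k T)) * rowop e"
    using spectral_theorem[OF assms] by blast
  have "btrace T = btrace (colop e * dg (\<lambda>k. of_real (sv k T)) * adj (colop e))" using e(4) by simp
  also have "\<dots> = btrace (dg (\<lambda>k. of_real (sv k T)))"
    by (rule btrace_isometry[OF L1bop_dg[OF weak_l1_sv[OF assms(1)]]]) (simp add: rowop_colop[OF e(1,2)])
  finally show ?thesis .
qed

end

section \<open>Cyclic averaging inside dyadic blocks\<close>

text \<open>cyc r j rotates the n-th dyadic block by j steps of length 2^(n - r); blocks with n < r are
  left fixed because then 2^n div 2^r = 0.\<close>

definition cyc :: "nat \<Rightarrow> nat \<Rightarrow> nat \<Rightarrow> nat" where
  "cyc r j k = 2 ^ dyad k - 1 + (k + 1 - 2 ^ dyad k + j * (2 ^ dyad k div 2 ^ r)) mod 2 ^ dyad k"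

lemma cyc_Suc: "cyc r j k + 1 = 2 ^ dyad k + (k + 1 - 2 ^ dyad k + j * (2 ^ dyad k div 2 ^ r)) mod 2 ^ dyad k"
proof -
  have "(1::nat) \<le> 2 ^ dyad k" by simp
  then show ?thesis unfolding cyc_def by linarith
qed

lemma dyad_cyc: "dyad (cyc r j k) = dyad k"
proof (rule dyad_eqI)
  have "(k + 1 - 2 ^ dyad k + j * (2 ^ dyad k div 2 ^ r)) mod 2 ^ dyad k < 2 ^ dyad k" by simp
  then show "2 ^ dyad k \<le> cyc r j k + 1" "cyc r j k + 1 < 2 ^ Suc (dyad k)"
    unfolding cyc_Suc by simp_all
qed

lemma cyc_cyc: "cyc r i (cyc r j k) = cyc r (i + j) k"
proof -
  let ?n = "dyad k" let ?L = "2 ^ ?n div 2 ^ r"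
  have "cyc r j k + 1 - 2 ^ ?n = (k + 1 - 2 ^ ?n + j * ?L) mod 2 ^ ?n"
    unfolding cyc_Suc by simp
  then have "cyc r i (cyc r j k) = 2 ^ ?n - 1 + ((k + 1 - 2 ^ ?n + j * ?L) mod 2 ^ ?n + i * ?L) mod 2 ^ ?n"
    unfolding cyc_def[of r i "cyc r j k"] dyad_cyc by (simp only:)
  also have "\<dots> = 2 ^ ?n - 1 + (k + 1 - 2 ^ ?n + j * ?L + i * ?L) mod 2 ^ ?n"
    by (simp only: mod_add_left_eq)
  also have "\<dots> = cyc r (i + j) k"
    unfolding cyc_def by (simp add: algebra_simps)
  finally show ?thesis .
qed

lemma cyc_full: "cyc r (2 ^ r) k = k"
proof -
  let ?n = "dyad k"
  have lt: "k + 1 - 2 ^ ?n < 2 ^ ?n" using dyad_bounds[of k] by simp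
  \<comment> \<open>For r at most n, 2^r steps go exactly once around the block; for larger r the
    step has length 0.\<close>
  have "(2::nat) ^ r * (2 ^ ?n div 2 ^ r) = (if r \<le> ?n then 2 ^ ?n else 0)"
    by (auto simp: le_imp_power_dvd)
  then have "(k + 1 - 2 ^ ?n + 2 ^ r * (2 ^ ?n div 2 ^ r)) mod 2 ^ ?n = k + 1 - 2 ^ ?n"
    using lt by simp
  then show ?thesis using cyc_Suc[of r "2 ^ r" k] dyad_bounds(1)[of k] by linarith
qed

lemma bij_cyc: assumes "j \<le> 2 ^ r" shows "bij (cyc r j)"
proof (rule o_bij)
  show "cyc r (2 ^ r - j) \<circ> cyc r j = id" "cyc r j \<circ> cyc r (2 ^ r - j) = id"
    using assms by (auto simp: fun_eq_iff cyc_cyc cyc_full)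
qed

lemma sum_cyclic:
  fixes h :: "nat \<Rightarrow> real"
  shows "(\<Sum>j<m. h ((q + j) mod m)) = (\<Sum>j<m. h j)"
proof (induction q)
  case 0
  show ?case by (intro sum.cong) auto
next
  case (Suc q)
  define F where "F j = h ((q + j) mod m)" for j
  have "(\<Sum>j<m. F (Suc j)) + F 0 = (\<Sum>j<m. F j) + F m"
    by (metis sum.lessThan_Suc sum.lessThan_Suc_shift add.commute)
  moreover have "F m = F 0" by (simp add: F_def)
  ultimately show ?case using Suc by (simp add: F_def)
qed

text \<open>Both the rotation average and the block average lie between the lower and the upper
  Riemann sum of mesh 2^(n - r).\<close>

lemma cyc_average_close:
  fixes a :: "nat \<Rightarrow> real"
  assumes anti: "\<And>i j. i \<le> j \<Longrightarrow> a j \<le> a i" and nonneg: "\<And>k. 0 \<le> a k" and r: "r \<le> dyad k"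
  shows "\<bar>(\<Sum>j<2 ^ r. a (cyc r j k)) / 2 ^ r - (\<Sum>i\<in>block (dyad k). a i) / 2 ^ dyad k\<bar>
     \<le> a (2 ^ dyad k - 1) / 2 ^ r"
proof -
  define n m L s i where "n = dyad k" and "m = (2::nat) ^ r" and "L = (2::nat) ^ (n - r)"
    and "s = (2::nat) ^ n - 1" and "i = k + 1 - 2 ^ n"
  have mL: "m * L = 2 ^ n" using r by (simp add: m_def L_def n_def flip: power_add)
  have L: "2 ^ n div 2 ^ r = L" using mL by (simp add: m_def[symmetric]) (simp add: m_def flip: mL)
  have L0: "0 < L" "0 < m" by (simp_all add: L_def m_def)
  define U V where "U = (\<Sum>j<m. a (s + j * L))" and "V = (\<Sum>j<m. a (s + (j + 1) * L))"
  define p where "p j = (i + j * L) mod 2 ^ n" for j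
  \<comment> \<open>c j is the number of the cell of length L that contains the rotated position p
    j. Being a cyclic shift, it visits each of the m cells once as j runs.\<close>
  define c where "c j = (i div L + j) mod m" for j
  have p: "p j = L * c j + (i + j * L) mod L" for j
    unfolding p_def mL[symmetric] mult.commute[of m L] mod_mult2_eq c_def using L0 by (simp add: add.commute)
  have cyc: "cyc r j k = s + p j" for j
    unfolding cyc_def n_def[symmetric] L p_def s_def i_def by simp
  have "(\<Sum>j<m. a (cyc r j k)) \<le> (\<Sum>j<m. a (s + c j * L))"
    unfolding cyc by (intro sum_mono anti) (simp add: p)
  also have "\<dots> = U" unfolding U_def c_def by (rule sum_cyclic[of "\<lambda>j. a (s + j * L)"])
  finally have up: "(\<Sum>j<m. a (cyc r j k)) \<le> U" .
  have "V = (\<Sum>j<m. a (s + (c j + 1) * L))"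
    unfolding V_def c_def by (rule sum_cyclic[of "\<lambda>j. a (s + (j + 1) * L)", symmetric])
  also have "\<dots> \<le> (\<Sum>j<m. a (cyc r j k))"
  proof (unfold cyc, intro sum_mono anti)
    fix j
    have "(i + j * L) mod L < L" using L0 by simp
    then show "s + p j \<le> s + (c j + 1) * L" by (simp add: p)
  qed
  finally have lo: "V \<le> (\<Sum>j<m. a (cyc r j k))" .
  have bl: "(\<Sum>i\<in>block n. a i) = (\<Sum>j<m. sum (\<lambda>u. a (s + u)) {j * L..<j * L + L})"
  proof -
    have "block n = (\<lambda>u. s + u) ` {..<m * L}"
      unfolding block_def mL s_def lessThan_atLeast0 image_add_atLeastLessThan by (simp add: mult_2)
    then have "(\<Sum>i\<in>block n. a i) = (\<Sum>u<m * L. a (s + u))"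
      by (simp add: sum.reindex)
    then show ?thesis by (simp add: sum.nat_group[symmetric])
  qed
  have "(\<Sum>i\<in>block n. a i) \<le> (\<Sum>j<m. \<Sum>u\<in>{j * L..<j * L + L}. a (s + j * L))"
    unfolding bl by (intro sum_mono anti) auto
  also have "\<dots> = real L * U" by (simp add: U_def sum_distrib_left)
  finally have up2: "(\<Sum>i\<in>block n. a i) \<le> real L * U" .
  have "real L * V = (\<Sum>j<m. \<Sum>u\<in>{j * L..<j * L + L}. a (s + (j + 1) * L))"
    by (simp add: V_def sum_distrib_left)
  also have "\<dots> \<le> (\<Sum>i\<in>block n. a i)"
    unfolding bl by (intro sum_mono anti) auto
  finally have lo2: "real L * V \<le> (\<Sum>i\<in>block n. a i)" .
  \<comment> \<open>The two Riemann sums telescope to their end terms, so they differ by at most the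
    largest value in the block; dividing by m gives the error.\<close>
  have "U - V = a (s + 0 * L) - a (s + m * L)"
    unfolding U_def V_def sum_subtractf[symmetric]
    using sum_lessThan_telescope'[of "\<lambda>j. a (s + j * L)" m] by simp
  then have UV: "U - V \<le> a s" using nonneg[of "s + m * L"] by simp
  have pw: "(2::real) ^ n = real m * real L" using mL by (metis of_nat_mult of_nat_numeral of_nat_power)
  have "\<bar>(\<Sum>j<m. a (cyc r j k)) / real m - (\<Sum>i\<in>block n. a i) / 2 ^ n\<bar> \<le> a s / real m"
  proof -
    have "V / real m \<le> (\<Sum>j<m. a (cyc r j k)) / real m" "(\<Sum>j<m. a (cyc r j k)) / real m \<le> U / real m"
      using lo up by (simp_all add: divide_right_mono)
    moreover have "V / real m \<le> (\<Sum>i\<in>block n. a i) / 2 ^ n" "(\<Sum>i\<in>block n. a i) / 2 ^ n \<le> U / real m"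
      unfolding pw using lo2 up2 L0 by (simp_all add: field_simps)
    moreover have "(U - V) / real m \<le> a s / real m" using UV by (simp add: divide_right_mono)
    then have "U / real m - V / real m \<le> a s / real m" by (simp add: diff_divide_distrib)
    ultimately show ?thesis by linarith
  qed
  then show ?thesis by (simp add: m_def n_def s_def)
qed

section \<open>Real sequences in weak l1\<close>

lemma weak_l1_realI: "(\<And>k. \<bar>a k\<bar> \<le> C / real (k + 1)) \<Longrightarrow> weak_l1 (\<lambda>k. of_real (a k))"
  unfolding weak_l1_def norm_of_real by blast

abbreviation wl1 :: "(nat \<Rightarrow> real) \<Rightarrow> bool" where "wl1 a \<equiv> weak_l1 (\<lambda>k. complex_of_real (a k))"

lemma wl1_obtain: assumes "wl1 a" obtains C where "0 \<le> C" "\<And>k. \<bar>a k\<bar> \<le> C / real (k + 1)"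
proof -
  obtain C where C: "\<And>k. \<bar>a k\<bar> \<le> C / real (k + 1)" using assms unfolding weak_l1_def norm_of_real by blast
  then show ?thesis using C[of 0] by (intro that[of C]) auto
qed

lemma wl1_bounded: "wl1 a \<Longrightarrow> bounded (range a)"
  using weak_l1_bounded[of "\<lambda>k. complex_of_real (a k)"] by (auto simp: bounded_iff)

lemma wl1_add: assumes "wl1 a" "wl1 b" shows "wl1 (\<lambda>k. a k + b k)"
proof -
  obtain C where C: "\<And>k. \<bar>a k\<bar> \<le> C / real (k + 1)" using wl1_obtain[OF assms(1)] by blast
  obtain D where D: "\<And>k. \<bar>b k\<bar> \<le> D / real (k + 1)" using wl1_obtain[OF assms(2)] by blast
  have "\<bar>a k + b k\<bar> \<le> (C + D) / real (k + 1)" for k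
    using C[of k] D[of k] abs_triangle_ineq[of "a k" "b k"] unfolding add_divide_distrib by linarith
  then show ?thesis by (rule weak_l1_realI)
qed

lemma wl1_scale: assumes "wl1 a" shows "wl1 (\<lambda>k. c * a k)"
proof -
  obtain C where C: "\<And>k. \<bar>a k\<bar> \<le> C / real (k + 1)" using wl1_obtain[OF assms(1)] by blast
  have "\<bar>c * a k\<bar> \<le> (\<bar>c\<bar> * C) / real (k + 1)" for k
    using mult_left_mono[OF C[of k], of "\<bar>c\<bar>"] by (simp add: abs_mult)
  then show ?thesis by (rule weak_l1_realI)
qed

lemma wl1_diff: assumes "wl1 a" "wl1 b" shows "wl1 (\<lambda>k. a k - b k)"
  using wl1_add[OF assms(1) wl1_scale[OF assms(2), of "-1"]] by simp

text \<open>A rotation stays inside its dyadic block, where k + 1 varies by a factor of at most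
  2.\<close>

lemma wl1_cyc: assumes "wl1 a" shows "wl1 (\<lambda>k. a (cyc r j k))"
proof -
  obtain C where C: "0 \<le> C" "\<And>k. \<bar>a k\<bar> \<le> C / real (k + 1)" using wl1_obtain[OF assms(1)] by blast
  have "\<bar>a (cyc r j k)\<bar> \<le> (2 * C) / real (k + 1)" for k
  proof -
    have "2 ^ dyad k \<le> cyc r j k + 1" using dyad_bounds(1)[of "cyc r j k"] by (simp add: dyad_cyc)
    then have "k + 1 \<le> 2 * (cyc r j k + 1)" using dyad_bounds(2)[of k] by simp
    then have "real (k + 1) \<le> 2 * real (cyc r j k + 1)" by linarith
    then have "C / real (cyc r j k + 1) \<le> (2 * C) / real (k + 1)"
      using C(1) mult_left_mono[of "real (k + 1)" "2 * real (cyc r j k + 1)" C] by (simp add: field_simps)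
    then show ?thesis using C(2)[of "cyc r j k"] by linarith
  qed
  then show ?thesis by (rule weak_l1_realI)
qed

lemma wl1_Dmap: "x \<in> linf \<Longrightarrow> wl1 (Dmap x)"
  by (rule weak_l1_Dmap)

section \<open>The Banach limit of a trace\<close>

context
  fixes \<tau> assumes \<tau>: "\<tau> \<in> PT"
begin

definition diag_trace :: "(nat \<Rightarrow> real) \<Rightarrow> real" where "diag_trace a = Re (btrace \<tau> (dg (\<lambda>k. of_real (a k))))"

lemma diag_trace_add: assumes "wl1 a" "wl1 b" shows "diag_trace (\<lambda>k. a k + b k) = diag_trace a + diag_trace b"
proof -
  have "dg (\<lambda>k. of_real (a k + b k)) = dg (\<lambda>k. of_real (a k)) + dg (\<lambda>k. of_real (b k))"
    by (rule bop_eqI, rule ell2_eqI,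
        simp only: co_dg[OF weak_l1_bounded[OF wl1_add[OF assms]]] app_simps co_simps
        co_dg[OF weak_l1_bounded[OF assms(1)]] co_dg[OF weak_l1_bounded[OF assms(2)]], simp add: distrib_right)
  then show ?thesis by (simp add: diag_trace_def btrace_add[OF \<tau>] L1bop_dg assms)
qed

lemma diag_trace_scale: assumes "wl1 a" shows "diag_trace (\<lambda>k. c * a k) = c * diag_trace a"
proof -
  have "dg (\<lambda>k. of_real (c * a k)) = sc (of_real c) * dg (\<lambda>k. of_real (a k))"
    by (rule bop_eqI, rule ell2_eqI,
        simp only: co_dg[OF weak_l1_bounded[OF wl1_scale[OF assms]]] app_simps app_sc co_simps
        co_dg[OF weak_l1_bounded[OF assms(1)]], simp)
  then show ?thesis by (simp add: diag_trace_def btrace_scale[OF \<tau>] L1bop_dg assms)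
qed

lemma diag_trace_diff: assumes "wl1 a" "wl1 b" shows "diag_trace (\<lambda>k. a k - b k) = diag_trace a - diag_trace b"
  using diag_trace_add[OF assms(1) wl1_scale[OF assms(2), of "-1"]] diag_trace_scale[OF assms(2), of "-1"] by simp

lemma diag_trace_nonneg: assumes "wl1 a" "\<And>k. 0 \<le> a k" shows "0 \<le> diag_trace a"
  unfolding diag_trace_def by (rule btrace_posop(2)[OF \<tau> L1bop_dg[OF assms(1)] posop_dg[OF wl1_bounded[OF assms(1)] assms(2)]])

lemma diag_trace_abs_le: assumes "wl1 a" "wl1 b" "\<And>k. \<bar>a k\<bar> \<le> b k" shows "\<bar>diag_trace a\<bar> \<le> diag_trace b"
proof -
  have "0 \<le> b k - a k" "0 \<le> b k + a k" for k using assms(3)[of k] by linarith+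
  then have "0 \<le> diag_trace (\<lambda>k. b k - a k)" "0 \<le> diag_trace (\<lambda>k. b k + a k)"
    using assms by (auto intro!: diag_trace_nonneg simp del: of_real_add of_real_diff intro: wl1_add wl1_diff)
  then show ?thesis by (simp add: diag_trace_add diag_trace_diff assms)
qed

text \<open>Moving the entries along h and filling the gaps with zeros is conjugation by the
  isometry \<open>iop h\<close>.\<close>

lemma diag_trace_spread:
  assumes h: "inj h" and "wl1 a" "wl1 b" "\<And>k. b (h k) = a k" "\<And>j. j \<notin> range h \<Longrightarrow> b j = 0"
  shows "diag_trace b = diag_trace a"
proof -
  note bd = weak_l1_bounded[OF assms(2)] weak_l1_bounded[OF assms(3)]
  have "dg (\<lambda>k. of_real (b k)) = iop h * dg (\<lambda>k. of_real (a k)) * adj (iop h)"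
  proof (rule bop_eq_dlI)
    fix j
    show "app (dg (\<lambda>k. of_real (b k))) (bvec j) = app (iop h * dg (\<lambda>k. of_real (a k)) * adj (iop h)) (bvec j)"
    proof (cases "j \<in> range h")
      case True
      then obtain k where "j = h k" by blast
      then show ?thesis by (simp add: app_dg_bvec[OF bd(1)] app_dg_bvec[OF bd(2)] adj_iop_bvec[OF h] iop_bvec[OF h] assms(4))
    next
      case False
      then show ?thesis by (simp add: app_dg_bvec[OF bd(2)] adj_iop_bvec_notin[OF h] assms(5))
    qed
  qed
  then show ?thesis
    unfolding diag_trace_def using btrace_isometry[OF \<tau> L1bop_dg[OF assms(2)] iop_isometry[OF h]] by simp
qed

lemma diag_trace_cyc: assumes "wl1 a" "j \<le> 2 ^ r" shows "diag_trace (\<lambda>k. a (cyc r j k)) = diag_trace a"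
proof (rule diag_trace_spread[OF _ assms(1) wl1_cyc[OF assms(1)]])
  \<comment> \<open>The entries travel along the inverse of \<open>cyc r j\<close>, the rotation by
    the complementary number of steps.\<close>
  have bij: "bij (cyc r (2 ^ r - j))" by (rule bij_cyc) simp
  then show "inj (cyc r (2 ^ r - j))" by (rule bij_is_inj)
  show "a (cyc r j (cyc r (2 ^ r - j) k)) = a k" for k using assms(2) by (simp add: cyc_cyc cyc_full)
  show "a (cyc r j k) = 0" if "k \<notin> range (cyc r (2 ^ r - j))" for k
    using that bij_is_surj[OF bij] by simp
qed

definition assoc_lim :: "(nat \<Rightarrow> real) \<Rightarrow> real" where
  "assoc_lim x = Re (\<tau> (diag (\<lambda>k. complex_of_real (Dmap x k))))"

lemma assoc_lim_diag_trace: assumes "x \<in> linf" shows "assoc_lim x = diag_trace (Dmap x)"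
  unfolding assoc_lim_def diag_trace_def btrace_def[OF \<tau>] to_op_dg[OF weak_l1_bounded[OF wl1_Dmap[OF assms]]] ..

lemma dyad_double: "dyad (2 * k + 1) = Suc (dyad k)" "dyad (2 * k + 2) = Suc (dyad k)"
  using dyad_bounds[of k] by (auto intro!: dyad_eqI)

text \<open>Apart from index 0, \<open>Dmap (shift x)\<close> carries every entry of
  \<open>Dmap x\<close> twice with half the weight, at the indices 2 k + 1 and 2 k + 2. Each copy is
  a spread-out version and contributes half of the trace.\<close>

lemma assoc_lim_shift: assumes "x \<in> linf" shows "assoc_lim (shift x) = assoc_lim x"
proof -
  have "shift x \<in> linf"
  proof -
    obtain C where C: "\<And>n. \<bar>x n\<bar> \<le> C" using assms by (auto simp: linf_iff)
    then have "0 \<le> C" by (meson abs_ge_zero order_trans)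
    with C have "\<bar>shift x n\<bar> \<le> C" for n by (simp add: shift_def)
    then show ?thesis by (auto simp: linf_iff)
  qed
  define a b where "a = Dmap x" and "b = Dmap (shift x)"
  have wa: "wl1 a" and wb: "wl1 b" unfolding a_def b_def by (intro wl1_Dmap assms \<open>shift x \<in> linf\<close>)+
  have b0: "b 0 = 0" by (simp add: b_def Dmap_def shift_def dyad_def)
  have b: "b (2 * k + 1) = (1/2) * a k" "b (2 * k + 2) = (1/2) * a k" for k
    unfolding a_def b_def Dmap_def dyad_double by (simp_all add: shift_def)
  define b1 b2 where "b1 k = (if odd k then b k else 0)" and "b2 k = (if even k then b k else 0)" for k
  have wb12: "wl1 b1" "wl1 b2"
  proof -
    obtain C where C: "0 \<le> C" "\<And>k. \<bar>b k\<bar> \<le> C / real (k + 1)" using wl1_obtain[OF wb] by blast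
    have "\<bar>b1 k\<bar> \<le> C / real (k + 1)" "\<bar>b2 k\<bar> \<le> C / real (k + 1)" for k
      using C(2)[of k] by (auto simp: b1_def b2_def intro: order_trans[OF abs_ge_zero])
    then show "wl1 b1" "wl1 b2" by (auto intro!: weak_l1_realI)
  qed
  have "diag_trace b1 = diag_trace (\<lambda>k. (1/2) * a k)"
  proof (rule diag_trace_spread[OF inj_odd wl1_scale[OF wa] wb12(1)])
    show "b1 (2 * k + 1) = (1/2) * a k" for k using b(1)[of k] by (simp add: b1_def)
    show "b1 j = 0" if "j \<notin> range (\<lambda>k. 2 * k + 1)" for j
      using that by (auto simp: b1_def elim!: oddE)
  qed
  moreover have "diag_trace b2 = diag_trace (\<lambda>k. (1/2) * a k)"
  proof (rule diag_trace_spread[of "\<lambda>k. 2 * k + 2", OF _ wl1_scale[OF wa] wb12(2)])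
    show "b2 (2 * k + 2) = (1/2) * a k" for k using b(2)[of k] by (simp add: b2_def)
    show "b2 j = 0" if "j \<notin> range (\<lambda>k. 2 * k + 2)" for j
    proof (cases "even j \<and> j \<noteq> 0")
      case True
      then obtain i where "j = 2 * i" "i \<noteq> 0" by auto
      then have "j = 2 * (i - 1) + 2" by simp
      then show ?thesis using that by blast
    qed (auto simp: b2_def b0)
  qed (simp add: inj_def)
  moreover have "b = (\<lambda>k. b1 k + b2 k)" by (auto simp: fun_eq_iff b1_def b2_def)
  ultimately have "diag_trace b = diag_trace a"
    using diag_trace_add[OF wb12] diag_trace_scale[OF wa, of "1/2"] by simp
  then show ?thesis by (simp add: assoc_lim_diag_trace assms \<open>shift x \<in> linf\<close> a_def b_def)
qed

lemma assoc_lim_psf: "pos_shift_functional assoc_lim"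
  unfolding pos_shift_functional_def
proof (intro conjI ballI allI impI)
  fix x y assume xy: "x \<in> linf" "y \<in> linf"
  have "x + y \<in> linf" using linf_add[OF xy] by (simp add: plus_fun_def)
  moreover have "Dmap (x + y) = (\<lambda>k. Dmap x k + Dmap y k)"
    by (simp add: fun_eq_iff Dmap_def distrib_left add_divide_distrib)
  ultimately show "assoc_lim (x + y) = assoc_lim x + assoc_lim y"
    by (simp add: assoc_lim_diag_trace xy diag_trace_add wl1_Dmap)
next
  fix x c assume x: "x \<in> linf"
  have "Dmap (\<lambda>n. c * x n) = (\<lambda>k. c * Dmap x k)" by (simp add: fun_eq_iff Dmap_def)
  then show "assoc_lim (\<lambda>n. c * x n) = c * assoc_lim x"
    by (simp add: assoc_lim_diag_trace x linf_scale diag_trace_scale wl1_Dmap)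
next
  fix x assume x: "x \<in> linf" "\<forall>n. 0 \<le> x n"
  then show "0 \<le> assoc_lim x" unfolding assoc_lim_diag_trace[OF x(1)] by (intro diag_trace_nonneg wl1_Dmap) (auto simp: Dmap_def)
next
  fix x assume "x \<in> linf"
  then show "assoc_lim (shift x) = assoc_lim x" by (rule assoc_lim_shift)
qed

lemma diag_trace_sum:
  assumes "\<And>i. i \<in> I \<Longrightarrow> wl1 (A i)" "finite I" "I \<noteq> {}"
  shows "wl1 (\<lambda>k. \<Sum>i\<in>I. A i k) \<and> diag_trace (\<lambda>k. \<Sum>i\<in>I. A i k) = (\<Sum>i\<in>I. diag_trace (A i))"
  using assms(2,3,1)
proof (induction I rule: finite_ne_induct)
  case (insert i I)
  then have "wl1 (A i)" "wl1 (\<lambda>k. \<Sum>i\<in>I. A i k)" by auto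
  from wl1_add[OF this] diag_trace_add[OF this] show ?case using insert by simp
qed simp

lemma diag_trace_antimono_eq_assoc_lim:
  assumes a: "wl1 a" and anti: "\<And>i j. i \<le> j \<Longrightarrow> a j \<le> a i" and nonneg: "\<And>k. 0 \<le> a k"
  shows "diag_trace a = assoc_lim (blk a)"
proof -
  obtain C where C: "0 \<le> C" "\<And>k. \<bar>a k\<bar> \<le> C / real (k + 1)" using wl1_obtain[OF a] by blast
  have lb: "blk a \<in> linf" by (rule blk_linf[OF C(2)])
  \<comment> \<open>Its value is 1, but that is established only in
    \<open>assoc_lim_banach_limit\<close>, which relies on this lemma; here finiteness is
    enough.\<close>
  define b where "b = assoc_lim (\<lambda>_. 1)"
  have b0: "0 \<le> b" unfolding b_def by (intro psf_nonneg[OF assoc_lim_psf] linf_const) auto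
  have bound: "\<bar>diag_trace a - assoc_lim (blk a)\<bar> \<le> (C / ln 2 * b) * (1 / 2) ^ r" for r
  proof -
    define g where "g k = (1 / 2 ^ r) * (\<Sum>j<2 ^ r. a (cyc r j k))" for k
    \<comment> \<open>g averages a over 2^r rotations and has the same trace. \<open>Dmap x\<close>
      dominates its distance to the block means: the constant part of x is the mesh error, and the
      indicator part covers the blocks before r, where nothing is averaged and only the weak l1
      bound holds. The limit functional discards that second part.\<close>
    define x where "x n = (C / ln 2 * (1 / 2) ^ r) * 1 + C / ln 2 * (if n < r then 1 else 0)" for n
    have lx: "x \<in> linf" unfolding x_def by (intro linf_add linf_scale linf_const linf_indicator)
    have s: "wl1 (\<lambda>k. \<Sum>j<2 ^ r. a (cyc r j k))" "diag_trace (\<lambda>k. \<Sum>j<2 ^ r. a (cyc r j k)) = (\<Sum>j<(2::nat) ^ r. diag_trace a)"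
      using diag_trace_sum[of "{..<2 ^ r}" "\<lambda>j k. a (cyc r j k)"] wl1_cyc[OF a] diag_trace_cyc[OF a, of _ r]
      by (auto simp: lessThan_empty_iff)
    have wg: "wl1 g" unfolding g_def by (rule wl1_scale[OF s(1)])
    have fg: "diag_trace g = diag_trace a" unfolding g_def diag_trace_scale[OF s(1)] s(2) by simp
    have "\<bar>g k - Dmap (blk a) k\<bar> \<le> Dmap x k" for k
    proof -
      let ?n = "dyad k"
      have Db: "Dmap (blk a) k = (\<Sum>i\<in>block ?n. a i) / 2 ^ ?n" by (simp add: Dmap_def blk_def)
      have Dx: "Dmap x k = C * (1 / 2) ^ r / 2 ^ ?n + (if ?n < r then C / 2 ^ ?n else 0)"
        by (simp add: Dmap_def x_def field_simps)
      have ak: "a i \<le> C / 2 ^ ?n" if "2 ^ ?n \<le> i + 1" for i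
      proof -
        have "(2::real) ^ ?n \<le> real (i + 1)" using that by (metis of_nat_le_iff of_nat_numeral of_nat_power)
        then have "C / real (i + 1) \<le> C / 2 ^ ?n" using C(1) by (intro divide_left_mono) auto
        then show ?thesis using C(2)[of i] by linarith
      qed
      show ?thesis
      proof (cases "r \<le> ?n")
        case True
        have "\<bar>g k - Dmap (blk a) k\<bar> \<le> a (2 ^ ?n - 1) / 2 ^ r"
          using cyc_average_close[OF anti nonneg True] by (simp add: g_def Db)
        also have "\<dots> \<le> C / 2 ^ ?n / 2 ^ r" by (intro divide_right_mono ak) auto
        finally show ?thesis using True by (simp add: Dx power_one_over field_simps)
      next
        case False
        then have z: "(2::nat) ^ ?n div 2 ^ r = 0" by simp
        have "cyc r j k = k" for j
        proof -
          have "k + 1 - 2 ^ ?n < 2 ^ ?n" using dyad_bounds[of k] by simp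
          then show ?thesis using cyc_Suc[of r j k] dyad_bounds(1)[of k] unfolding z by simp
        qed
        then have "g k = a k" by (simp add: g_def)
        moreover have "a k \<le> C / 2 ^ ?n" by (rule ak[OF dyad_bounds(1)])
        moreover have "(\<Sum>i\<in>block ?n. a i) \<le> (\<Sum>i\<in>block ?n. C / 2 ^ ?n)"
          using dyad_bounds(1) by (intro sum_mono ak) (metis block_iff)
        then have "(\<Sum>i\<in>block ?n. a i) \<le> C" by (simp add: card_block)
        then have "(\<Sum>i\<in>block ?n. a i) / 2 ^ ?n \<le> C / 2 ^ ?n" by (simp add: divide_right_mono)
        moreover have "0 \<le> (\<Sum>i\<in>block ?n. a i) / 2 ^ ?n" using nonneg by (simp add: sum_nonneg)
        moreover have "0 \<le> C * (1 / 2) ^ r / 2 ^ ?n" using C(1) by simp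
        ultimately show ?thesis using False nonneg[of k] unfolding Dx Db by simp
      qed
    qed
    then have "\<bar>diag_trace (\<lambda>k. g k - Dmap (blk a) k)\<bar> \<le> diag_trace (Dmap x)"
      by (intro diag_trace_abs_le wl1_diff wg wl1_Dmap lb lx)
    then have "\<bar>diag_trace a - assoc_lim (blk a)\<bar> \<le> assoc_lim x"
      by (simp add: diag_trace_diff wg wl1_Dmap lb fg assoc_lim_diag_trace lx)
    also have "assoc_lim x = (C / ln 2 * (1 / 2) ^ r) * b + C / ln 2 * 0"
      unfolding x_def b_def
      by (simp only: psf_add[OF assoc_lim_psf linf_scale[OF linf_const] linf_scale[OF linf_indicator]]
          psf_scale[OF assoc_lim_psf linf_const] psf_scale[OF assoc_lim_psf linf_indicator] psf_initial_segment[OF assoc_lim_psf])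
    finally show ?thesis by (simp add: mult_ac)
  qed
  have "(\<lambda>r. (C / ln 2 * b) * (1 / 2) ^ r) \<longlonglongrightarrow> (C / ln 2 * b) * 0"
    by (intro tendsto_intros LIMSEQ_power_zero) auto
  then have "\<bar>diag_trace a - assoc_lim (blk a)\<bar> \<le> (C / ln 2 * b) * 0"
    by (rule LIMSEQ_le_const) (blast intro: bound)
  then show ?thesis by simp
qed

lemma trace_eq_assoc_lim:
  assumes "T \<in> L1bop" "posop T" shows "\<tau> (to_op T) = of_real (assoc_lim (blk (\<lambda>k. sv k T)))"
proof -
  have "Re (btrace \<tau> T) = assoc_lim (blk (\<lambda>k. sv k T))"
    unfolding btrace_eq_diagonal[OF \<tau> assms] diag_trace_def[symmetric]
    by (rule diag_trace_antimono_eq_assoc_lim[OF weak_l1_sv[OF assms(1)] sv_antimono[OF L1bop_cpt[OF assms(1)]] sv_nonneg])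
  then show ?thesis using btrace_posop(1)[OF \<tau> assms] by (simp add: btrace_def[OF \<tau>] complex_eq_iff)
qed

text \<open>The harmonic diagonal has trace 1 by normalisation, while its block sums converge to 1;
  comparing the two gives the value at the constant 1.\<close>

lemma assoc_lim_banach_limit: "banach_limit assoc_lim"
proof -
  let ?h = "\<lambda>k. 1 / real (k + 1)"
  have wh: "wl1 ?h" by (rule weak_l1_realI[of _ 1]) simp
  have sv: "sv n (dg (\<lambda>k. of_real (?h k))) = ?h n" for n
    by (rule sv_dg_antimono) (auto intro!: divide_left_mono)
  have p: "posop (dg (\<lambda>k. of_real (?h k)))" by (rule posop_dg[OF wl1_bounded[OF wh]]) simp
  have "assoc_lim (blk ?h) = 1"
    using btrace_normalised[OF \<tau> L1bop_dg[OF wh] p sv] trace_eq_assoc_lim[OF L1bop_dg[OF wh] p] unfolding sv btrace_def[OF \<tau>]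
    by (metis of_real_eq_1_iff)
  then have "assoc_lim (\<lambda>_. 1) = 1" using psf_tendsto[OF assoc_lim_psf blk_harmonic] by simp
  then show ?thesis using assoc_lim_psf by (simp add: banach_limit_alt)
qed

end

section \<open>Injectivity and surjectivity of the passage from traces to Banach limits\<close>

lemma trace_determined:
  assumes "\<tau> \<in> PT" "\<sigma> \<in> PT" "\<And>x. x \<in> linf \<Longrightarrow> assoc_lim \<tau> x = assoc_lim \<sigma> x" "A \<in> L1inf"
  shows "\<tau> A = \<sigma> A"
proof -
  obtain T where T: "A = to_op T" "T \<in> L1bop" using L1inf_obtain[OF assms(4)] .
  \<comment> \<open>On a positive operator both traces apply their Banach limit to the same block
    sums of singular values; linearity and \<open>positive_decomposition\<close> do the
    rest.\<close>
  have p: "btrace \<tau> P = btrace \<sigma> P" if "P \<in> L1bop" "posop P" for P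
    using trace_eq_assoc_lim[OF assms(1) that] trace_eq_assoc_lim[OF assms(2) that] assms(3)[OF sv_blk_linf[OF that(1)]]
    by (simp add: btrace_def assms(1,2))
  obtain P Q R S where d: "P \<in> L1bop" "Q \<in> L1bop" "R \<in> L1bop" "S \<in> L1bop" "posop P" "posop Q" "posop R" "posop S"
    "T = P - Q + sc \<i> * (R - S)" using positive_decomposition[OF T(2)] by blast
  have "T = P + sc (- 1) * Q + (sc \<i> * R + sc (- \<i>) * S)" unfolding d(9) by (simp add: algebra_simps)
  then have "btrace \<rho> T = btrace \<rho> P + (- 1) * btrace \<rho> Q + (\<i> * btrace \<rho> R + (- \<i>) * btrace \<rho> S)" if "\<rho> \<in> PT" for \<rho>
    by (simp only: btrace_add[OF that] btrace_scale[OF that] L1bop_add L1bop_left d(1-4))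
  then have "btrace \<tau> T = btrace \<sigma> T" by (simp add: assms(1,2) p d(1-8))
  then show ?thesis by (simp add: T(1) btrace_def assms(1,2))
qed

lemma trace_of_realises:
  assumes B: "banach_limit B" and x: "x \<in> linf"
  shows "assoc_lim (trace_of B) x = B x"
proof -
  note PT = trace_of_PT[OF B]
  note psfs = assoc_lim_psf[OF PT] psf[OF B]
  have special: "assoc_lim (trace_of B) y = B y" if "\<And>n. 1 \<le> y n" "\<And>n. y n \<le> 2" for y
    unfolding assoc_lim_def[OF PT] trace_of_Dmap_special[OF B that] by simp
  obtain M where M: "\<And>n. \<bar>x n\<bar> \<le> M" using x by (auto simp: linf_iff)
  \<comment> \<open>K is chosen so that x / K has absolute value at most 1/2; the translate by 3/2
    then has values in [1,2], and the constant 3/2 is itself such a sequence, so both are covered by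
    \<open>special\<close>.\<close>
  define K where "K = 2 * (M + 1)"
  have K: "K > 0" using M[of 0] by (simp add: K_def)
  define y where "y n = 3 / 2 + x n / K" for n
  have xK: "\<bar>x n / K\<bar> \<le> 1 / 2" for n
  proof -
    have "\<bar>x n\<bar> \<le> K / 2" using M[of n] by (simp add: K_def)
    then show ?thesis using K by (simp add: abs_divide pos_divide_le_eq)
  qed
  have y: "1 \<le> y n" "y n \<le> 2" for n
    unfolding y_def using xK[of n] by linarith+
  have "\<bar>y n\<bar> \<le> 2" for n using y[of n] by linarith
  then have ly: "y \<in> linf" by (auto simp: linf_iff)
  have xe: "x = (\<lambda>n. K * (y n - 3 / 2))" using K by (simp add: y_def fun_eq_iff)
  have lin: "F x = K * (F y - F (\<lambda>_. 3 / 2))" if "pos_shift_functional F" for F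
    by (subst xe) (simp only: psf_scale[OF that linf_diff[OF ly linf_const]] psf_diff[OF that ly linf_const])
  have "assoc_lim (trace_of B) y = B y" by (rule special) (rule y)+
  moreover have "assoc_lim (trace_of B) (\<lambda>_. 3 / 2) = B (\<lambda>_. 3 / 2)" by (rule special) auto
  ultimately show ?thesis by (simp add: lin[OF psfs(1)] lin[OF psfs(2)])
qed

text \<open>A convex decomposition of the Banach limit of a trace lifts to a combination of induced
  traces. This combination has to be a member of \<open>PT\<close> before injectivity can identify
  it with the given trace.\<close>

lemma PT_convex:
  assumes "\<sigma> \<in> PT" "\<rho> \<in> PT" "0 < u" "u < 1"
  shows "(\<lambda>A. u *\<^sub>R \<sigma> A + (1 - u) *\<^sub>R \<rho> A) \<in> PT"
  unfolding PT_def positive_trace_def is_trace_def normalised_def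
proof (intro CollectI conjI ballI allI impI; (elim conjE)?)
  fix A B assume "A \<in> L1inf" "B \<in> L1inf"
  then show "u *\<^sub>R \<sigma> (A + B) + (1 - u) *\<^sub>R \<rho> (A + B) = u *\<^sub>R \<sigma> A + (1 - u) *\<^sub>R \<rho> A + (u *\<^sub>R \<sigma> B + (1 - u) *\<^sub>R \<rho> B)"
    using assms unfolding PT_def positive_trace_def is_trace_def by (simp add: scaleR_add_right)
next
  fix A c assume "A \<in> L1inf"
  then show "u *\<^sub>R \<sigma> (\<lambda>x k. c * A x k) + (1 - u) *\<^sub>R \<rho> (\<lambda>x k. c * A x k) = c * (u *\<^sub>R \<sigma> A + (1 - u) *\<^sub>R \<rho> A)"
    using assms unfolding PT_def positive_trace_def is_trace_def by (simp add: distrib_left)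
next
  fix A U V assume "A \<in> L1inf" "unitary_op U" "is_adjoint U V"
  then have "\<sigma> (U \<circ> A \<circ> V) = \<sigma> A" "\<rho> (U \<circ> A \<circ> V) = \<rho> A"
    using assms unfolding PT_def positive_trace_def is_trace_def by blast+
  then show "u *\<^sub>R \<sigma> (U \<circ> A \<circ> V) + (1 - u) *\<^sub>R \<rho> (U \<circ> A \<circ> V) = u *\<^sub>R \<sigma> A + (1 - u) *\<^sub>R \<rho> A" by simp
next
  fix A assume "A \<in> L1inf" "positive_op A"
  then show "Im (u *\<^sub>R \<sigma> A + (1 - u) *\<^sub>R \<rho> A) = 0" "0 \<le> Re (u *\<^sub>R \<sigma> A + (1 - u) *\<^sub>R \<rho> A)"
    using assms unfolding PT_def positive_trace_def by auto
next
  fix A assume "A \<in> L1inf" "positive_op A" "\<forall>n. sval n A = 1 / real (n + 1)"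
  then have "\<sigma> A = 1" "\<rho> A = 1" using assms unfolding PT_def normalised_def by blast+
  then show "u *\<^sub>R \<sigma> A + (1 - u) *\<^sub>R \<rho> A = 1" by (simp flip: scaleR_add_left)
qed

theorem theorem4p10:
  fixes \<tau> :: "op \<Rightarrow> complex"
  assumes "\<tau> \<in> PT"
  shows "extreme_pt_on L1inf PT \<tau> \<longleftrightarrow>
         extreme_pt_on linf BL (\<lambda>x. Re (\<tau> (diag (\<lambda>k. complex_of_real (Dmap x k)))))"
proof -
  have assoc_lim: "(\<lambda>x. Re (\<sigma> (diag (\<lambda>k. complex_of_real (Dmap x k))))) = assoc_lim \<sigma>" if "\<sigma> \<in> PT" for \<sigma>
    by (simp add: fun_eq_iff assoc_lim_def[OF that])
  have diag: "diag (\<lambda>k. complex_of_real (Dmap x k)) \<in> L1inf" if "x \<in> linf" for x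
    using L1bop_dg[OF wl1_Dmap[OF that]] to_op_dg[OF weak_l1_bounded[OF wl1_Dmap[OF that]]] by (simp add: L1bop_def)
  show ?thesis unfolding assoc_lim[OF assms]
  proof
    assume ext: "extreme_pt_on L1inf PT \<tau>"
    show "extreme_pt_on linf BL (assoc_lim \<tau>)"
      unfolding extreme_pt_on_def
    proof (intro conjI ballI allI impI)
      show "assoc_lim \<tau> \<in> BL" using assoc_lim_banach_limit[OF assms] by (simp add: BL_def)
    next
      fix G H :: "(nat \<Rightarrow> real) \<Rightarrow> real" and u :: real and x
      assume "G \<in> BL" "H \<in> BL" and u: "0 < u \<and> u < 1 \<and> (\<forall>a\<in>linf. assoc_lim \<tau> a = u *\<^sub>R G a + (1 - u) *\<^sub>R H a)"
        and x: "x \<in> linf"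
      then have G: "banach_limit G" and H: "banach_limit H" by (simp_all add: BL_def)
      let ?g = "trace_of G" and ?h = "trace_of H"
      note PT = trace_of_PT[OF G] trace_of_PT[OF H]
      let ?\<sigma> = "\<lambda>A. u *\<^sub>R ?g A + (1 - u) *\<^sub>R ?h A"
      have \<sigma>: "?\<sigma> \<in> PT" using u by (intro PT_convex PT) auto
      have "assoc_lim \<tau> y = assoc_lim ?\<sigma> y" if "y \<in> linf" for y
        using u that trace_of_realises[OF G that] trace_of_realises[OF H that]
        unfolding assoc_lim_def[OF \<sigma>] assoc_lim_def[OF PT(1)] assoc_lim_def[OF PT(2)] by simp
      \<comment> \<open>Both traces have the same Banach limit, so injectivity turns the
        decomposition of the limit into one of \<tau>, to which extremality applies.\<close>
      then have "\<tau> A = ?\<sigma> A" if "A \<in> L1inf" for A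
        using trace_determined[OF assms \<sigma> _ that] by blast
      then have "?g A = \<tau> A \<and> ?h A = \<tau> A" if "A \<in> L1inf" for A
        using ext u PT that unfolding extreme_pt_on_def by blast
      from this[OF diag[OF x]] have "assoc_lim ?g x = assoc_lim \<tau> x" "assoc_lim ?h x = assoc_lim \<tau> x"
        unfolding assoc_lim_def[OF PT(1)] assoc_lim_def[OF PT(2)] assoc_lim_def[OF assms] by simp_all
      then show "G x = assoc_lim \<tau> x" "H x = assoc_lim \<tau> x"
        by (simp_all add: trace_of_realises[OF G x] trace_of_realises[OF H x])
    qed
  next
    assume ext: "extreme_pt_on linf BL (assoc_lim \<tau>)"
    show "extreme_pt_on L1inf PT \<tau>"
      unfolding extreme_pt_on_def
    proof (intro conjI ballI allI impI)
      show "\<tau> \<in> PT" by (rule assms)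
    next
      fix g h :: "op \<Rightarrow> complex" and u :: real and A
      assume g: "g \<in> PT" and h: "h \<in> PT"
        and u: "0 < u \<and> u < 1 \<and> (\<forall>a\<in>L1inf. \<tau> a = u *\<^sub>R g a + (1 - u) *\<^sub>R h a)" and A: "A \<in> L1inf"
      \<comment> \<open>Evaluation on diagonal operators is linear in the trace, so a decomposition
        of \<tau> descends to the limits. Once extremality makes those equal, injectivity returns to
        all of \<open>L1inf\<close>.\<close>
      have "assoc_lim \<tau> x = u *\<^sub>R assoc_lim g x + (1 - u) *\<^sub>R assoc_lim h x" if "x \<in> linf" for x
        using u diag[OF that] unfolding assoc_lim_def[OF assms] assoc_lim_def[OF g] assoc_lim_def[OF h] by simp
      moreover have "assoc_lim g \<in> BL" "assoc_lim h \<in> BL"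
        using assoc_lim_banach_limit g h by (simp_all add: BL_def)
      ultimately have "assoc_lim g x = assoc_lim \<tau> x \<and> assoc_lim h x = assoc_lim \<tau> x" if "x \<in> linf" for x
        using ext u that unfolding extreme_pt_on_def by blast
      then show "g A = \<tau> A" "h A = \<tau> A"
        using trace_determined[OF g assms _ A] trace_determined[OF h assms _ A] by blast+
    qed
  qed
qed

end
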